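(* Let $\mathbb{K}$ be a number field and assume that the $\mathbb{K}$-rational $abc$-Conjecture holds: for every $\varepsilon>0$ there exists a constant $C(\varepsilon)$ such that for all $\alpha\in\mathbb{K}\setminus\{0,1\}$, \[ (1-\varepsilon)h(\alpha)\le \sum_{\substack{v\in M_{\mathbb{K}}^0\\ v(\alpha)>0}}\log\left|\frac{1}{\pi_v}\right|_v+\sum_{\substack{v\in M_{\mathbb{K}}^0\\ v(1-\alpha)>0}}\log\left|\frac{1}{\pi_v}\right|_v+\sum_{\substack{v\in M_{\mathbb{K}}^0\\ v(1/\alpha)>0}}\log\left|\frac{1}{\pi_v}\right|_v+C(\varepsilon). \] Let $f\in\mathbb{K}[X]$ be a polynomial of degree $d\ge 3$ having only simple roots and such that $0\notin\operatorname{Per}(f)$. Then for any finite set of places $\mathcal{S}$ of $\mathbb{K}$, the set \[ \mathcal{V}(\mathbb{K},f,\mathcal{S})=\left\{\alpha\in\mathbb{K}:~\exists\,(n,\ell,a)\in\mathbb{Z}_{\ge 1}\times\mathbb{Z}_{\ne 0,1}\times R_{\mathcal{S}}\text{ such that } f^{(n)}(\alpha)=a^{\ell}\alpha\right\} \] is finite.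
   Context: $M_{\mathbb{K}}$ is the set of places of $\mathbb{K}$ and $M_{\mathbb{K}}^0$ the set of non-Archimedean ones. Each $v\in M_{\mathbb{K}}^0$ comes from a prime ideal $\mathfrak{p}_v$ of the ring of integers of $\mathbb{K}$, and $v(\alpha)=\operatorname{ord}_{\mathfrak{p}_v}(\alpha)$ is the normalised valuation; for each such $v$ a uniformizer $\pi_v\in\mathbb{K}$ with $v(\pi_v)=1$ is fixed. The absolute values $|\cdot|_v$ are normalised so that $h(\beta)=\sum_{v\in M_{\mathbb{K}}}\log\max\{|\beta|_v,1\}$ is the absolute logarithmic Weil height. $f^{(n)}$ denotes the $n$-th iterate of $f$, and $\operatorname{Per}(f)$ is the set of $\beta$ in an algebraic closure of $\mathbb{K}$ with $f^{(n)}(\beta)=\beta$ for some $n\ge1$. $\mathbb{Z}_{\ne 0,1}$ is the set of integers different from $0$ and $1$. $R_{\mathcal{S}}$ is the ring of $\mathcal{S}$-integers of $\mathbb{K}$ (elements $x$ with $v(x)\ge 0$ for every non-Archimedean place $v\notin\mathcal{S}$). When $\ell<0$, $a^\ell$ requires $a\ne 0$. *)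

theory Defs
  imports
    "HOL-Analysis.Analysis"
    "HOL-Algebra.Ideal_Product"
    "HOL-Algebra.QuotRing"
    "HOL-Algebra.Algebraic_Closure_Type"
begin

section \<open>Number fields\<close>

abbreviation rat_scale :: "rat \<Rightarrow> 'k::field_char_0 \<Rightarrow> 'k"
  where "rat_scale q x \<equiv> of_rat q * x"

definition number_field :: "'k::field_char_0 itself \<Rightarrow> bool"
  where "number_field _ \<longleftrightarrow>
    (\<exists>B. finite_dimensional_vector_space (rat_scale :: rat \<Rightarrow> 'k \<Rightarrow> 'k) B)"

definition field_degree :: "'k::field_char_0 itself \<Rightarrow> nat"
  where "field_degree _ = vector_space.dim (rat_scale :: rat \<Rightarrow> 'k \<Rightarrow> 'k) UNIV"

definition ring_of_integers :: "'k::field_char_0 ring"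
  where "ring_of_integers = ring_of_type_algebra \<lparr> carrier := {x. algebraic_int x} \<rparr>"


section \<open>Places\<close>

text \<open>A non-Archimedean place is given by a nonzero prime ideal of the ring of integers,
  an Archimedean one by a pair of complex conjugate embeddings; the pair is a singleton
  exactly when the embedding is real.\<close>

datatype 'k place =
    Nonarch (prime_of: "'k set")
  | Arch (embeddings_of: "('k \<Rightarrow> complex) set")

definition nonarch_places :: "'k::field_char_0 place set"
  where "nonarch_places = Nonarch ` {P. primeideal P ring_of_integers \<and> P \<noteq> {0}}"

definition arch_places :: "'k::field_char_0 place set"
  where "arch_places =
    (\<lambda>\<sigma>. Arch {\<sigma>, cnj \<circ> \<sigma>}) ` ring_hom ring_of_type_algebra ring_of_type_algebra"

definition places :: "'k::field_char_0 place set"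
  where "places = nonarch_places \<union> arch_places"


section \<open>Valuations, absolute values and height\<close>

definition ord_integer :: "'k::field_char_0 set \<Rightarrow> 'k \<Rightarrow> nat"
  where "ord_integer P a = (GREATEST n. a \<in> P [^]\<^bsub>ideals_set ring_of_integers\<^esub> n)"

text \<open>The normalised valuation of the non-Archimedean place \<open>v\<close>. The value at \<open>0\<close>, which should
  be \<open>\<infinity>\<close>, is set to the dummy \<open>0\<close>. This is harmless: below, \<open>0\<close> is either treated separately or
  excluded, and since the dummy is not \<open>1\<close>, uniformizers are nonzero.\<close>

definition val :: "'k::field_char_0 place \<Rightarrow> 'k \<Rightarrow> int"
  where "val v x = (if x = 0 then 0 else
    (THE k. \<exists>a b. a \<in> carrier ring_of_integers \<and> b \<in> carrier ring_of_integers \<and>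
       a \<noteq> 0 \<and> b \<noteq> 0 \<and> x = a / b \<and>
       k = int (ord_integer (prime_of v) a) - int (ord_integer (prime_of v) b)))"

definition ideal_norm :: "'k::field_char_0 set \<Rightarrow> nat"
  where "ideal_norm P = card (carrier (ring_of_integers Quot P))"

text \<open>The usual absolute values, raised to the power local degree over global degree. For a
  prime \<open>P\<close> above \<open>p\<close> with ramification index \<open>e\<close> and inertia degree \<open>f\<close>, the norm of \<open>P\<close> is
  \<open>p ^ f\<close>, so the value below is \<open>p powr (- ord x / e)\<close> raised to the power \<open>e * f / degree\<close>.
  At an Archimedean place the local degree is the number of embeddings in the conjugate pair.\<close>

definition place_abs :: "'k::field_char_0 place \<Rightarrow> 'k \<Rightarrow> real"
  where "place_abs v x = (case v of
      Nonarch P \<Rightarrow>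
        if x = 0 then 0
        else real (ideal_norm P) powr (- real_of_int (val v x) / real (field_degree TYPE('k)))
    | Arch E \<Rightarrow>
        cmod ((SOME \<sigma>. \<sigma> \<in> E) x) powr (real (card E) / real (field_degree TYPE('k))))"

text \<open>Over a number field only finitely many summands are nonzero.\<close>

definition weil_height :: "'k::field_char_0 \<Rightarrow> real"
  where "weil_height x = (\<Sum>\<^sub>\<infinity>v\<in>places. ln (max (place_abs v x) 1))"

definition S_integers :: "'k::field_char_0 place set \<Rightarrow> 'k set"
  where "S_integers S = {x. \<forall>v\<in>nonarch_places - S. x = 0 \<or> val v x \<ge> 0}"


section \<open>The abc-conjecture\<close>

definition uniformizers :: "('k::field_char_0 place \<Rightarrow> 'k) \<Rightarrow> bool"
  where "uniformizers \<pi> \<longleftrightarrow> (\<forall>v\<in>nonarch_places. val v (\<pi> v) = 1)"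

definition abc_conjecture :: "('k::field_char_0 place \<Rightarrow> 'k) \<Rightarrow> bool"
  where "abc_conjecture \<pi> \<longleftrightarrow>
    (\<forall>\<epsilon>>0. \<exists>C. \<forall>\<alpha>. \<alpha> \<notin> {0, 1} \<longrightarrow>
       (1 - \<epsilon>) * weil_height \<alpha> \<le>
           (\<Sum>v \<in> {v \<in> nonarch_places. val v \<alpha> > 0}. ln (place_abs v (1 / \<pi> v)))
         + (\<Sum>v \<in> {v \<in> nonarch_places. val v (1 - \<alpha>) > 0}. ln (place_abs v (1 / \<pi> v)))
         + (\<Sum>v \<in> {v \<in> nonarch_places. val v (1 / \<alpha>) > 0}. ln (place_abs v (1 / \<pi> v)))
         + C)"


section \<open>Dynamics\<close>

definition Per :: "'k::field poly \<Rightarrow> 'k alg_closure set"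
  where "Per f = {\<beta>. \<exists>n\<ge>1. (poly (map_poly to_ac f) ^^ n) \<beta> = \<beta>}"

text \<open>Simplicity is required of the roots in the algebraic closure.\<close>

definition only_simple_roots :: "'k::field poly \<Rightarrow> bool"
  where "only_simple_roots f \<longleftrightarrow> rsquarefree (map_poly to_ac f)"

text \<open>In Isabelle \<open>0 powi l = 0\<close> for negative \<open>l\<close>, hence the explicit requirement \<open>a \<noteq> 0\<close>.\<close>

definition \<V> :: "'k::field_char_0 poly \<Rightarrow> 'k place set \<Rightarrow> 'k set"
  where "\<V> f S = {\<alpha>. \<exists>(n::nat) (l::int) a.
     n \<ge> 1 \<and> l \<noteq> 0 \<and> l \<noteq> 1 \<and> a \<in> S_integers S \<and> (l < 0 \<longrightarrow> a \<noteq> 0) \<and>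
     (poly f ^^ n) \<alpha> = (a powi l) * \<alpha>}"

end

theory Submission imports Defs "Jordan_Normal_Form.Char_Poly" begin

text \<open>Let \<open>h\<close> be the Weil height and \<open>N(x)\<close> the sum of the weights of the finite places at which \<open>x\<close>
  vanishes. The \<open>abc\<close> conjecture is the case \<open>g = X (X - 1)\<close> of the bound
  \<open>(deg g - 1 - \<epsilon>) h(\<beta>) \<le> N(g(\<beta>)) + N(1/\<beta>) + O(1)\<close>, and Belyi maps that are polynomials carry it over to
  every \<open>g\<close> with simple roots. Apply it to \<open>f\<close> at \<open>\<beta> = f^{n-1}(\<alpha>)\<close>, where \<open>f(\<beta>) = a^l \<alpha>\<close>. For \<open>l < 0\<close> a
  zero of \<open>f(\<beta>)\<close> outside \<open>\<S>\<close> is a zero of \<open>\<alpha>\<close>. For \<open>l \<ge> 2\<close> the other zeros are at least double, so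
  they contribute at most \<open>h(f(\<beta>))/2\<close> to \<open>N(f(\<beta>))\<close>, and \<open>\<beta>\<close> has its poles in \<open>\<S>\<close>. Common zeros of \<open>\<alpha>\<close>
  and \<open>f(\<beta>)\<close> divide \<open>f^n(0)\<close>, which is not \<open>0\<close>, and for large \<open>n\<close> they are controlled by
  \<open>h(\<alpha>) \<approx> h(\<beta>)/d^{n-1}\<close>. In all cases \<open>h(\<beta>)\<close> is bounded and Northcott's theorem applies.
  The product formula used for the height comes from the index of principal ideals.\<close>

text \<open>The obstacle is the term N(1/\<beta>), which may be as large as h(\<beta>). A Belyi map
  must not enlarge it, and a polynomial, having its only pole at infinity, guarantees this. For l <
  0 the term is estimated trivially at the cost of a full h(\<beta>): with D = deg f, \<epsilon> =
  1/8 and a further 1/8 for the common zeros, (D - 1) - 1 - 1/4 \<ge> 3/4 of h(\<beta>) remains when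
  D \<ge> 3. For l \<ge> 2 the term is bounded, but the multiple zeros cost D/2, which leaves D/2 -
  5/4 \<ge> 1/4. The value l = 1 is out of reach because the zeros of f(\<beta>) may then be simple.
  A bound for h(\<beta>) uniform in n is enough, as h(\<alpha>) \<le> h(\<beta>) + O(1). On the
  arithmetic side no factorisation of ideals is developed: products of prime powers are described by
  valuations, and the finiteness of residue rings comes from one fact, that the integers of
  \<rat>(\<theta>) lie in (1/\<Delta>) \<int>[\<theta>] for some integer \<Delta>.\<close>

section \<open>Linear systems and divisibility of polynomials\<close>

text \<open>Gaussian elimination: one equation is spent on one unknown, and the reduced system still
  has more unknowns than equations. The later dimension counts (powers of an element, or of a
  polynomial modulo another) use it.\<close>

lemma homogeneous_system_nontrivial:
  fixes c :: "'j \<Rightarrow> 'i \<Rightarrow> 'a::field"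
  assumes "finite I" "finite J" "card I < card J"
  shows "\<exists>a. (\<exists>j\<in>J. a j \<noteq> 0) \<and> (\<forall>i\<in>I. (\<Sum>j\<in>J. a j * c j i) = 0)"
  using assms
proof (induction I arbitrary: J c rule: finite_induct)
  case empty
  then have "J \<noteq> {}" by auto
  then show ?case by (intro exI[of _ "\<lambda>_. 1"]) auto
next
  case (insert i I)
  show ?case
  proof (cases "\<forall>j\<in>J. c j i = 0")
    case True
    have "card I < card J" using insert by simp
    from insert.IH[OF insert.prems(1) this, of c] True show ?thesis by force
  next
    case False
    then obtain j0 where j0: "j0 \<in> J" "c j0 i \<noteq> 0" by auto
    define J' where "J' = J - {j0}"
    \<comment> \<open>Elimination of the unknown \<open>j0\<close> by means of equation
      \<open>i\<close>; \<open>a\<close> below is the back substitution.\<close>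
    define c' where "c' = (\<lambda>j k. c j k - c j i / c j0 i * c j0 k)"
    have J': "finite J'" "card I < card J'" using insert j0 by (auto simp: J'_def)
    from insert.IH[OF J', of c'] obtain a' where
      a': "\<exists>j\<in>J'. a' j \<noteq> 0" "\<And>k. k \<in> I \<Longrightarrow> (\<Sum>j\<in>J'. a' j * c' j k) = 0" by blast
    define a where "a = (\<lambda>j. if j = j0 then - (\<Sum>j\<in>J'. a' j * c j i) / c j0 i else a' j)"
    have split: "(\<Sum>j\<in>J. a j * c j k) = a j0 * c j0 k + (\<Sum>j\<in>J'. a' j * c j k)" for k
    proof -
      have "(\<Sum>j\<in>J. a j * c j k) = a j0 * c j0 k + (\<Sum>j\<in>J'. a j * c j k)"
        unfolding J'_def using insert.prems(1) j0(1) by (rule sum.remove)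
      also have "(\<Sum>j\<in>J'. a j * c j k) = (\<Sum>j\<in>J'. a' j * c j k)"
        by (rule sum.cong) (auto simp: a_def J'_def)
      finally show ?thesis .
    qed
    have "(\<Sum>j\<in>J. a j * c j k) = 0" if "k \<in> insert i I" for k
    proof (cases "k = i")
      case True
      then show ?thesis using j0 unfolding split by (simp add: a_def)
    next
      case False
      with that have "k \<in> I" by auto
      from a'(2)[OF this] have "(\<Sum>j\<in>J'. a' j * c j k) = (\<Sum>j\<in>J'. a' j * c j i) / c j0 i * c j0 k"
        by (simp add: c'_def right_diff_distrib sum_subtractf sum_distrib_right sum_divide_distrib mult.assoc)
      then show ?thesis unfolding split by (simp add: a_def)
    qed
    moreover have "\<exists>j\<in>J. a j \<noteq> 0" using a'(1) by (auto simp: a_def J'_def)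
    ultimately show ?thesis by blast
  qed
qed

text \<open>Over an algebraically closed field a root of \<open>p\<close> can be stripped from both
  polynomials, which preserves the comparison of multiplicities.\<close>

lemma dvd_if_order_le:
  fixes p q :: "'a::alg_closed_field poly"
  assumes "p \<noteq> 0" "q \<noteq> 0" "\<And>x. Polynomial.order x p \<le> Polynomial.order x q"
  shows "p dvd q"
  using assms
proof (induction "Polynomial.degree p" arbitrary: p q)
  case 0
  then show ?case by (metis is_unit_iff_degree unit_imp_dvd)
next
  case (Suc n)
  obtain x where x: "poly p x = 0"
    using alg_closed_imp_poly_has_root[of p] Suc.hyps(2) by auto
  have "Polynomial.order x p > 0" using x Suc.prems by (simp add: order_root)
  with Suc.prems(3)[of x] have xq: "poly q x = 0" by (simp add: order_root)
  obtain p1 where p1: "p = [:-x, 1:] * p1" using x by (metis dvdE poly_eq_0_iff_dvd)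
  obtain q1 where q1: "q = [:-x, 1:] * q1" using xq by (metis dvdE poly_eq_0_iff_dvd)
  have nz: "p1 \<noteq> 0" "q1 \<noteq> 0" using Suc.prems p1 q1 by auto
  have "Polynomial.degree p = Suc (Polynomial.degree p1)" using nz unfolding p1 by (subst degree_mult_eq) auto
  then have deg: "n = Polynomial.degree p1" using Suc.hyps(2) by simp
  have "Polynomial.order y p1 \<le> Polynomial.order y q1" for y
  proof -
    have "Polynomial.order y p = Polynomial.order y [:-x, 1:] + Polynomial.order y p1"
      "Polynomial.order y q = Polynomial.order y [:-x, 1:] + Polynomial.order y q1"
      using Suc.prems(1,2) order_mult[of "[:-x, 1:]" p1 y] order_mult[of "[:-x, 1:]" q1 y]
      unfolding p1 q1 by blast+
    then show ?thesis using Suc.prems(3)[of y] by linarith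
  qed
  from Suc.hyps(1)[OF deg nz this] have "p1 dvd q1" .
  then show ?case unfolding p1 q1 by (rule mult_dvd_mono[OF dvd_refl])
qed

section \<open>Algebraic integers\<close>

interpretation zmod: Modules.module "\<lambda>(n::int) (x::'a::field_char_0). of_int n * x"
  by unfold_locales (auto simp: algebra_simps)

lemma zspan_mult:
  fixes z :: "'a::field_char_0"
  assumes "\<And>w. w \<in> W \<Longrightarrow> z * w \<in> zmod.span V" "v \<in> zmod.span W"
  shows "z * v \<in> zmod.span V"
  using assms(2)
proof (induction rule: zmod.span_induct_alt)
  case base
  then show ?case by (simp add: zmod.span_zero)
next
  case (step c x y)
  have "z * (of_int c * x + y) = of_int c * (z * x) + z * y" by (simp add: algebra_simps)
  then show ?case using step assms(1) by (auto intro!: zmod.span_add zmod.span_scale)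
qed

text \<open>The determinant trick: multiplication by \<open>z\<close> on the generators
  \<open>W\<close> has an integer matrix, the tuple of generators is an eigenvector for
  \<open>z\<close>, and the characteristic polynomial is monic with integer coefficients. The
  nonzero \<open>w0\<close> makes the eigenvector nonzero.\<close>

lemma algebraic_int_stable_module:
  fixes z :: "'a::field_char_0"
  assumes "finite W" "w0 \<in> W" "w0 \<noteq> 0" "\<And>w. w \<in> W \<Longrightarrow> z * w \<in> zmod.span W"
  shows "algebraic_int z"
proof -
  obtain f N where f: "bij_betw f {..<N::nat} W"
    using assms(1) by (metis ex_bij_betw_nat_finite atLeast0LessThan)
  have "\<exists>c. \<forall>w\<in>W. z * w = (\<Sum>v\<in>W. of_int (c w v) * v)"
  proof -
    have "\<exists>u. z * w = (\<Sum>v\<in>W. of_int (u v) * v)" if "w \<in> W" for w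
      using assms(4)[OF that] unfolding zmod.span_finite[OF assms(1)] by auto
    then show ?thesis by metis
  qed
  then obtain c :: "'a \<Rightarrow> 'a \<Rightarrow> int" where c: "\<And>w. w \<in> W \<Longrightarrow> z * w = (\<Sum>v\<in>W. of_int (c w v) * v)" by auto
  define A :: "int mat" where "A = Matrix.mat N N (\<lambda>(i,j). c (f i) (f j))"
  define B :: "'a mat" where "B = map_mat of_int A"
  define x where "x = Matrix.vec N f"
  have A: "A \<in> carrier_mat N N" and B: "B \<in> carrier_mat N N" by (auto simp: A_def B_def)
  have "eigenvector B x z"
    unfolding eigenvector_def
  proof (intro conjI)
    show "x \<in> carrier_vec (dim_row B)" using B by (simp add: x_def)
    obtain i0 where "i0 < N" "f i0 = w0" using f assms(2) unfolding bij_betw_def by auto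
    then have "vec_index x i0 \<noteq> vec_index (0\<^sub>v (dim_row B)) i0"
      using assms(3) B by (simp add: x_def)
    then show "x \<noteq> 0\<^sub>v (dim_row B)" by metis
    show "B *\<^sub>v x = z \<cdot>\<^sub>v x"
    proof (rule eq_vecI)
      fix i assume "i < dim_vec (z \<cdot>\<^sub>v x)"
      then have i: "i < N" by (simp add: x_def)
      have fi: "f i \<in> W" using f i by (auto simp: bij_betw_def)
      have "vec_index (B *\<^sub>v x) i = (\<Sum>j<N. of_int (c (f i) (f j)) * f j)"
        using i by (simp add: B_def A_def x_def scalar_prod_def atLeast0LessThan)
      also have "\<dots> = (\<Sum>v\<in>W. of_int (c (f i) v) * v)"
        by (rule sum.reindex_bij_betw[OF f])
      also have "\<dots> = z * f i" using c[OF fi] by simp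
      finally show "vec_index (B *\<^sub>v x) i = vec_index (z \<cdot>\<^sub>v x) i" using i by (simp add: x_def)
    qed (use B in \<open>auto simp: x_def\<close>)
  qed
  then have "poly (char_poly B) z = 0"
    using eigenvalue_root_char_poly[OF B] by (auto simp: eigenvalue_def)
  moreover have "char_poly B = of_int_poly (char_poly A)"
    unfolding B_def by (rule of_int_hom.char_poly_hom[OF A])
  moreover have "monic (char_poly A)" using degree_monic_char_poly[OF A] by simp
  ultimately show ?thesis by (auto simp: algebraic_int_altdef_ipoly)
qed

lemma algebraic_int_power_reduction:
  fixes x :: "'a::field_char_0"
  assumes "algebraic_int x"
  obtains n and c :: "nat \<Rightarrow> int" where "n > 0" "x ^ n = (\<Sum>i<n. of_int (c i) * x ^ i)"
proof -
  from assms obtain p :: "int poly" where p: "poly (of_int_poly p) x = 0" "monic p"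
    by (auto simp: algebraic_int_altdef_ipoly)
  define n where "n = Polynomial.degree p"
  have n0: "n > 0"
  proof (rule ccontr)
    assume "\<not> n > 0"
    then have "p = 1" using p(2) by (simp add: n_def) (metis monic_degree_0)
    with p(1) show False by simp
  qed
  have "0 = (\<Sum>i\<le>n. of_int (Polynomial.coeff p i) * x ^ i)"
    using p(1) by (simp add: poly_altdef n_def)
  also have "\<dots> = (\<Sum>i<n. of_int (Polynomial.coeff p i) * x ^ i) + x ^ n"
    using p(2) by (simp add: n_def lessThan_Suc_atMost[symmetric])
  finally have "x ^ n = - (\<Sum>i<n. of_int (Polynomial.coeff p i) * x ^ i)"
    by (metis add_eq_0_iff)
  then have "x ^ n = (\<Sum>i<n. of_int (- Polynomial.coeff p i) * x ^ i)"
    by (simp add: sum_negf)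
  with n0 show ?thesis by (rule that)
qed

text \<open>The products \<open>x ^ i * y ^ j\<close> with exponents below the degrees of monic
  equations for \<open>x\<close> and \<open>y\<close> generate a module stable under both, hence
  under sum and product.\<close>

lemma
  fixes x y :: "'a::field_char_0"
  assumes x: "algebraic_int x" and y: "algebraic_int y"
  shows algebraic_int_add: "algebraic_int (x + y)" and algebraic_int_mult: "algebraic_int (x * y)"
proof -
  obtain n c where n: "n > 0" "x ^ n = (\<Sum>i<n. of_int (c i) * x ^ i)"
    using algebraic_int_power_reduction[OF x] .
  obtain m d where m: "m > 0" "y ^ m = (\<Sum>i<m. of_int (d i) * y ^ i)"
    using algebraic_int_power_reduction[OF y] .
  define W where "W = (\<lambda>(i,j). x ^ i * y ^ j) ` ({..<n} \<times> {..<m})"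
  have W: "finite W" by (simp add: W_def)
  have inW: "x ^ i * y ^ j \<in> zmod.span W" if "i < n" "j < m" for i j
    using that by (intro zmod.span_base) (auto simp: W_def)
  have one: "1 \<in> W" unfolding W_def using n(1) m(1) by (intro image_eqI[of _ _ "(0, 0)"]) auto
  have xW: "x * w \<in> zmod.span W" if "w \<in> W" for w
  proof -
    from that obtain i j where ij: "w = x ^ i * y ^ j" "i < n" "j < m" by (auto simp: W_def)
    show ?thesis
    proof (cases "Suc i < n")
      case True
      have "x * w = x ^ Suc i * y ^ j" by (simp add: ij)
      then show ?thesis using inW[OF True ij(3)] by (simp only:)
    next
      case False
      then have "Suc i = n" using ij by simp
      have "x * w = x ^ Suc i * y ^ j" by (simp add: ij)
      also have "\<dots> = (\<Sum>k<n. of_int (c k) * (x ^ k * y ^ j))"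
        unfolding \<open>Suc i = n\<close> n(2) by (simp add: sum_distrib_right mult.assoc)
      also have "\<dots> \<in> zmod.span W"
        using ij by (intro zmod.span_sum zmod.span_scale inW) auto
      finally show ?thesis .
    qed
  qed
  have yW: "y * w \<in> zmod.span W" if "w \<in> W" for w
  proof -
    from that obtain i j where ij: "w = x ^ i * y ^ j" "i < n" "j < m" by (auto simp: W_def)
    show ?thesis
    proof (cases "Suc j < m")
      case True
      have "y * w = x ^ i * y ^ Suc j" by (simp add: ij)
      then show ?thesis using inW[OF ij(2) True] by (simp only:)
    next
      case False
      then have "Suc j = m" using ij by simp
      have "y * w = y ^ Suc j * x ^ i" by (simp add: ij)
      also have "\<dots> = (\<Sum>k<m. of_int (d k) * (x ^ i * y ^ k))"
        unfolding \<open>Suc j = m\<close> m(2) by (simp add: sum_distrib_left sum_distrib_right mult_ac)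
      also have "\<dots> \<in> zmod.span W"
        using ij by (intro zmod.span_sum zmod.span_scale inW) auto
      finally show ?thesis .
    qed
  qed
  show "algebraic_int (x + y)"
  proof (rule algebraic_int_stable_module[OF W one])
    fix w assume "w \<in> W"
    then show "(x + y) * w \<in> zmod.span W"
      unfolding distrib_right by (intro zmod.span_add xW yW)
  qed simp
  show "algebraic_int (x * y)"
  proof (rule algebraic_int_stable_module[OF W one])
    fix w assume "w \<in> W"
    have "x * (y * w) \<in> zmod.span W"
      by (rule zspan_mult[OF xW yW[OF \<open>w \<in> W\<close>]])
    then show "x * y * w \<in> zmod.span W" by (simp only: mult.assoc)
  qed simp
qed

lemma algebraic_int_diff: "algebraic_int x \<Longrightarrow> algebraic_int y \<Longrightarrow> algebraic_int (x - (y::'a::field_char_0))"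
  using algebraic_int_add[of x "-y"] by auto

lemma algebraic_int_sum:
  "(\<And>i. i \<in> I \<Longrightarrow> algebraic_int (f i :: 'a::field_char_0)) \<Longrightarrow> algebraic_int (sum f I)"
  by (induction I rule: infinite_finite_induct) (auto intro: algebraic_int_add)

lemma algebraic_int_prod:
  "(\<And>i. i \<in> I \<Longrightarrow> algebraic_int (f i :: 'a::field_char_0)) \<Longrightarrow> algebraic_int (prod f I)"
  by (induction I rule: infinite_finite_induct) (auto intro: algebraic_int_mult)

lemma algebraic_int_power: "algebraic_int (x :: 'a::field_char_0) \<Longrightarrow> algebraic_int (x ^ n)"
  by (induction n) (auto intro: algebraic_int_mult)

text \<open>With leading coefficient \<open>C\<close> and degree \<open>n\<close>, the element
  \<open>z = C * x\<close> is integral: in \<open>z ^ n = C ^ (n - 1) * (C * x ^ n)\<close> the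
  lower terms \<open>x ^ k\<close> absorb \<open>C ^ k\<close> and become powers of
  \<open>z\<close>.\<close>

lemma algebraic_int_multiple:
  assumes "algebraic (x::'a::field_char_0)"
  obtains D :: int where "D > 0" "algebraic_int (of_int D * x)"
proof -
  from assms obtain p :: "'a poly" where p: "\<And>i. Polynomial.coeff p i \<in> \<int>" "p \<noteq> 0" "poly p x = 0"
    by (auto simp: algebraic_def)
  have "\<forall>i. \<exists>b. Polynomial.coeff p i = of_int b" using p(1) by (auto elim: Ints_cases)
  then obtain a where a: "\<And>i. Polynomial.coeff p i = of_int (a i)" by metis
  define n where "n = Polynomial.degree p"
  define C where "C = a n"
  have C0: "C \<noteq> 0" using p(2) a[of n] by (auto simp: n_def C_def)
  have n0: "n > 0"
  proof (rule ccontr)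
    assume "\<not> n > 0"
    then obtain b where "p = [:b:]" by (auto simp: n_def elim: degree_eq_zeroE)
    with p show False by simp
  qed
  define z where "z = of_int C * x"
  define W where "W = (\<lambda>i. z ^ i) ` {..<n}"
  have "algebraic_int z"
  proof (rule algebraic_int_stable_module[of W 1])
    show "finite W" by (simp add: W_def)
    show "1 \<in> W" unfolding W_def using n0 by (intro image_eqI[of _ _ 0]) auto
    fix w assume "w \<in> W"
    then obtain i where i: "w = z ^ i" "i < n" by (auto simp: W_def)
    have inW: "z ^ i \<in> zmod.span W" if "i < n" for i
      using that by (intro zmod.span_base) (auto simp: W_def)
    show "z * w \<in> zmod.span W"
    proof (cases "Suc i < n")
      case True
      then show ?thesis using inW[OF True] by (simp add: i)
    next
      case False
      then have "Suc i = n" using i by simp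
      have "0 = (\<Sum>i\<le>n. of_int (a i) * x ^ i)"
        using p(3) a by (simp add: poly_altdef n_def)
      also have "\<dots> = (\<Sum>i<n. of_int (a i) * x ^ i) + of_int C * x ^ n"
        by (simp add: lessThan_Suc_atMost[symmetric] C_def)
      finally have "of_int C * x ^ n = - (\<Sum>i<n. of_int (a i) * x ^ i)"
        by (metis add_eq_0_iff)
      then have eq: "of_int C * x ^ n = (\<Sum>i<n. of_int (- a i) * x ^ i)"
        by (simp add: sum_negf)
      have "z * w = z ^ Suc i" by (simp add: i)
      also have "\<dots> = of_int C ^ i * (of_int C * x ^ n)"
        unfolding \<open>Suc i = n\<close>[symmetric] z_def by (simp add: power_mult_distrib)
      also have "\<dots> = (\<Sum>k<n. of_int (- a k * C ^ (n - 1 - k)) * z ^ k)"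
        unfolding eq sum_distrib_left
      proof (rule sum.cong)
        fix k assume k: "k \<in> {..<n}"
        have "i = (n - 1 - k) + k" using k \<open>Suc i = n\<close> by auto
        then have "(of_int C::'a) ^ i = of_int C ^ (n - 1 - k) * of_int C ^ k" by (metis power_add)
        then show "(of_int C::'a) ^ i * (of_int (- a k) * x ^ k) = of_int (- a k * C ^ (n - 1 - k)) * z ^ k"
          by (simp add: z_def power_mult_distrib mult_ac)
      qed simp
      also have "\<dots> \<in> zmod.span W"
        by (intro zmod.span_sum zmod.span_scale inW) auto
      finally show ?thesis .
    qed
  qed simp
  then have "algebraic_int (of_int \<bar>C\<bar> * x)"
    using algebraic_int_minus[of z] unfolding z_def by (cases "C \<ge> 0") (simp_all)
  with C0 show ?thesis using that[of "\<bar>C\<bar>"] by simp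
qed

section \<open>Primitive elements\<close>

interpretation of_rat_poly_hom: map_poly_inj_idom_hom "of_rat :: rat \<Rightarrow> 'a::field_char_0" ..

abbreviation rpoly :: "rat poly \<Rightarrow> 'a::field_char_0 \<Rightarrow> 'a"
  where "rpoly g x \<equiv> poly (map_poly of_rat g) x"

lemma poly_sum_le:
  fixes p :: "'a::comm_semiring_1 poly"
  shows "Polynomial.degree p \<le> N \<Longrightarrow> poly p x = (\<Sum>i\<le>N. Polynomial.coeff p i * x ^ i)"
  unfolding poly_altdef
  by (rule sum.mono_neutral_left) (auto simp: coeff_eq_0 not_le)

lemma coeff_sum_monom:
  "Polynomial.coeff (\<Sum>j\<le>N. Polynomial.monom (a j) j) k = (if k \<le> N then a k else 0)"
  by (simp add: Polynomial.coeff_sum if_distrib cong: if_cong)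

lemma degree_sum_monom_le: "Polynomial.degree (\<Sum>j\<le>N. Polynomial.monom (a j) j) \<le> N"
  by (rule degree_le) (simp add: coeff_sum_monom)

lemma rpoly_sum_monom:
  "rpoly (\<Sum>j\<le>N. Polynomial.monom (a j) j) x = (\<Sum>j\<le>N. of_rat (a j) * x ^ j)"
  by (subst poly_sum_le[of _ N])
    (auto simp: coeff_sum_monom degree_sum_monom_le intro!: sum.cong order.trans[OF degree_map_poly_le])

text \<open>The powers of \<open>x\<close> up to exponent \<open>card B\<close> are one too many to
  be independent.\<close>

lemma number_field_annihilator:
  assumes "number_field TYPE('k::field_char_0)"
  shows "\<exists>g::rat poly. g \<noteq> 0 \<and> rpoly g (x::'k) = 0"
proof -
  from assms obtain B where "finite_dimensional_vector_space (rat_scale :: rat \<Rightarrow> 'k \<Rightarrow> 'k) B"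
    by (auto simp: number_field_def)
  then interpret V: finite_dimensional_vector_space "rat_scale :: rat \<Rightarrow> 'k \<Rightarrow> 'k" B .
  define N where "N = card B"
  define c where "c = (\<lambda>j. V.representation B (x ^ j))"
  have c: "(\<Sum>b\<in>B. of_rat (c j b) * b) = x ^ j" for j
    unfolding c_def by (rule V.sum_representation_eq)
      (auto simp: V.independent_Basis V.span_Basis V.finite_Basis)
  obtain a where a: "\<exists>j\<in>{..N}. a j \<noteq> 0" "\<forall>b\<in>B. (\<Sum>j\<in>{..N}. a j * c j b) = 0"
    using homogeneous_system_nontrivial[of B "{..N}" c] V.finite_Basis by (auto simp: N_def)
  define g where "g = (\<Sum>j\<le>N. Polynomial.monom (a j) j)"
  have "g \<noteq> 0"
  proof
    assume "g = 0"
    then have "a j = 0" if "j \<le> N" for j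
      using that coeff_sum_monom[of a N j] by (simp add: g_def)
    with a(1) show False by auto
  qed
  moreover have "rpoly g x = 0"
  proof -
    have "rpoly g x = (\<Sum>j\<le>N. of_rat (a j) * x ^ j)"
      unfolding g_def by (rule rpoly_sum_monom)
    also have "\<dots> = (\<Sum>j\<le>N. of_rat (a j) * (\<Sum>b\<in>B. of_rat (c j b) * b))"
      by (simp only: c)
    also have "\<dots> = (\<Sum>j\<le>N. \<Sum>b\<in>B. of_rat (a j * c j b) * b)"
      by (simp only: sum_distrib_left of_rat_mult mult.assoc)
    also have "\<dots> = (\<Sum>b\<in>B. \<Sum>j\<le>N. of_rat (a j * c j b) * b)" by (rule sum.swap)
    also have "\<dots> = (\<Sum>b\<in>B. of_rat (\<Sum>j\<le>N. a j * c j b) * b)"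
      by (simp only: sum_distrib_right of_rat_sum)
    also have "\<dots> = 0" using a(2) by simp
    finally show ?thesis .
  qed
  ultimately show ?thesis by blast
qed

definition minimal_poly :: "rat poly \<Rightarrow> 'a::field_char_0 \<Rightarrow> bool" where
  "minimal_poly g x \<longleftrightarrow> monic g \<and> rpoly g x = 0 \<and>
     (\<forall>h. h \<noteq> 0 \<longrightarrow> rpoly h x = 0 \<longrightarrow> Polynomial.degree g \<le> Polynomial.degree h)"

lemma minimal_polyD:
  assumes "minimal_poly g x"
  shows "monic g" "rpoly g x = 0" "g \<noteq> 0"
    "h \<noteq> 0 \<Longrightarrow> rpoly h x = 0 \<Longrightarrow> Polynomial.degree g \<le> Polynomial.degree h"
  using assms by (auto simp: minimal_poly_def)

lemma minimal_poly_exists: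
  assumes "g \<noteq> 0" "rpoly g x = 0"
  obtains h where "minimal_poly h x"
proof -
  define P where "P = (\<lambda>g. g \<noteq> 0 \<and> rpoly g x = 0)"
  define g0 where "g0 = (ARG_MIN Polynomial.degree g. P g)"
  have "P g" using assms by (simp add: P_def)
  then have g0: "P g0" "\<And>h. P h \<Longrightarrow> Polynomial.degree g0 \<le> Polynomial.degree h"
    unfolding g0_def using arg_min_natI[of P g] arg_min_nat_le[of P _ Polynomial.degree] by blast+
  define h where "h = Polynomial.smult (inverse (Polynomial.lead_coeff g0)) g0"
  have "minimal_poly h x"
    using g0 unfolding minimal_poly_def h_def P_def
    by (auto simp: map_poly_smult of_rat_mult)
  then show ?thesis by (rule that)
qed

lemma rpoly_simps:
  "rpoly (p + q) x = rpoly p x + rpoly q x"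
  "rpoly (p - q) x = rpoly p x - rpoly q x"
  "rpoly (p * q) x = rpoly p x * rpoly q x"
  "rpoly (p \<circ>\<^sub>p q) x = rpoly p (rpoly q x)"
  "rpoly (- p) x = - rpoly p x"
  "rpoly [:a, 1:] x = of_rat a + x"
  "rpoly [:a:] x = of_rat a"
  "rpoly 1 x = 1" "rpoly 0 x = 0"
  "rpoly (Polynomial.monom a n) x = of_rat a * x ^ n"
  "rpoly (Polynomial.smult a p) x = of_rat a * rpoly p x"
  by (simp_all add: of_rat_hom.map_poly_pcompose poly_pcompose of_rat_hom.map_poly_hom_add
      hom_distribs poly_monom of_rat_hom.map_poly_hom_monom of_rat_hom.map_poly_pCons_hom
      of_rat_hom.map_poly_hom_smult)

lemma minimal_poly_dvd:
  assumes "minimal_poly g x" "rpoly h x = 0"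
  shows "g dvd h"
proof -
  have "h = (h div g) * g + h mod g" by simp
  then have "rpoly h x = rpoly (h div g) x * rpoly g x + rpoly (h mod g) x"
    by (metis rpoly_simps(1,3))
  then have "rpoly (h mod g) x = 0" using assms(2) minimal_polyD(2)[OF assms(1)] by simp
  moreover have "h mod g \<noteq> 0 \<Longrightarrow> Polynomial.degree (h mod g) < Polynomial.degree g"
    using assms minimal_polyD(3) degree_mod_less' by blast
  ultimately have "h mod g = 0" using minimal_polyD(4)[OF assms(1)] by force
  then show ?thesis by auto
qed

lemma minimal_poly_degree_pos:
  assumes "minimal_poly g x" shows "Polynomial.degree g > 0"
proof (rule ccontr)
  assume "\<not> Polynomial.degree g > 0"
  then have "g = 1" using minimal_polyD(1)[OF assms] by (auto elim!: degree_eq_zeroE simp: one_pCons)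
  with minimal_polyD(2)[OF assms] show False by (simp add: rpoly_simps)
qed

text \<open>Separability in characteristic 0: the derivative is nonzero of smaller degree, so
  minimality forbids the root.\<close>

lemma minimal_poly_pderiv:
  assumes "minimal_poly g x" shows "rpoly (pderiv g) x \<noteq> 0"
proof
  assume "rpoly (pderiv g) x = 0"
  moreover have "pderiv g \<noteq> 0" using minimal_poly_degree_pos[OF assms] by (simp add: pderiv_eq_0_iff)
  ultimately have "Polynomial.degree g \<le> Polynomial.degree (pderiv g)" by (rule minimal_polyD(4)[OF assms, rotated])
  then show False using minimal_poly_degree_pos[OF assms] by (simp add: degree_pderiv)
qed

text \<open>The ring \<rat>[x], which is the field \<rat>(x) once its elements are
  algebraic.\<close>

definition rat_adjoin :: "'a::field_char_0 \<Rightarrow> 'a set" where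
  "rat_adjoin x = range (\<lambda>g. rpoly g x)"

lemma rat_adjoin_closed:
  "x \<in> rat_adjoin x" "of_rat q \<in> rat_adjoin x"
  "a \<in> rat_adjoin x \<Longrightarrow> b \<in> rat_adjoin x \<Longrightarrow> a + b \<in> rat_adjoin x"
  "a \<in> rat_adjoin x \<Longrightarrow> b \<in> rat_adjoin x \<Longrightarrow> a - b \<in> rat_adjoin x"
  "a \<in> rat_adjoin x \<Longrightarrow> b \<in> rat_adjoin x \<Longrightarrow> a * b \<in> rat_adjoin x"
proof -
  have "x = rpoly [:0, 1:] x" "of_rat q = rpoly [:q:] x" by (simp_all add: rpoly_simps)
  then show "x \<in> rat_adjoin x" "of_rat q \<in> rat_adjoin x" unfolding rat_adjoin_def by blast+
qed (auto simp: rat_adjoin_def simp flip: rpoly_simps(1-3))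

lemma rat_adjoin_trans: "y \<in> rat_adjoin x \<Longrightarrow> rat_adjoin y \<subseteq> rat_adjoin x"
  unfolding rat_adjoin_def by (auto simp flip: rpoly_simps(4))

text \<open>For nonzero \<open>y\<close> the constant term of the minimal polynomial is nonzero, so
  its equation can be solved for the inverse.\<close>

lemma rat_adjoin_inverse_self:
  assumes "g \<noteq> 0" "rpoly g y = 0"
  shows "inverse y \<in> rat_adjoin y"
proof (cases "y = 0")
  case True
  then show ?thesis using rat_adjoin_closed(1)[of y] by simp
next
  case False
  obtain h where h: "minimal_poly h y" using minimal_poly_exists[OF assms] .
  obtain a q where hq: "h = pCons a q" by (cases h)
  have eq: "of_rat a + y * rpoly q y = 0"
    using minimal_polyD(2)[OF h] by (simp add: hq of_rat_hom.map_poly_pCons_hom)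
  have "q \<noteq> 0" using minimal_poly_degree_pos[OF h] by (auto simp: hq)
  have "a \<noteq> 0"
  proof
    assume "a = 0"
    with eq False have "rpoly q y = 0" by simp
    from minimal_polyD(4)[OF h \<open>q \<noteq> 0\<close> this] show False using \<open>q \<noteq> 0\<close> by (simp add: hq)
  qed
  then have "inverse y = of_rat (- inverse a) * rpoly q y"
  proof -
    have "y * rpoly q y = - of_rat a" using eq by (metis add_eq_0_iff)
    then have "rpoly q y = - of_rat a * inverse y" using False by (simp add: field_simps)
    then show ?thesis using \<open>a \<noteq> 0\<close> by (simp add: of_rat_minus of_rat_inverse)
  qed
  then have "inverse y = rpoly (Polynomial.smult (- inverse a) q) y" by (simp only: rpoly_simps)
  then show ?thesis unfolding rat_adjoin_def by blast
qed

lemma rat_adjoin_inverse: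
  assumes "\<And>x::'a::field_char_0. \<exists>g. g \<noteq> 0 \<and> rpoly g x = 0" "y \<in> rat_adjoin (x::'a)"
  shows "inverse y \<in> rat_adjoin x"
  using assms(1)[of y] rat_adjoin_inverse_self rat_adjoin_trans[OF assms(2)] by blast

interpretation to_ac_hom: field_hom "to_ac :: 'a::field \<Rightarrow> 'a alg_closure" by unfold_locales auto

interpretation to_ac_hom: inj_idom_hom "to_ac :: 'a::field \<Rightarrow> 'a alg_closure" ..

interpretation to_ac_poly_hom: map_poly_inj_idom_hom "to_ac :: 'a::field \<Rightarrow> 'a alg_closure" ..

text \<open>The classical argument with \<gamma> = \<alpha> + c \<beta>: the polynomials
  \<open>g1\<close> and \<open>f1\<close> over F = \<rat>(\<gamma>) have only the root \<beta> in
  common, and it is simple in \<open>g1\<close>, so their common divisor over F is linear. As F is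
  only a subset of the field, that divisor is taken as an element \<open>r\<close> of least degree
  in the ideal \<open>I\<close> of polynomials over F that vanish at \<beta>.\<close>

lemma primitive_element_two:
  fixes \<alpha> \<beta> :: "'a::field_char_0"
  assumes alg: "\<And>x::'a. \<exists>g. g \<noteq> 0 \<and> rpoly g x = 0"
  obtains \<gamma> where "\<alpha> \<in> rat_adjoin \<gamma>" "\<beta> \<in> rat_adjoin \<gamma>"
proof -
  from alg[of \<alpha>] obtain fa where fa: "fa \<noteq> 0" "rpoly fa \<alpha> = 0" by blast
  from alg[of \<beta>] obtain gb where gb: "minimal_poly gb \<beta>" by (blast elim: minimal_poly_exists)
  define A where "A = {z::'a alg_closure. rpoly fa z = 0}"
  define B where "B = {z::'a alg_closure. rpoly gb z = 0}"
  have "finite A" "finite B" unfolding A_def B_def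
    using fa minimal_polyD(3)[OF gb] by (auto intro!: poly_roots_finite)
  \<comment> \<open>For these values of \<open>c\<close> some root x of \<open>fa\<close> and some
    root y of \<open>gb\<close> other than \<beta> would satisfy \<gamma> = x + c y.\<close>
  then have "finite ((\<lambda>(x,y). (x - to_ac \<alpha>) / (to_ac \<beta> - y)) ` (A \<times> B))" by blast
  moreover have "infinite (range (of_nat :: nat \<Rightarrow> 'a alg_closure))"
    by (rule range_inj_infinite) (simp add: inj_on_def)
  ultimately have "\<not> range of_nat \<subseteq> (\<lambda>(x,y). (x - to_ac \<alpha>) / (to_ac \<beta> - y)) ` (A \<times> B)"
    using finite_subset by blast
  then obtain c :: nat where c: "of_nat c \<notin> (\<lambda>(x,y). (x - to_ac \<alpha>) / (to_ac \<beta> - y)) ` (A \<times> B)"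
    by blast
  define \<gamma> where "\<gamma> = \<alpha> + of_nat c * \<beta>"
  define F where "F = rat_adjoin \<gamma>"
  define I where "I = {p. (\<forall>i. Polynomial.coeff p i \<in> F) \<and> poly p \<beta> = 0}"
  define g1 where "g1 = (map_poly of_rat gb :: 'a poly)"
  define f1 where "f1 = map_poly of_rat fa \<circ>\<^sub>p [:\<gamma>, - of_nat c:]"
  have ratF: "of_rat q \<in> F" for q by (simp add: F_def rat_adjoin_closed)
  have F0: "0 \<in> F" using ratF[of 0] by simp
  have Fsum: "(\<Sum>i\<in>J. u i) \<in> F" if "\<And>i. i \<in> J \<Longrightarrow> u i \<in> F" for u :: "nat \<Rightarrow> 'a" and J
    using that by (induction J rule: infinite_finite_induct) (auto simp: F0 intro: rat_adjoin_closed(3)[where x = \<gamma>, folded F_def])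
  have coeffs_mult: "\<forall>i. Polynomial.coeff (p * q) i \<in> F"
    if "\<forall>i. Polynomial.coeff p i \<in> F" "\<forall>i. Polynomial.coeff q i \<in> F" for p q
    using that unfolding coeff_mult by (auto intro!: Fsum) (simp add: F_def rat_adjoin_closed)
  have g1I: "g1 \<in> I" using minimal_polyD(2)[OF gb] ratF by (simp add: I_def g1_def coeff_map_poly)
  have f1I: "f1 \<in> I"
  proof -
    have "\<forall>i. Polynomial.coeff (map_poly of_rat p \<circ>\<^sub>p [:\<gamma>, - of_nat c:]) i \<in> F" for p
    proof (induction p)
      case 0
      then show ?case by (simp add: F0)
    next
      case (pCons a p)
      have c1: "\<forall>i. Polynomial.coeff [:\<gamma>, - of_nat c :: 'a:] i \<in> F"
        using ratF[of "- of_nat c"] F0 by (auto simp: coeff_pCons of_rat_minus F_def rat_adjoin_closed split: nat.splits)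
      have "map_poly of_rat (pCons a p) \<circ>\<^sub>p [:\<gamma>, - of_nat c:] =
         [:of_rat a:] + [:\<gamma>, - of_nat c:] * (map_poly of_rat p \<circ>\<^sub>p [:\<gamma>, - of_nat c:])"
        by (simp add: of_rat_hom.map_poly_pCons_hom pcompose_pCons)
      moreover have "Polynomial.coeff [:of_rat a :: 'a:] i \<in> F" for i
        using ratF F0 by (auto simp: coeff_pCons split: nat.splits)
      ultimately show ?case using coeffs_mult[OF c1 pCons.IH]
        by (auto simp del: mult_pCons_left simp: F_def intro!: rat_adjoin_closed(3))
    qed
    then show ?thesis using fa(2) by (simp add: I_def f1_def poly_pcompose \<gamma>_def mult.commute)
  qed
  have "g1 \<noteq> 0" using minimal_polyD(3)[OF gb] by (simp add: g1_def)
  define P where "P = (\<lambda>p. p \<noteq> 0 \<and> p \<in> I)"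
  define r where "r = (ARG_MIN Polynomial.degree p. P p)"
  have "P g1" using g1I \<open>g1 \<noteq> 0\<close> by (simp add: P_def)
  then have r: "P r" "\<And>h. P h \<Longrightarrow> Polynomial.degree r \<le> Polynomial.degree h"
    unfolding r_def using arg_min_natI[of P g1] arg_min_nat_le[of P _ Polynomial.degree] by blast+
  have r0: "r \<noteq> 0" and rI: "r \<in> I" using r(1) by (auto simp: P_def)
  have rdvd: "r dvd p" if "p \<in> I" for p
    using that
  proof (induction "if p = 0 then 0 else Suc (Polynomial.degree p)" arbitrary: p rule: less_induct)
    case less
    show ?case
    proof (cases "p = 0")
      case False
      then have deg: "Polynomial.degree r \<le> Polynomial.degree p" using less.prems r(2) by (simp add: P_def)
      define q where "q = Polynomial.monom (Polynomial.lead_coeff p) (Polynomial.degree p - Polynomial.degree r)"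
      \<comment> \<open>Division by \<open>r\<close> without inverses in F: the leading terms cancel
        after multiplying \<open>p\<close> by the leading coefficient of \<open>r\<close>.\<close>
      define p' where "p' = [:Polynomial.lead_coeff r:] * p - q * r"
      have "p' \<in> I"
      proof -
        have "\<forall>i. Polynomial.coeff q i \<in> F" "\<forall>i. Polynomial.coeff [:Polynomial.lead_coeff r:] i \<in> F"
          using less.prems rI F0 by (auto simp: q_def I_def coeff_pCons split: nat.splits)
        then have "\<forall>i. Polynomial.coeff p' i \<in> F"
          using coeffs_mult less.prems rI unfolding p'_def I_def
          by (auto simp del: mult_pCons_left simp: F_def intro!: rat_adjoin_closed(4))
        then show ?thesis using less.prems rI by (simp add: I_def p'_def)
      qed
      moreover have "p' = 0 \<or> Polynomial.degree p' < Polynomial.degree p"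
      proof -
        have "Polynomial.degree (q * r) = Polynomial.degree p"
          using False r0 deg by (subst degree_mult_eq) (auto simp: q_def degree_monom_eq)
        then have "Polynomial.degree p' \<le> Polynomial.degree p"
          unfolding p'_def by (intro degree_diff_le) (auto simp: degree_smult_le)
        moreover have "Polynomial.coeff p' (Polynomial.degree p) = 0"
          using \<open>Polynomial.degree (q * r) = _\<close> lead_coeff_mult[of q r] False
          by (simp add: p'_def q_def degree_monom_eq mult.commute)
        ultimately show ?thesis by (metis eq_zero_or_degree_less)
      qed
      ultimately have "r dvd p'" using less.hyps False by auto
      then have "r dvd [:Polynomial.lead_coeff r:] * p" unfolding p'_def by (metis diff_add_cancel dvd_add dvd_triv_right)
      then show ?thesis using r0 by (simp add: dvd_smult_cancel)
    qed simp
  qed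
  define R where "R = map_poly to_ac r"
  have toac_rat: "to_ac (of_rat q :: 'a) = of_rat q" for q by (cases q) (simp add: of_rat_rat)
  have mapmap: "map_poly to_ac (map_poly of_rat p :: 'a poly) = map_poly of_rat p" for p
    by (subst map_poly_map_poly) (auto simp: o_def toac_rat)
  have R0: "R \<noteq> 0" using r0 by (simp add: R_def)
  have Rg: "R dvd map_poly of_rat gb"
    using rdvd[OF g1I] mapmap unfolding R_def g1_def by (metis to_ac_poly_hom.hom_dvd)
  have Rf: "R dvd map_poly of_rat fa \<circ>\<^sub>p [:to_ac \<gamma>, - of_nat c:]"
  proof -
    have "R dvd map_poly to_ac f1" unfolding R_def using rdvd[OF f1I] by (metis to_ac_poly_hom.hom_dvd)
    also have "map_poly to_ac f1 = map_poly of_rat fa \<circ>\<^sub>p [:to_ac \<gamma>, - of_nat c:]"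
      by (simp add: f1_def to_ac_hom.map_poly_pcompose mapmap to_ac_hom.map_poly_pCons_hom)
    finally show ?thesis .
  qed
  have rootR: "z = to_ac \<beta>" if "poly R z = 0" for z
  proof (rule ccontr)
    assume z: "z \<noteq> to_ac \<beta>"
    have "z \<in> B" using Rg that by (auto simp: B_def elim!: dvdE)
    moreover have "rpoly fa (to_ac \<gamma> - of_nat c * z) = 0"
      using Rf that by (auto elim!: dvdE simp: poly_pcompose dest!: arg_cong[of _ _ "\<lambda>p. poly p z"] simp: mult.commute)
    then have "to_ac \<gamma> - of_nat c * z \<in> A" by (simp add: A_def)
    moreover have "of_nat c = ((to_ac \<gamma> - of_nat c * z) - to_ac \<alpha>) / (to_ac \<beta> - z)"
      using z by (simp add: \<gamma>_def field_simps)
    ultimately show False using c by (auto simp: image_iff)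
  qed
  \<comment> \<open>\<open>gb\<close> is separable, so its divisor \<open>R\<close> has at most a
    simple root at \<beta>.\<close>
  have ordR: "Polynomial.order z R \<le> Polynomial.order z [:- to_ac \<beta>, 1:]" for z
  proof (cases "poly R z = 0")
    case True
    then have z: "z = to_ac \<beta>" by (rule rootR)
    have g0: "map_poly of_rat gb \<noteq> (0 :: 'a alg_closure poly)" using minimal_polyD(3)[OF gb] by simp
    have "Polynomial.order z R \<le> Polynomial.order z (map_poly of_rat gb)"
      using g0 Rg by (rule dvd_imp_order_le)
    also have "rpoly gb z = 0" using Rg True by (auto elim!: dvdE)
    then have "Polynomial.order z (map_poly of_rat gb) = Suc (Polynomial.order z (pderiv (map_poly of_rat gb)))"
      by (rule order_pderiv[OF g0])
    also have "poly (pderiv (map_poly of_rat gb)) z = to_ac (rpoly (pderiv gb) \<beta>)"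
      unfolding z of_rat_hom.map_poly_pderiv[symmetric] unfolding mapmap[symmetric] to_ac_hom.poly_map_poly ..
    then have "poly (pderiv (map_poly of_rat gb)) z \<noteq> 0" using minimal_poly_pderiv[OF gb] by simp
    then have "Polynomial.order z (pderiv (map_poly of_rat gb)) = 0" by (rule order_0I)
    also have "Suc 0 = Polynomial.order z [:- to_ac \<beta>, 1:]" using order_power_n_n[of z 1] by (simp add: z)
    finally show ?thesis .
  qed (simp add: order_0I)
  have "R dvd [:- to_ac \<beta>, 1:]" by (rule dvd_if_order_le[OF R0 _ ordR]) simp
  then have "Polynomial.degree r \<le> 1" using dvd_imp_degree_le[of R "[:- to_ac \<beta>, 1:]"] by (simp add: R_def)
  moreover have "poly r \<beta> = 0" using rI by (simp add: I_def)
  then have "Polynomial.degree r \<noteq> 0" using r0 by (auto elim!: degree_eq_zeroE)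
  ultimately have "Polynomial.degree r = 1" by simp
  then obtain a b where ab: "r = [:a, b:]" "b \<noteq> 0"
  proof -
    have "r = [:Polynomial.coeff r 0, Polynomial.coeff r 1:]"
      by (rule poly_eqI) (use \<open>Polynomial.degree r = 1\<close> in \<open>auto simp: coeff_pCons coeff_eq_0 split: nat.splits\<close>)
    moreover have "Polynomial.coeff r 1 \<noteq> 0" using \<open>Polynomial.degree r = 1\<close> r0 by (metis leading_coeff_0_iff)
    ultimately show ?thesis by (rule that)
  qed
  have "Polynomial.coeff r 0 \<in> F" "Polynomial.coeff r 1 \<in> F" using rI by (auto simp: I_def)
  then have "a \<in> F" "b \<in> F" using ab by simp_all
  moreover have "\<beta> = (0 - a) * inverse b" using \<open>poly r \<beta> = 0\<close> ab by (simp add: field_simps eq_neg_iff_add_eq_0)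
  moreover have "inverse b \<in> F" using \<open>b \<in> F\<close> unfolding F_def by (rule rat_adjoin_inverse[OF alg])
  ultimately have "\<beta> \<in> F"
    using rat_adjoin_closed(5)[OF rat_adjoin_closed(4)[OF F0[unfolded F_def], of a], of "inverse b"]
    unfolding F_def by simp
  moreover have "\<alpha> = \<gamma> - of_rat (of_nat c) * \<beta>" by (simp add: \<gamma>_def)
  moreover have "of_rat (of_nat c) * \<beta> \<in> F" using ratF \<open>\<beta> \<in> F\<close> unfolding F_def by (rule rat_adjoin_closed(5))
  moreover have "\<gamma> \<in> F" by (simp add: F_def rat_adjoin_closed)
  ultimately have "\<alpha> \<in> F" unfolding F_def using rat_adjoin_closed(4) by metis
  then show ?thesis using \<open>\<beta> \<in> F\<close> unfolding F_def by (rule that)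
qed

text \<open>The basis elements are absorbed one at a time into a single generator, and an integer
  multiple of it is integral.\<close>

lemma number_field_primitive_integer:
  assumes "number_field TYPE('k::field_char_0)"
  obtains \<theta> :: "'k::field_char_0" where "algebraic_int \<theta>" "rat_adjoin \<theta> = UNIV"
proof -
  note alg = number_field_annihilator[OF assms]
  from assms obtain B where "finite_dimensional_vector_space (rat_scale :: rat \<Rightarrow> 'k \<Rightarrow> 'k) B"
    by (auto simp: number_field_def)
  then interpret V: finite_dimensional_vector_space "rat_scale :: rat \<Rightarrow> 'k \<Rightarrow> 'k" B .
  have "\<exists>\<gamma>. A \<subseteq> rat_adjoin \<gamma>" if "finite A" for A :: "'k set"
    using that
  proof (induction rule: finite_induct)
    case (insert a A)
    then obtain \<gamma> where \<gamma>: "A \<subseteq> rat_adjoin \<gamma>" by blast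
    obtain \<delta> where \<delta>: "\<gamma> \<in> rat_adjoin \<delta>" "a \<in> rat_adjoin \<delta>"
      using primitive_element_two[OF alg, of \<gamma> a] by blast
    with \<gamma> rat_adjoin_trans[OF \<delta>(1)] show ?case by blast
  qed auto
  from this[OF V.finite_Basis] obtain \<gamma> where \<gamma>: "B \<subseteq> rat_adjoin \<gamma>" by blast
  have "V.subspace (rat_adjoin \<gamma>)"
    unfolding V.subspace_def
    using rat_adjoin_closed(2)[of 0 \<gamma>] rat_adjoin_closed(3)[of _ \<gamma>]
      rat_adjoin_closed(5)[OF rat_adjoin_closed(2)[of _ \<gamma>]] by auto
  then have "V.span B \<subseteq> rat_adjoin \<gamma>" by (rule V.span_minimal[OF \<gamma>])
  then have top: "rat_adjoin \<gamma> = UNIV" using V.span_Basis by blast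
  obtain g :: "rat poly" where g: "g \<noteq> 0" "rpoly g \<gamma> = 0" using alg[of \<gamma>] by blast
  have "algebraic \<gamma>"
    by (rule algebraicI'[of "map_poly of_rat g"]) (use g in \<open>auto simp: of_rat_hom.coeff_map_poly_hom\<close>)
  then obtain D :: int where D: "D > 0" "algebraic_int (of_int D * \<gamma>)"
    by (rule algebraic_int_multiple)
  have "of_rat (1 / of_int D) * (of_int D * \<gamma>) \<in> rat_adjoin (of_int D * \<gamma>)"
    by (intro rat_adjoin_closed)
  also have "of_rat (1 / of_int D) * (of_int D * \<gamma>) = \<gamma>" using D(1) by (simp add: of_rat_divide)
  finally have "rat_adjoin (of_int D * \<gamma>) = UNIV" using rat_adjoin_trans top by blast
  with D(2) show ?thesis by (rule that)
qed

lemma map_poly_of_rat_of_int: "map_poly of_rat (of_int_poly p) = (of_int_poly p :: 'a::field_char_0 poly)"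
  by (rule poly_eqI) (simp add: of_rat_hom.coeff_map_poly_hom)

text \<open>The coefficients are, up to sign, elementary symmetric functions of the roots; the
  induction adds one root at a time.\<close>

lemma monic_coeff_algebraic_int:
  fixes P :: "complex poly"
  assumes "monic P" "\<And>z. poly P z = 0 \<Longrightarrow> algebraic_int z"
  shows "algebraic_int (Polynomial.coeff P i)"
proof -
  have "P \<noteq> 0" using assms(1) by auto
  from alg_closed_imp_factorization[OF this] assms(1) obtain A where A: "P = (\<Prod>x\<in>#A. [:- x, 1:])" by auto
  have roots: "algebraic_int z" if "z \<in># A" for z
  proof -
    have "[:- z, 1:] dvd P" unfolding A using that by (auto dest!: multi_member_split simp del: mult_pCons_left)
    then show ?thesis using assms(2) by (simp add: poly_eq_0_iff_dvd)
  qed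
  have "algebraic_int (Polynomial.coeff (\<Prod>x\<in>#B. [:- x, 1:]) i)" if "B \<subseteq># A" for B
    using that
  proof (induction B arbitrary: i)
    case empty
    then show ?case by (simp add: coeff_1)
  next
    case (add x B)
    have x: "algebraic_int x" using roots add.prems by (meson insert_subset_eq_iff)
    have "algebraic_int (Polynomial.coeff (\<Prod>x\<in>#B. [:- x, 1:]) j)" for j
      by (rule add.IH) (use add.prems subset_mset.trans[OF _ add.prems, of B] in auto)
    then show ?case using x
      by (auto simp: coeff_pCons split: nat.splits intro!: algebraic_int_diff algebraic_int_mult)
  qed
  from this[of A] show ?thesis by (simp add: A)
qed

lemma algebraic_int_rat:
  assumes "algebraic_int (of_rat q :: 'a::field_char_0)"
  obtains c where "q = of_int c"
proof -
  have "(of_rat q :: 'a) \<in> \<int>"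
    by (rule rational_algebraic_int_is_int[OF assms]) auto
  then obtain c where "(of_rat q :: 'a) = of_int c" by (auto elim: Ints_cases)
  then have "of_rat q = (of_rat (of_int c) :: 'a)" by simp
  then have "q = of_int c" by (simp only: of_rat_eq_iff)
  then show ?thesis by (rule that)
qed

text \<open>Gauss's lemma by way of roots: every complex root of \<open>g\<close> is a root of a
  monic integer polynomial, so the coefficients of \<open>g\<close> are algebraic integers, and
  being rational they are integers.\<close>

lemma minimal_poly_integer:
  assumes g: "minimal_poly g (x::'a::field_char_0)" and x: "algebraic_int x"
  obtains m :: "int poly" where "g = of_int_poly m"
proof -
  from x obtain p :: "int poly" where p: "poly (of_int_poly p) x = 0" "monic p"
    by (auto simp: algebraic_int_altdef_ipoly)
  have "g dvd of_int_poly p" using minimal_poly_dvd[OF g] p(1) by (simp add: map_poly_of_rat_of_int)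
  then have dv: "map_poly of_rat g dvd (of_int_poly p :: complex poly)"
    using of_rat_poly_hom.hom_dvd map_poly_of_rat_of_int by metis
  have "algebraic_int (Polynomial.coeff (map_poly of_rat g) i :: complex)" for i
  proof (rule monic_coeff_algebraic_int)
    show "monic (map_poly of_rat g :: complex poly)"
      using minimal_polyD(1)[OF g] by simp
    show "algebraic_int z" if "rpoly g z = 0" for z :: complex
    proof -
      have "poly (of_int_poly p) z = 0" using dv that by (metis dvdE mult_zero_left poly_mult)
      then show ?thesis using p(2) unfolding algebraic_int_altdef_ipoly by blast
    qed
  qed
  then have ex: "\<exists>c. Polynomial.coeff g i = of_int c" for i
    unfolding of_rat_hom.coeff_map_poly_hom by (blast elim: algebraic_int_rat)
  have floor: "of_int \<lfloor>Polynomial.coeff g i\<rfloor> = Polynomial.coeff g i" for i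
  proof -
    obtain c where "Polynomial.coeff g i = of_int c" using ex by blast
    then show ?thesis by simp
  qed
  have "g = of_int_poly (map_poly floor g)"
    by (intro poly_eqI) (simp add: coeff_map_poly floor del: of_int_floor_cancel)
  then show ?thesis by (rule that)
qed

lemma clear_denominators:
  fixes v :: "rat poly"
  obtains D :: int and p :: "int poly" where "D > 0" "Polynomial.smult (of_int D) v = of_int_poly p"
proof -
  have "\<exists>D>0::int. \<exists>p. Polynomial.smult (of_int D) v = of_int_poly p"
  proof (induction v)
    case (pCons a v)
    then obtain D p where D: "D > 0" "Polynomial.smult (of_int D) v = of_int_poly p" by blast
    obtain b c where q: "quotient_of a = (b, c)" by (cases "quotient_of a")
    have bc: "a = of_int b / of_int c" "c > 0"
      using quotient_of_div[OF q] quotient_of_denom_pos[OF q] by auto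
    have "of_int (c * D) * a = of_int (b * D)" using bc by simp
    then have "Polynomial.smult (of_int (c * D)) (pCons a v) =
        pCons (of_int (b * D)) (Polynomial.smult (of_int c) (Polynomial.smult (of_int D) v))"
      by (simp only: smult_pCons smult_smult of_int_mult)
    also have "\<dots> = of_int_poly (pCons (b * D) (Polynomial.smult c p))"
      unfolding D(2) by (simp add: of_int_hom.map_poly_pCons_hom of_int_hom.map_poly_hom_smult)
    finally show ?case using mult_pos_pos[OF bc(2) D(1)] by blast
  qed (auto intro: exI[of _ 1])
  then show ?thesis using that by blast
qed

section \<open>Embeddings and Lagrange interpolation for \<rat>(\<theta>)\<close>

locale integral_primitive =
  fixes \<theta> :: "'k::field_char_0" and m :: "int poly"
  assumes minimal: "minimal_poly (of_int_poly m) \<theta>" and generates: "rat_adjoin \<theta> = UNIV"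
begin

definition n where "n = Polynomial.degree m"
definition Z where "Z = {z::complex. poly (of_int_poly m) z = 0}"

lemma monic_m: "monic m"
  using minimal_polyD(1)[OF minimal] by (simp add: of_int_hom.degree_map_poly_hom of_int_hom.coeff_map_poly_hom)

lemma m_nonzero: "m \<noteq> 0" using monic_m by auto

lemma n_pos: "n > 0" using minimal_poly_degree_pos[OF minimal] by (simp add: n_def)

lemma theta_integral: "algebraic_int \<theta>"
  using minimal_polyD(2)[OF minimal] monic_m by (auto simp: algebraic_int_altdef_ipoly map_poly_of_rat_of_int)

lemma finite_Z: "finite Z" unfolding Z_def using m_nonzero by (intro poly_roots_finite) simp

lemma Z_integral: "z \<in> Z \<Longrightarrow> algebraic_int z"
  using monic_m by (auto simp: algebraic_int_altdef_ipoly Z_def)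

lemma representation:
  obtains g :: "rat poly" where "Polynomial.degree g < n" "x = rpoly g \<theta>"
proof -
  obtain h where h: "x = rpoly h \<theta>" using generates by (auto simp: rat_adjoin_def)
  let ?M = "of_int_poly m :: rat poly"
  have "h = (h div ?M) * ?M + h mod ?M" by (rule div_mult_mod_eq[symmetric])
  then have "rpoly h \<theta> = rpoly (h div ?M) \<theta> * rpoly ?M \<theta> + rpoly (h mod ?M) \<theta>" by (metis rpoly_simps(1,3))
  then have "x = rpoly (h mod ?M) \<theta>" using minimal_polyD(2)[OF minimal] h by simp
  moreover have "Polynomial.degree (h mod ?M) < n"
    using degree_mod_less[of ?M h] n_pos m_nonzero by (auto simp: n_def)
  ultimately show ?thesis using that by blast
qed

lemma representation_ex: "\<exists>g. x = rpoly g \<theta>"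
  using generates by (auto simp: rat_adjoin_def)

text \<open>The embedding with \<theta> \<mapsto> z. Two representatives of \<open>x\<close> differ
  by a multiple of the minimal polynomial, which vanishes at every \<open>z\<close> in
  \<open>Z\<close>, so the choice is immaterial.\<close>

definition emb :: "complex \<Rightarrow> 'k \<Rightarrow> complex" where
  "emb z x = rpoly (SOME g. rpoly g \<theta> = x) z"

lemma emb_rpoly:
  assumes "z \<in> Z" shows "emb z (rpoly g \<theta>) = rpoly g z"
proof -
  define h where "h = (SOME h. rpoly h \<theta> = rpoly g \<theta>)"
  have h: "rpoly h \<theta> = rpoly g \<theta>" unfolding h_def by (rule someI[of _ g]) simp
  then have "rpoly (h - g) \<theta> = 0" by (simp add: rpoly_simps)
  then have "of_int_poly m dvd h - g" by (rule minimal_poly_dvd[OF minimal])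
  then obtain q where "h - g = of_int_poly m * q" by (elim dvdE)
  then have "rpoly h z - rpoly g z = rpoly (of_int_poly m) z * rpoly q z" by (metis rpoly_simps(2,3))
  also have "\<dots> = 0" using assms by (simp add: Z_def map_poly_of_rat_of_int)
  finally show ?thesis by (simp add: emb_def h_def)
qed

lemma emb_simps:
  assumes "z \<in> Z"
  shows "emb z (x + y) = emb z x + emb z y" "emb z (x * y) = emb z x * emb z y"
    "emb z 1 = 1" "emb z 0 = 0" "emb z \<theta> = z" "emb z (of_rat q) = of_rat q"
proof -
  obtain g h where gh: "x = rpoly g \<theta>" "y = rpoly h \<theta>" using representation_ex by meson
  show "emb z (x + y) = emb z x + emb z y" "emb z (x * y) = emb z x * emb z y"
    unfolding gh rpoly_simps(1,3)[symmetric] emb_rpoly[OF assms] by (simp_all only: rpoly_simps)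
  show "emb z 1 = 1" "emb z 0 = 0" "emb z \<theta> = z" "emb z (of_rat q) = of_rat q"
    using emb_rpoly[OF assms, of 1] emb_rpoly[OF assms, of 0] emb_rpoly[OF assms, of "[:0,1:]"]
      emb_rpoly[OF assms, of "[:q:]"] by (simp_all add: rpoly_simps)
qed

lemma emb_hom: "z \<in> Z \<Longrightarrow> field_hom (emb z)"
  by unfold_locales (simp_all add: emb_simps)

text \<open>An embedding fixes the rationals, hence is determined by the image of \<theta>, and this
  is a root of \<open>m\<close>.\<close>

lemma embeddings: "Ring.ring_hom ring_of_type_algebra ring_of_type_algebra = emb ` Z"
proof (intro equalityI subsetI)
  fix \<sigma> :: "'k \<Rightarrow> complex" assume "\<sigma> \<in> emb ` Z"
  then show "\<sigma> \<in> Ring.ring_hom ring_of_type_algebra ring_of_type_algebra"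
    by (auto simp: Ring.ring_hom_def ring_of_type_algebra_def emb_simps)
next
  fix \<sigma> :: "'k \<Rightarrow> complex" assume s: "\<sigma> \<in> Ring.ring_hom ring_of_type_algebra ring_of_type_algebra"
  have s1: "\<sigma> (x + y) = \<sigma> x + \<sigma> y" "\<sigma> (x * y) = \<sigma> x * \<sigma> y" "\<sigma> 1 = 1" for x y
    using s by (auto simp: Ring.ring_hom_def ring_of_type_algebra_def)
  have s2: "\<sigma> 0 = 0" using s1(1)[of 0 0] by simp
  interpret s: field_hom \<sigma> by unfold_locales (auto simp: s1 s2)
  have rat: "\<sigma> (of_rat q) = of_rat q" for q
  proof (cases q)
    case (Fract a b)
    then have "\<sigma> (of_rat q) * of_int b = of_int a"
      unfolding s.hom_of_int[symmetric] s1(2)[symmetric] by (simp add: of_rat_rat)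
    then show ?thesis using Fract by (simp add: of_rat_rat field_simps)
  qed
  have pol: "\<sigma> (rpoly g \<theta>) = rpoly g (\<sigma> \<theta>)" for g
  proof -
    have "map_poly \<sigma> (map_poly of_rat g) = map_poly of_rat g"
      by (rule poly_eqI) (simp add: s.coeff_map_poly_hom of_rat_hom.coeff_map_poly_hom rat)
    then show ?thesis using s.poly_map_poly[of "map_poly of_rat g" \<theta>] by simp
  qed
  have "\<sigma> \<theta> \<in> Z" using pol[of "of_int_poly m"] minimal_polyD(2)[OF minimal] s2
    by (simp add: Z_def map_poly_of_rat_of_int)
  moreover have "\<sigma> = emb (\<sigma> \<theta>)"
  proof
    fix x obtain g where "x = rpoly g \<theta>" using representation_ex by meson
    then show "\<sigma> x = emb (\<sigma> \<theta>) x" using pol emb_rpoly[OF \<open>\<sigma> \<theta> \<in> Z\<close>] by simp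
  qed
  ultimately show "\<sigma> \<in> emb ` Z" by blast
qed

lemma inj_emb: "inj_on emb Z"
  by (rule inj_onI) (metis emb_simps(5))

lemma emb_integral:
  assumes z: "z \<in> Z" and x: "algebraic_int x" shows "algebraic_int (emb z x)"
proof -
  interpret s: field_hom "emb z" by (rule emb_hom[OF z])
  from x obtain p :: "int poly" where p: "poly (of_int_poly p) x = 0" "monic p"
    by (auto simp: algebraic_int_altdef_ipoly)
  have "map_poly (emb z) (of_int_poly p) = of_int_poly p"
    by (rule poly_eqI) (simp add: s.coeff_map_poly_hom s.hom_of_int)
  then have "poly (of_int_poly p) (emb z x) = 0" using p(1) s.poly_map_poly[of "of_int_poly p" x] s.hom_zero by simp
  then show ?thesis using p(2) by (auto simp: algebraic_int_altdef_ipoly)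
qed

text \<open>The inverse of m'(\<theta>) in the field is v(\<theta>), and the identity passes to
  every conjugate because it holds modulo \<open>m\<close>. One rational \<open>v\<close> thus
  serves all embeddings; its denominator becomes \<Delta> in
  \<open>integral_coordinates\<close>.\<close>

lemma pderiv_inverse: "\<exists>v. \<forall>z\<in>Z. poly (pderiv (of_int_poly m)) z * rpoly v z = 1"
proof -
  let ?M = "of_int_poly m :: rat poly"
  obtain v where v: "inverse (rpoly (pderiv ?M) \<theta>) = rpoly v \<theta>" using representation_ex by meson
  have "rpoly (pderiv ?M * v - 1) \<theta> = 0"
    using minimal_poly_pderiv[OF minimal] by (simp add: rpoly_simps v[symmetric])
  then have "?M dvd pderiv ?M * v - 1" by (rule minimal_poly_dvd[OF minimal])
  then obtain q where q: "pderiv ?M * v - 1 = ?M * q" by (elim dvdE)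
  have "poly (pderiv (of_int_poly m)) z * rpoly v z = 1" if "z \<in> Z" for z
  proof -
    have "rpoly (pderiv ?M) z * rpoly v z - 1 = rpoly ?M z * rpoly q z"
      using q by (metis rpoly_simps(2,3,8))
    then show ?thesis using that
      by (simp add: Z_def map_poly_of_rat_of_int of_rat_hom.map_poly_pderiv)
  qed
  then show ?thesis by blast
qed

lemma rsquarefree_M: "rsquarefree (of_int_poly m :: complex poly)"
proof -
  obtain v where v: "\<And>z. z \<in> Z \<Longrightarrow> poly (pderiv (of_int_poly m)) z * rpoly v z = 1"
    using pderiv_inverse by blast
  show ?thesis unfolding rsquarefree_roots
  proof (intro allI notI)
    fix a assume "poly (of_int_poly m) a = (0::complex) \<and> poly (pderiv (of_int_poly m)) a = 0"
    then show False using v[of a] by (simp add: Z_def)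
  qed
qed

lemma card_Z: "card Z = n"
  using rsquarefree_M m_nonzero rsquarefree_card_degree[of "of_int_poly m :: complex poly"] by (simp add: Z_def n_def)

text \<open>The quotient of \<open>m\<close> by X - z; divided by its value at \<open>z\<close>,
  which is m'(z), it is the Lagrange basis polynomial at \<open>z\<close>.\<close>

definition cofactor where "cofactor z = (\<Prod>w\<in>Z - {z}. [:- w, 1:])"

lemma M_factors: "(\<Prod>z\<in>Z. [:- z, 1:]) = (of_int_poly m :: complex poly)"
  using complex_poly_decompose_rsquarefree[OF rsquarefree_M] monic_m
  by (simp add: Z_def)

lemma M_cofactor: "z \<in> Z \<Longrightarrow> of_int_poly m = [:- z, 1:] * cofactor z"
  unfolding M_factors[symmetric] cofactor_def by (rule prod.remove[OF finite_Z])

lemma pderiv_M: "z \<in> Z \<Longrightarrow> poly (pderiv (of_int_poly m)) z = poly (cofactor z) z"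
  by (subst M_cofactor[of z]) (auto simp: pderiv_mult pderiv_pCons simp del: mult_pCons_left)

lemma cofactor_root: "w \<in> Z \<Longrightarrow> w \<noteq> z \<Longrightarrow> poly (cofactor z) w = 0"
  using finite_Z by (auto simp: cofactor_def poly_prod intro!: prod_zero bexI[of _ w])

lemma degree_cofactor: "z \<in> Z \<Longrightarrow> Polynomial.degree (cofactor z) < n"
  unfolding cofactor_def using degree_prod_sum_le[of "Z - {z}" "\<lambda>w. [:- w, 1:]"] finite_Z card_Z n_pos
  by (simp add: o_def)

lemma cofactor_integral: "algebraic_int (Polynomial.coeff (cofactor z) i)"
proof (rule monic_coeff_algebraic_int)
  show "monic (cofactor z)" unfolding cofactor_def by (rule monic_prod) auto
  show "algebraic_int w" if "poly (cofactor z) w = 0" for w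
    using that finite_Z Z_integral by (auto simp: cofactor_def poly_prod)
qed

text \<open>Both sides agree at the \<open>n\<close> points of \<open>Z\<close> and have degree
  below \<open>n\<close>.\<close>

lemma lagrange:
  fixes G :: "complex poly"
  assumes "Polynomial.degree G < n"
  shows "G = (\<Sum>z\<in>Z. Polynomial.smult (poly G z / poly (cofactor z) z) (cofactor z))" (is "G = ?L")
proof (rule ccontr)
  assume ne: "G \<noteq> ?L"
  have nz: "poly (cofactor z) z \<noteq> 0" if "z \<in> Z" for z
    using rsquarefree_M that unfolding rsquarefree_roots pderiv_M[OF that, symmetric] by (auto simp: Z_def)
  have "poly ?L w = poly G w" if "w \<in> Z" for w
  proof -
    have "poly ?L w = (\<Sum>z\<in>Z. if z = w then poly G w else 0)"
      unfolding poly_sum by (rule sum.cong) (auto simp: cofactor_root[OF that] nz that)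
    then show ?thesis using finite_Z that by simp
  qed
  then have "Z \<subseteq> {w. poly (G - ?L) w = 0}" by auto
  then have "n \<le> card {w. poly (G - ?L) w = 0}"
    unfolding card_Z[symmetric] by (rule card_mono[rotated]) (rule poly_roots_finite, use ne in simp)
  also have "\<dots> \<le> Polynomial.degree (G - ?L)" by (rule card_poly_roots_bound) (use ne in auto)
  also have "\<dots> < n"
  proof -
    have "Polynomial.degree (Polynomial.smult c (cofactor z)) \<le> n - 1" if "z \<in> Z" for c z
      using degree_smult_le[of c "cofactor z"] degree_cofactor[OF that] by linarith
    then have "Polynomial.degree ?L \<le> n - 1" by (intro degree_sum_le[OF finite_Z])
    with assms n_pos show ?thesis by (intro degree_diff_less) auto
  qed
  finally show False by simp
qed

end

section \<open>Indices of additive subgroups\<close>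

definition zsub :: "'a::ab_group_add set \<Rightarrow> bool" where
  "zsub A \<longleftrightarrow> 0 \<in> A \<and> (\<forall>x\<in>A. \<forall>y\<in>A. x - y \<in> A)"

lemma zsubD:
  assumes "zsub A"
  shows "0 \<in> A" "x \<in> A \<Longrightarrow> y \<in> A \<Longrightarrow> x - y \<in> A" "x \<in> A \<Longrightarrow> - x \<in> A"
    "x \<in> A \<Longrightarrow> y \<in> A \<Longrightarrow> x + y \<in> A"
proof -
  show 0: "0 \<in> A" and 1: "x \<in> A \<Longrightarrow> y \<in> A \<Longrightarrow> x - y \<in> A" for x y using assms by (auto simp: zsub_def)
  show 2: "x \<in> A \<Longrightarrow> - x \<in> A" for x using 1[OF 0, of x] by simp
  show "x \<in> A \<Longrightarrow> y \<in> A \<Longrightarrow> x + y \<in> A" using 1[OF _ 2, of x y] by simp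
qed

definition residue_class :: "'a::ab_group_add set \<Rightarrow> 'a set \<Rightarrow> 'a \<Rightarrow> 'a set" where
  "residue_class A B a = {x \<in> A. x - a \<in> B}"

abbreviation residue_classes :: "'a::ab_group_add set \<Rightarrow> 'a set \<Rightarrow> 'a set set" where
  "residue_classes A B \<equiv> residue_class A B ` A"

text \<open>An infinite index is \<open>0\<close>; since \<open>0\<close> absorbs products,
  \<open>index_mult\<close> remains true for it.\<close>

definition index :: "'a::ab_group_add set \<Rightarrow> 'a set \<Rightarrow> nat" where
  "index A B = card (residue_classes A B)"

lemma residue_class_eq_iff:
  assumes "zsub A" "zsub B" "a \<in> A" "b \<in> A"
  shows "residue_class A B a = residue_class A B b \<longleftrightarrow> a - b \<in> B"
proof
  assume "residue_class A B a = residue_class A B b"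
  moreover have "a \<in> residue_class A B a" using assms zsubD(1) by (auto simp: residue_class_def)
  ultimately show "a - b \<in> B" by (auto simp: residue_class_def)
next
  assume ab: "a - b \<in> B"
  have "x - b \<in> B" if "x - a \<in> B" for x using zsubD(4)[OF assms(2) that ab] by simp
  moreover have "x - a \<in> B" if "x - b \<in> B" for x using zsubD(2)[OF assms(2) that ab] by simp
  ultimately show "residue_class A B a = residue_class A B b" by (auto simp: residue_class_def)
qed

lemma finite_residue_classes:
  assumes "zsub A" "zsub B" "finite R" "\<And>x. x \<in> A \<Longrightarrow> \<exists>r\<in>R. x - r \<in> B"
  shows "finite (residue_classes A B)"
proof -
  \<comment> \<open>The elements of \<open>R\<close> may lie outside \<open>A\<close>; each relevant
    one is moved to an element of \<open>A\<close> in the same class modulo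
    \<open>B\<close>.\<close>
  define pick where "pick = (\<lambda>r. SOME a. a \<in> A \<and> a - r \<in> B)"
  have "residue_classes A B \<subseteq> (\<lambda>r. residue_class A B (pick r)) ` R"
  proof (rule image_subsetI)
    fix x assume x: "x \<in> A"
    from assms(4)[OF x] obtain r where r: "r \<in> R" "x - r \<in> B" by blast
    then have p: "pick r \<in> A \<and> pick r - r \<in> B"
      unfolding pick_def using someI[of "\<lambda>a. a \<in> A \<and> a - r \<in> B" x] x by simp
    then have "x - pick r \<in> B" using zsubD(2)[OF assms(2) r(2), of "pick r - r"] by simp
    then have "residue_class A B x = residue_class A B (pick r)"
      using residue_class_eq_iff[OF assms(1,2) x] p by blast
    with r(1) show "residue_class A B x \<in> (\<lambda>r. residue_class A B (pick r)) ` R" by blast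
  qed
  then show ?thesis using assms(3) finite_subset by blast
qed

lemma index_eqI:
  assumes "zsub A" "zsub B" "R \<subseteq> A" "\<And>x. x \<in> A \<Longrightarrow> \<exists>r\<in>R. x - r \<in> B"
    "\<And>r s. r \<in> R \<Longrightarrow> s \<in> R \<Longrightarrow> r - s \<in> B \<Longrightarrow> r = s"
  shows "index A B = card R"
proof -
  have "bij_betw (residue_class A B) R (residue_classes A B)"
    unfolding bij_betw_def
  proof
    show "inj_on (residue_class A B) R"
      using residue_class_eq_iff[OF assms(1,2)] assms(3,5) by (meson inj_onI subsetD)
    show "residue_class A B ` R = residue_classes A B"
    proof
      show "residue_classes A B \<subseteq> residue_class A B ` R"
      proof (rule image_subsetI)
        fix x assume x: "x \<in> A"
        then obtain r where "r \<in> R" "x - r \<in> B" using assms(4) by blast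
        then show "residue_class A B x \<in> residue_class A B ` R"
          using residue_class_eq_iff[OF assms(1,2) x] assms(3) by blast
      qed
    qed (use assms(3) in blast)
  qed
  then show ?thesis unfolding index_def by (metis bij_betw_same_card)
qed

lemma representatives:
  assumes "zsub A" "zsub B"
  obtains R where "R \<subseteq> A" "\<And>x. x \<in> A \<Longrightarrow> \<exists>r\<in>R. x - r \<in> B"
    "\<And>r s. r \<in> R \<Longrightarrow> s \<in> R \<Longrightarrow> r - s \<in> B \<Longrightarrow> r = s"
proof -
  define f where "f = (\<lambda>x. SOME a. a \<in> A \<and> x - a \<in> B)"
  have f: "f x \<in> A" "x - f x \<in> B" if "x \<in> A" for x
    unfolding f_def using someI[of "\<lambda>a. a \<in> A \<and> x - a \<in> B" x] that zsubD(1)[OF assms(2)] by auto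
  have feq: "f x = f y" if "x - y \<in> B" for x y
  proof -
    have "(x - a \<in> B) = (y - a \<in> B)" for a
      using zsubD(2)[OF assms(2), of "x - a" "x - y"] zsubD(4)[OF assms(2) that, of "y - a"] that by auto
    then show ?thesis by (simp add: f_def)
  qed
  show ?thesis
  proof
    show "f ` A \<subseteq> A" using f by blast
    show "\<exists>r\<in>f ` A. x - r \<in> B" if "x \<in> A" for x using f that by blast
    show "r = s" if rs: "r \<in> f ` A" "s \<in> f ` A" "r - s \<in> B" for r s
    proof -
      obtain x y where xy: "x \<in> A" "y \<in> A" "r = f x" "s = f y" using rs by blast
      have "f x - f (f x) \<in> B" "f (f x) = f x"
        using f xy feq[of "f x" x] zsubD(3)[OF assms(2) f(2)[OF xy(1)]] zsubD(1)[OF assms(2)] by auto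
      have "f (f y) = f y" using feq[of "f y" y] zsubD(3)[OF assms(2) f(2)[OF xy(2)]] by auto
      then show "r = s" using feq[OF rs(3)] xy \<open>f (f x) = f x\<close> by simp
    qed
  qed
qed

text \<open>Sums of representatives of \<open>A\<close> modulo \<open>B\<close> and of
  \<open>B\<close> modulo \<open>C\<close> represent \<open>A\<close> modulo \<open>C\<close>,
  without repetition.\<close>

lemma index_mult:
  assumes A: "zsub A" and B: "zsub B" and C: "zsub C" and "B \<subseteq> A" "C \<subseteq> B"
  shows "index A C = index A B * index B C"
proof -
  obtain R where R: "R \<subseteq> A" "\<And>x. x \<in> A \<Longrightarrow> \<exists>r\<in>R. x - r \<in> B"
    "\<And>r s. r \<in> R \<Longrightarrow> s \<in> R \<Longrightarrow> r - s \<in> B \<Longrightarrow> r = s" using representatives[OF A B] by metis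
  obtain S where S: "S \<subseteq> B" "\<And>x. x \<in> B \<Longrightarrow> \<exists>r\<in>S. x - r \<in> C"
    "\<And>r s. r \<in> S \<Longrightarrow> s \<in> S \<Longrightarrow> r - s \<in> C \<Longrightarrow> r = s" using representatives[OF B C] by metis
  define T where "T = (\<lambda>(r,s). r + s) ` (R \<times> S)"
  have eq: "r = r' \<and> s = s'"
    if "r \<in> R" "r' \<in> R" "s \<in> S" "s' \<in> S" "(r + s) - (r' + s') \<in> C" for r s r' s'
  proof -
    have "s - s' \<in> B" using zsubD(2)[OF B] S(1) that by blast
    moreover have "(r + s) - (r' + s') \<in> B" using that assms(5) by blast
    ultimately have "((r + s) - (r' + s')) - (s - s') \<in> B" using zsubD(2)[OF B] by blast
    then have "r = r'" using R(3) that by (simp add: algebra_simps)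
    then show ?thesis using S(3)[of s s'] that by simp
  qed
  have "inj_on (\<lambda>(r,s). r + s) (R \<times> S)"
    using eq zsubD(1)[OF C] by (force simp: inj_on_def)
  then have "card T = card R * card S" by (simp add: T_def card_image card_cartesian_product)
  moreover have "index A C = card T"
  proof (rule index_eqI[OF A C])
    show "T \<subseteq> A"
    proof
      fix t assume "t \<in> T"
      then obtain r s where rs: "r \<in> R" "s \<in> S" "t = r + s" by (auto simp: T_def)
      then show "t \<in> A" using zsubD(4)[OF A, of r s] R(1) S(1) assms(4) by blast
    qed
    show "\<exists>r\<in>T. x - r \<in> C" if x: "x \<in> A" for x
    proof -
      obtain r where r: "r \<in> R" "x - r \<in> B" using R(2)[OF x] by blast
      obtain s where s: "s \<in> S" "(x - r) - s \<in> C" using S(2)[OF r(2)] by blast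
      have "r + s \<in> T" using r s by (auto simp: T_def)
      moreover have "x - (r + s) \<in> C" using s by (simp add: algebra_simps)
      ultimately show ?thesis by blast
    qed
    show "t = u" if tu: "t \<in> T" "u \<in> T" "t - u \<in> C" for t u
    proof -
      obtain r s where rs: "r \<in> R" "s \<in> S" "t = r + s" using tu(1) by (auto simp: T_def)
      obtain r' s' where rs': "r' \<in> R" "s' \<in> S" "u = r' + s'" using tu(2) by (auto simp: T_def)
      show ?thesis using eq[OF rs(1) rs'(1) rs(2) rs'(2)] tu(3) rs(3) rs'(3) by simp
    qed
  qed
  moreover have "index A B = card R" by (rule index_eqI[OF A B R])
  moreover have "index B C = card S" by (rule index_eqI[OF B C S])
  ultimately show ?thesis by simp
qed

lemma zsub_scale: "zsub A \<Longrightarrow> zsub ((*) (y::'a::field) ` A)"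
  unfolding zsub_def by (auto simp flip: right_diff_distrib intro: image_eqI[of _ _ 0])

lemma index_scale:
  assumes A: "zsub A" and B: "zsub B" and "B \<subseteq> A" and y: "(y::'a::field) \<noteq> 0"
  shows "index ((*) y ` A) ((*) y ` B) = index A B"
proof -
  obtain R where R: "R \<subseteq> A" "\<And>x. x \<in> A \<Longrightarrow> \<exists>r\<in>R. x - r \<in> B"
    "\<And>r s. r \<in> R \<Longrightarrow> s \<in> R \<Longrightarrow> r - s \<in> B \<Longrightarrow> r = s" using representatives[OF A B] by metis
  have "index ((*) y ` A) ((*) y ` B) = card ((*) y ` R)"
  proof (rule index_eqI)
    show "zsub ((*) y ` A)" "zsub ((*) y ` B)" using zsub_scale A B by auto
    show "\<exists>r\<in>(*) y ` R. x - r \<in> (*) y ` B" if "x \<in> (*) y ` A" for x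
    proof -
      obtain a where a: "a \<in> A" "x = y * a" using \<open>x \<in> (*) y ` A\<close> by blast
      obtain r where r: "r \<in> R" "a - r \<in> B" using R(2)[OF a(1)] by blast
      have "x - y * r = y * (a - r)" by (simp add: a right_diff_distrib)
      then have "x - y * r \<in> (*) y ` B" using r(2) by blast
      with r(1) show ?thesis by blast
    qed
    show "r = s" if "r \<in> (*) y ` R" "s \<in> (*) y ` R" "r - s \<in> (*) y ` B" for r s
    proof -
      obtain a b c where abc: "a \<in> R" "b \<in> R" "c \<in> B" "r = y * a" "s = y * b" "r - s = y * c"
        using \<open>r \<in> (*) y ` R\<close> \<open>s \<in> (*) y ` R\<close> \<open>r - s \<in> (*) y ` B\<close> by blast
      then have "y * (a - b) = y * c" by (simp add: right_diff_distrib)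
      then have "a - b = c" using y by simp
      then show ?thesis using R(3)[of a b] abc by simp
    qed
  qed (use R(1) in blast)
  also have "\<dots> = card R" using y by (intro card_image) (auto simp: inj_on_def)
  also have "\<dots> = index A B" by (rule index_eqI[OF A B R, symmetric])
  finally show ?thesis .
qed

lemma index_pos:
  assumes "finite (residue_classes A B)" "A \<noteq> {}" shows "index A B > 0"
  unfolding index_def using assms by (simp add: card_gt_0_iff)

abbreviation integers :: "'a::field_char_0 set" where
  "integers \<equiv> {x. algebraic_int x}"

lemma zsub_integers: "zsub integers"
  by (auto simp: zsub_def intro: algebraic_int_diff)

section \<open>Integers in coordinates over the powers of \<theta>\<close>

context integral_primitive
begin

abbreviation lin_comb :: "(nat \<Rightarrow> int) \<Rightarrow> 'k" where
  "lin_comb c \<equiv> (\<Sum>i<n. of_int (c i) * \<theta> ^ i)"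

text \<open>Lagrange interpolation writes the coordinates of \<open>x\<close> as sums of its
  conjugates with fixed coefficients, the conjugates of the trace-dual basis of the powers of
  \<theta>. Since \<Delta> clears the denominator of 1/m'(\<theta>), the coordinates of \<Delta> x
  are rational algebraic integers, and the same formula bounds them by the conjugates of
  \<open>x\<close>.\<close>

lemma integral_coordinates:
  "\<exists>(\<Delta>::int) C::real. \<Delta> > 0 \<and> (\<forall>x. algebraic_int x \<longrightarrow> (\<exists>c. of_int \<Delta> * x = lin_comb c \<and>
      (\<forall>B. (\<forall>z\<in>Z. cmod (emb z x) \<le> B) \<longrightarrow> (\<forall>i<n. \<bar>of_int (c i)\<bar> \<le> C * B))))"
proof -
  obtain v where v: "\<And>z. z \<in> Z \<Longrightarrow> poly (pderiv (of_int_poly m)) z * rpoly v z = 1"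
    using pderiv_inverse by blast
  obtain \<Delta> :: int and p where \<Delta>: "\<Delta> > 0" "Polynomial.smult (of_int \<Delta>) v = of_int_poly p"
    using clear_denominators .
  define b where "b = (\<lambda>z i. of_int \<Delta> * rpoly v z * Polynomial.coeff (cofactor z) i)"
  define C where "C = (\<Sum>i<n. \<Sum>z\<in>Z. cmod (b z i))"
  have b_int: "algebraic_int (b z i)" if "z \<in> Z" for z i
  proof -
    have "of_int \<Delta> * rpoly v z = rpoly (Polynomial.smult (of_int \<Delta>) v) z" by (simp add: rpoly_simps)
    also have "\<dots> = poly (of_int_poly p) z" unfolding \<Delta>(2) map_poly_of_rat_of_int ..
    also have "algebraic_int \<dots>" unfolding poly_altdef using Z_integral[OF that]
      by (intro algebraic_int_sum algebraic_int_mult algebraic_int_power) auto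
    finally show ?thesis unfolding b_def by (rule algebraic_int_mult[OF _ cofactor_integral])
  qed
  have "\<exists>c. of_int \<Delta> * x = lin_comb c \<and>
      (\<forall>B. (\<forall>z\<in>Z. cmod (emb z x) \<le> B) \<longrightarrow> (\<forall>i<n. \<bar>of_int (c i)\<bar> \<le> C * B))"
    if x: "algebraic_int x" for x
  proof -
    obtain g where g: "Polynomial.degree g < n" "x = rpoly g \<theta>" using representation .
    have gz: "rpoly g z = emb z x" if "z \<in> Z" for z using emb_rpoly[OF that] g by simp
    have inv: "inverse (poly (cofactor z) z) = rpoly v z" if "z \<in> Z" for z
      using v[OF that] unfolding pderiv_M[OF that] by (rule inverse_unique)
    have eq: "of_rat (of_int \<Delta> * Polynomial.coeff g i) = (\<Sum>z\<in>Z. emb z x * b z i)" for i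
    proof -
      have "map_poly of_rat g = (\<Sum>z\<in>Z. Polynomial.smult (rpoly g z / poly (cofactor z) z) (cofactor z))"
        by (rule lagrange) (use g in simp)
      then have "(of_rat (Polynomial.coeff g i)::complex) =
          Polynomial.coeff (\<Sum>z\<in>Z. Polynomial.smult (rpoly g z / poly (cofactor z) z) (cofactor z)) i"
        by (metis of_rat_hom.coeff_map_poly_hom)
      also have "\<dots> = (\<Sum>z\<in>Z. emb z x * rpoly v z * Polynomial.coeff (cofactor z) i)"
        unfolding Polynomial.coeff_sum by (rule sum.cong) (simp_all add: gz inv[symmetric] divide_inverse)
      finally have "(of_rat (Polynomial.coeff g i)::complex) = (\<Sum>z\<in>Z. emb z x * rpoly v z * Polynomial.coeff (cofactor z) i)" .
      then have "(of_int \<Delta> * of_rat (Polynomial.coeff g i)::complex) = (\<Sum>z\<in>Z. emb z x * b z i)"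
        by (simp add: sum_distrib_left b_def mult_ac)
      then show ?thesis by (simp add: of_rat_mult)
    qed
    have "\<exists>c. of_int \<Delta> * Polynomial.coeff g i = of_int c" for i
    proof -
      have "algebraic_int (of_rat (of_int \<Delta> * Polynomial.coeff g i) :: complex)"
        unfolding eq by (intro algebraic_int_sum algebraic_int_mult emb_integral b_int x)
      then show ?thesis by (blast elim: algebraic_int_rat)
    qed
    then obtain c where c: "\<And>i. of_int \<Delta> * Polynomial.coeff g i = of_int (c i)" by metis
    have "of_int \<Delta> * x = rpoly (Polynomial.smult (of_int \<Delta>) g) \<theta>" by (simp add: g(2) rpoly_simps)
    also have "\<dots> = (\<Sum>i\<le>n - 1. of_rat (of_int \<Delta> * Polynomial.coeff g i) * \<theta> ^ i)"
      by (subst poly_sum_le[of _ "n - 1"]) (use g(1) in \<open>auto simp: of_rat_hom.coeff_map_poly_hom\<close>)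
    also have "\<dots> = lin_comb c" unfolding c using n_pos by (intro sum.cong) auto
    finally have 1: "of_int \<Delta> * x = lin_comb c" .
    have 2: "\<bar>of_int (c i)\<bar> \<le> C * B" if B: "\<forall>z\<in>Z. cmod (emb z x) \<le> B" and i: "i < n" for B i
    proof -
      have "Z \<noteq> {}" using card_Z n_pos by auto
      then have B0: "B \<ge> 0" using B norm_ge_zero order.trans by blast
      have "(of_int (c i) :: complex) = (\<Sum>z\<in>Z. emb z x * b z i)"
        using eq[of i] unfolding c by simp
      then have "\<bar>of_int (c i)\<bar> = cmod (\<Sum>z\<in>Z. emb z x * b z i)" by (metis norm_of_int)
      also have "\<dots> \<le> (\<Sum>z\<in>Z. cmod (emb z x * b z i))" by (rule norm_sum)
      also have "\<dots> \<le> (\<Sum>z\<in>Z. B * cmod (b z i))"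
        by (rule sum_mono) (use B in \<open>auto simp: norm_mult intro!: mult_right_mono\<close>)
      also have "\<dots> = B * (\<Sum>z\<in>Z. cmod (b z i))" by (simp add: sum_distrib_left)
      also have "\<dots> \<le> B * C"
      proof (rule mult_left_mono[OF _ B0])
        show "(\<Sum>z\<in>Z. cmod (b z i)) \<le> C" unfolding C_def
          by (rule member_le_sum[where f = "\<lambda>i. \<Sum>z\<in>Z. cmod (b z i)"]) (use i in \<open>auto intro: sum_nonneg\<close>)
      qed
      finally show ?thesis by (simp only: mult.commute)
    qed
    from 1 2 show ?thesis by blast
  qed
  with \<Delta>(1) show ?thesis by (intro exI[of _ \<Delta>] exI[of _ C]) simp
qed

text \<open>Bounded conjugates leave finitely many choices for the integer coordinates of \<Delta>
  x.\<close>

lemma finite_bounded_integers: "finite {x. algebraic_int x \<and> (\<forall>z\<in>Z. cmod (emb z x) \<le> B)}"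
proof -
  obtain \<Delta> :: int and C :: real where \<Delta>: "\<Delta> > 0" and coord:
    "\<And>x. algebraic_int x \<Longrightarrow> \<exists>c. of_int \<Delta> * x = lin_comb c \<and>
      (\<forall>B. (\<forall>z\<in>Z. cmod (emb z x) \<le> B) \<longrightarrow> (\<forall>i<n. \<bar>of_int (c i)\<bar> \<le> C * B))"
    using integral_coordinates by blast
  define K where "K = \<lceil>C * B\<rceil>"
  have "{x. algebraic_int x \<and> (\<forall>z\<in>Z. cmod (emb z x) \<le> B)} \<subseteq>
      (\<lambda>c. lin_comb c / of_int \<Delta>) ` ({..<n} \<rightarrow>\<^sub>E {-K..K})"
  proof
    fix x assume x: "x \<in> {x. algebraic_int x \<and> (\<forall>z\<in>Z. cmod (emb z x) \<le> B)}"
    then obtain c where c: "of_int \<Delta> * x = lin_comb c" "\<forall>i<n. \<bar>of_int (c i)\<bar> \<le> C * B"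
      using coord[of x] by blast
    define c' where "c' = restrict c {..<n}"
    have "c' \<in> {..<n} \<rightarrow>\<^sub>E {-K..K}"
    proof (rule PiE_I)
      fix i assume "i \<in> {..<n}"
      then have "\<bar>of_int (c i)\<bar> \<le> C * B" using c(2) by auto
      then have "\<bar>c i\<bar> \<le> K" unfolding K_def by linarith
      then show "c' i \<in> {-K..K}" using \<open>i \<in> {..<n}\<close> by (auto simp: c'_def)
    qed (auto simp: c'_def)
    moreover have "x = lin_comb c' / of_int \<Delta>"
    proof -
      have "lin_comb c' = lin_comb c" by (rule sum.cong) (auto simp: c'_def)
      then show ?thesis using c(1) \<Delta> by (simp add: field_simps)
    qed
    ultimately show "x \<in> (\<lambda>c. lin_comb c / of_int \<Delta>) ` ({..<n} \<rightarrow>\<^sub>E {-K..K})" by blast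
  qed
  moreover have "finite ({..<n} \<rightarrow>\<^sub>E {-K..K})" by (intro finite_PiE) auto
  ultimately show ?thesis using finite_surj by blast
qed

lemma finite_residues:
  assumes "N > (0::int)"
  shows "\<exists>R. finite R \<and> (\<forall>x. algebraic_int x \<longrightarrow> (\<exists>r\<in>R. \<exists>c. x - r = of_int N * lin_comb c))"
proof -
  obtain \<Delta> :: int and C :: real where \<Delta>: "\<Delta> > 0" and coord:
    "\<And>x. algebraic_int x \<Longrightarrow> \<exists>c. of_int \<Delta> * x = lin_comb c \<and>
      (\<forall>B. (\<forall>z\<in>Z. cmod (emb z x) \<le> B) \<longrightarrow> (\<forall>i<n. \<bar>of_int (c i)\<bar> \<le> C * B))"
    using integral_coordinates by blast
  define R where "R = (\<lambda>c. lin_comb c / of_int \<Delta>) ` ({..<n} \<rightarrow>\<^sub>E {0..<N * \<Delta>})"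
  have "finite ({..<n} \<rightarrow>\<^sub>E {0..<N * \<Delta>})" by (intro finite_PiE) auto
  then have "finite R" unfolding R_def by blast
  moreover have "\<exists>r\<in>R. \<exists>c. x - r = of_int N * lin_comb c" if x: "algebraic_int x" for x
  proof -
    obtain c where c: "of_int \<Delta> * x = lin_comb c" using coord[OF x] by blast
    have x_eq: "x = lin_comb c / of_int \<Delta>" using c \<Delta> by (simp add: field_simps)
    \<comment> \<open>Reduction is modulo N \<Delta> because the coordinates still have to be
      divided by \<Delta>.\<close>
    define c' where "c' = restrict (\<lambda>i. c i mod (N * \<Delta>)) {..<n}"
    define r where "r = lin_comb c' / of_int \<Delta>"
    have "c' \<in> {..<n} \<rightarrow>\<^sub>E {0..<N * \<Delta>}" using assms \<Delta> by (intro PiE_I) (auto simp: c'_def)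
    then have "r \<in> R" by (auto simp: R_def r_def)
    moreover have "lin_comb c - lin_comb c' = of_int (N * \<Delta>) * lin_comb (\<lambda>i. c i div (N * \<Delta>))"
      unfolding sum_distrib_left sum_subtractf[symmetric]
    proof (rule sum.cong)
      fix i assume i: "i \<in> {..<n}"
      have "c i - c' i = N * \<Delta> * (c i div (N * \<Delta>))"
        using i by (simp add: c'_def minus_mod_eq_mult_div)
      then have "of_int (c i) - of_int (c' i) = (of_int (N * \<Delta> * (c i div (N * \<Delta>))) :: 'k)"
        by (simp only: of_int_diff[symmetric])
      then show "of_int (c i) * \<theta> ^ i - of_int (c' i) * \<theta> ^ i = of_int (N * \<Delta>) * (of_int (c i div (N * \<Delta>)) * \<theta> ^ i)"
        unfolding left_diff_distrib[symmetric] by (simp only: of_int_mult mult.assoc)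
    qed simp
    then have "x - r = of_int N * lin_comb (\<lambda>i. c i div (N * \<Delta>))"
      unfolding x_eq r_def diff_divide_distrib[symmetric] using \<Delta> by simp
    ultimately show ?thesis by (intro bexI exI)
  qed
  ultimately show ?thesis by blast
qed

end

section \<open>Complex embeddings and the index of a principal ideal\<close>

definition complex_embeddings :: "('k::field_char_0 \<Rightarrow> complex) set" where
  "complex_embeddings = Ring.ring_hom ring_of_type_algebra ring_of_type_algebra"

lemma complex_embeddingsD:
  assumes "\<sigma> \<in> complex_embeddings"
  shows "\<sigma> (x + y) = \<sigma> x + \<sigma> y" "\<sigma> (x * y) = \<sigma> x * \<sigma> y" "\<sigma> 1 = 1" "\<sigma> 0 = 0" "field_hom \<sigma>"
proof -
  show 1: "\<sigma> (x + y) = \<sigma> x + \<sigma> y" "\<sigma> (x * y) = \<sigma> x * \<sigma> y" "\<sigma> 1 = 1" for x y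
    using assms by (auto simp: complex_embeddings_def Ring.ring_hom_def ring_of_type_algebra_def)
  show 2: "\<sigma> 0 = 0" using 1(1)[of 0 0] by simp
  show "field_hom \<sigma>" by unfold_locales (auto simp: 1 2)
qed

lemma complex_embedding_eq_0_iff: "\<sigma> \<in> complex_embeddings \<Longrightarrow> \<sigma> x = 0 \<longleftrightarrow> x = 0"
  using complex_embeddingsD(2)[of \<sigma> x "inverse x"] complex_embeddingsD(3,4)[of \<sigma>] by (cases "x = 0") auto

context integral_primitive
begin

lemma complex_embeddings_eq: "complex_embeddings = emb ` Z"
  unfolding complex_embeddings_def by (rule embeddings)

text \<open>The order generated by \<theta>, in which the index of \<theta> can be read off from
  \<open>m\<close>.\<close>

definition Zt where "Zt = range (\<lambda>p::int poly. poly (of_int_poly p) \<theta>)"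

lemma zsub_Zt: "zsub Zt"
  unfolding zsub_def Zt_def
proof (intro conjI ballI)
  show "0 \<in> range (\<lambda>p::int poly. poly (of_int_poly p) \<theta>)" by (intro image_eqI[of _ _ 0]) auto
  fix x y assume "x \<in> range (\<lambda>p::int poly. poly (of_int_poly p) \<theta>)" "y \<in> range (\<lambda>p::int poly. poly (of_int_poly p) \<theta>)"
  then obtain p q :: "int poly" where "x = poly (of_int_poly p) \<theta>" "y = poly (of_int_poly q) \<theta>" by blast
  then have "x - y = poly (of_int_poly (p - q)) \<theta>" by (simp add: of_int_poly_hom.hom_minus)
  then show "x - y \<in> range (\<lambda>p::int poly. poly (of_int_poly p) \<theta>)" by blast
qed

lemma Zt_mult: "x \<in> Zt \<Longrightarrow> y \<in> Zt \<Longrightarrow> x * y \<in> Zt"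
proof -
  assume "x \<in> Zt" "y \<in> Zt"
  then obtain p q :: "int poly" where "x = poly (of_int_poly p) \<theta>" "y = poly (of_int_poly q) \<theta>"
    by (auto simp: Zt_def)
  then have "x * y = poly (of_int_poly (p * q)) \<theta>" by (simp add: of_int_poly_hom.hom_mult)
  then show "x * y \<in> Zt" unfolding Zt_def by blast
qed

lemma theta_Zt: "\<theta> \<in> Zt" and of_int_Zt: "of_int k \<in> Zt"
proof -
  have "\<theta> = poly (of_int_poly [:0, 1:]) \<theta>" "of_int k = poly (of_int_poly [:k:]) \<theta>"
    by (simp_all add: of_int_hom.map_poly_pCons_hom)
  then show "\<theta> \<in> Zt" "of_int k \<in> Zt" unfolding Zt_def by blast+
qed

lemma sum_Zt: "(\<And>i. i \<in> J \<Longrightarrow> u i \<in> Zt) \<Longrightarrow> (\<Sum>i\<in>J. u i) \<in> Zt"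
  by (induction J rule: infinite_finite_induct) (auto intro: zsubD[OF zsub_Zt])

lemma power_Zt: "\<theta> ^ i \<in> Zt"
  by (induction i) (use of_int_Zt[of 1] in \<open>auto intro: Zt_mult theta_Zt\<close>)

lemma lin_comb_Zt: "lin_comb c \<in> Zt"
  by (intro sum_Zt Zt_mult of_int_Zt power_Zt)

lemma Zt_integral: "Zt \<subseteq> integers"
  unfolding Zt_def by (auto simp: poly_altdef
      intro!: algebraic_int_sum algebraic_int_mult algebraic_int_power theta_integral)

text \<open>Pseudo-division by the monic \<open>m\<close> is honest division over the integers, and
  its remainder vanishes by minimality.\<close>

lemma root_imp_multiple:
  assumes "poly (of_int_poly p) \<theta> = 0"
  obtains s where "p = m * s"
proof -
  obtain q r where qr: "pseudo_divmod p m = (q, r)" by (cases "pseudo_divmod p m")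
  have eq: "p = m * q + r" and r: "r = 0 \<or> Polynomial.degree r < n"
    using pseudo_divmod[OF m_nonzero qr] monic_m by (simp_all add: n_def)
  have "of_int_poly p = (of_int_poly m * of_int_poly q + of_int_poly r :: 'k poly)"
    unfolding eq by (simp only: of_int_poly_hom.hom_add of_int_poly_hom.hom_mult)
  then have "poly (of_int_poly r) \<theta> = 0"
    using assms minimal_polyD(2)[OF minimal] by (simp add: map_poly_of_rat_of_int)
  then have "rpoly (of_int_poly r) \<theta> = 0" by (simp add: map_poly_of_rat_of_int)
  then have "r = 0" using minimal_polyD(4)[OF minimal, of "of_int_poly r"] r by (force simp: n_def)
  with eq have "p = m * q" by simp
  then show ?thesis by (rule that)
qed

definition c0 where "c0 = Polynomial.coeff m 0"

text \<open>m(\<theta>) = 0 says that the constant term is -\<theta> q(\<theta>) with q over the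
  integers.\<close>

lemma c0_multiple:
  assumes "x \<in> Zt" shows "of_int c0 * x \<in> (*) \<theta> ` Zt"
proof -
  obtain a q where m: "m = pCons a q" by (cases m)
  have "poly (of_int_poly m) \<theta> = 0" using minimal_polyD(2)[OF minimal] by (simp add: map_poly_of_rat_of_int)
  then have "of_int a + \<theta> * poly (of_int_poly q) \<theta> = 0" by (simp add: m of_int_hom.map_poly_pCons_hom)
  moreover have "c0 = a" unfolding c0_def by (simp add: m)
  ultimately have "of_int c0 = - (\<theta> * poly (of_int_poly q) \<theta>)" by (simp only: eq_neg_iff_add_eq_0)
  then have "of_int c0 * x = \<theta> * (- poly (of_int_poly q) \<theta> * x)" by (simp only: mult_minus_left mult_minus_right mult.assoc)
  moreover have "poly (of_int_poly q) \<theta> \<in> Zt" by (auto simp: Zt_def)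
  then have "- poly (of_int_poly q) \<theta> * x \<in> Zt" by (intro Zt_mult zsubD(3)[OF zsub_Zt] assms)
  ultimately show ?thesis by blast
qed

lemma c0_nonzero:
  assumes "\<theta> \<noteq> 0" shows "c0 \<noteq> 0"
proof
  assume "c0 = 0"
  then have "Polynomial.coeff m 0 = 0" unfolding c0_def .
  then obtain q where m: "m = pCons 0 q" by (cases m) auto
  have "poly (of_int_poly m) \<theta> = 0" using minimal_polyD(2)[OF minimal] by (simp add: map_poly_of_rat_of_int)
  then have "rpoly (of_int_poly q) \<theta> = 0" using assms by (simp add: m of_int_hom.map_poly_pCons_hom map_poly_of_rat_of_int)
  moreover have "q \<noteq> 0" using m m_nonzero by auto
  ultimately show False using minimal_polyD(4)[OF minimal, of "of_int_poly q"] by (simp add: m)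
qed

text \<open>The quotient is \<int> modulo \<open>c0\<close>: modulo \<theta> a polynomial in
  \<theta> is its constant term, and an integer divisible by \<theta> in the order is a multiple of
  \<open>c0\<close> by \<open>root_imp_multiple\<close>.\<close>

lemma index_Zt:
  assumes "\<theta> \<noteq> 0" shows "index Zt ((*) \<theta> ` Zt) = nat \<bar>c0\<bar>"
proof -
  have "index Zt ((*) \<theta> ` Zt) = card (of_int ` {0..<\<bar>c0\<bar>} :: 'k set)"
  proof (rule index_eqI)
    show "zsub Zt" "zsub ((*) \<theta> ` Zt)" using zsub_scale zsub_Zt by auto
    show "of_int ` {0..<\<bar>c0\<bar>} \<subseteq> Zt" using of_int_Zt by blast
    show "\<exists>r\<in>of_int ` {0..<\<bar>c0\<bar>}. x - r \<in> (*) \<theta> ` Zt" if x: "x \<in> Zt" for x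
    proof -
      obtain p :: "int poly" where p: "x = poly (of_int_poly p) \<theta>" using x by (auto simp: Zt_def)
      obtain a q where q: "p = pCons a q" by (cases p)
      define k where "k = a div \<bar>c0\<bar>"
      have "a - a mod \<bar>c0\<bar> = c0 * (sgn c0 * k)"
        unfolding k_def by (metis abs_sgn minus_mod_eq_mult_div mult.assoc)
      then have "of_int a - of_int (a mod \<bar>c0\<bar>) = (of_int c0 * of_int (sgn c0 * k) :: 'k)"
        by (metis of_int_diff of_int_mult)
      moreover have "of_int c0 * of_int (sgn c0 * k) \<in> (*) \<theta> ` Zt" by (intro c0_multiple of_int_Zt)
      ultimately have "of_int a - of_int (a mod \<bar>c0\<bar>) \<in> (*) \<theta> ` Zt" by simp
      moreover have "\<theta> * poly (of_int_poly q) \<theta> \<in> (*) \<theta> ` Zt" by (auto simp: Zt_def)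
      ultimately have "(of_int a - of_int (a mod \<bar>c0\<bar>)) + \<theta> * poly (of_int_poly q) \<theta> \<in> (*) \<theta> ` Zt"
        by (rule zsubD(4)[OF zsub_scale[OF zsub_Zt]])
      then have "x - of_int (a mod \<bar>c0\<bar>) \<in> (*) \<theta> ` Zt" by (simp add: p q of_int_hom.map_poly_pCons_hom algebra_simps)
      moreover have "a mod \<bar>c0\<bar> \<in> {0..<\<bar>c0\<bar>}" using c0_nonzero[OF assms] by simp
      ultimately show ?thesis by blast
    qed
    show "r = s" if rs: "r \<in> of_int ` {0..<\<bar>c0\<bar>}" "s \<in> of_int ` {0..<\<bar>c0\<bar>}" "r - s \<in> (*) \<theta> ` Zt" for r s
    proof -
      obtain i j where ij: "r = of_int i" "s = of_int j" "i \<in> {0..<\<bar>c0\<bar>}" "j \<in> {0..<\<bar>c0\<bar>}" using rs by blast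
      obtain q :: "int poly" where q: "r - s = \<theta> * poly (of_int_poly q) \<theta>" using rs(3) by (auto simp: Zt_def)
      have "poly (of_int_poly (pCons (j - i) q)) \<theta> = 0"
        using q by (simp add: ij of_int_hom.map_poly_pCons_hom algebra_simps)
      then obtain t where "pCons (j - i) q = m * t" by (rule root_imp_multiple)
      then have "Polynomial.coeff (pCons (j - i) q) 0 = Polynomial.coeff (m * t) 0" by simp
      then have "j - i = c0 * Polynomial.coeff t 0" by (simp add: c0_def mult_poly_0_right coeff_mult_0)
      then have "c0 dvd j - i" by simp
      moreover have "\<bar>j - i\<bar> < \<bar>c0\<bar>" using ij by auto
      ultimately have "j - i = 0" by (metis abs_dvd_iff dvd_abs_iff linorder_not_less zdvd_not_zless zero_less_abs_iff)
      then show "r = s" using ij by simp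
    qed
  qed
  also have "\<dots> = card {0..<\<bar>c0\<bar>}" by (intro card_image) (auto simp: inj_on_def)
  finally show ?thesis by simp
qed

text \<open>The index of \<theta> \<open>Zt\<close> in the integers is computed through \<theta>
  \<open>integers\<close> and through \<open>Zt\<close>. By \<open>index_scale\<close> the index of
  \<open>Zt\<close> occurs on both sides, and it cancels because it is finite. What remains is the
  constant term of \<open>m\<close>, up to sign the product of the conjugates.\<close>

lemma index_theta:
  assumes "\<theta> \<noteq> 0" shows "real (index integers ((*) \<theta> ` integers)) = (\<Prod>\<sigma>\<in>complex_embeddings. cmod (\<sigma> \<theta>))"
proof -
  note zs = zsub_integers zsub_Zt zsub_scale[OF zsub_Zt, of \<theta>] zsub_scale[OF zsub_integers, of \<theta>]
  have sub: "(*) \<theta> ` Zt \<subseteq> Zt" using Zt_mult theta_Zt by blast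
  have sub2: "(*) \<theta> ` integers \<subseteq> integers" using algebraic_int_mult theta_integral by blast
  have "finite (residue_classes integers Zt)"
  proof -
    obtain R where R: "finite R" "\<forall>x. algebraic_int x \<longrightarrow> (\<exists>r\<in>R. \<exists>c. x - r = of_int 1 * lin_comb c)"
      using finite_residues[of 1] by auto
    have "\<exists>r\<in>R. x - r \<in> Zt" if "x \<in> integers" for x
    proof -
      have "\<exists>r\<in>R. \<exists>c. x - r = of_int 1 * lin_comb c" using R(2) that by simp
      then show ?thesis
      proof (elim bexE exE)
        fix r c assume "r \<in> R" "x - r = of_int 1 * lin_comb c"
        then show ?thesis using lin_comb_Zt[of c] by (intro bexI[of _ r]) simp_all
      qed
    qed
    then show ?thesis by (rule finite_residue_classes[OF zs(1,2) R(1)])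
  qed
  then have pos: "index integers Zt > 0" by (rule index_pos) (use zsubD(1)[OF zsub_integers] in auto)
  have "index integers ((*) \<theta> ` integers) * index ((*) \<theta> ` integers) ((*) \<theta> ` Zt) = index integers ((*) \<theta> ` Zt)"
    by (rule index_mult[symmetric]) (use zs sub2 Zt_integral in auto)
  also have "\<dots> = index integers Zt * index Zt ((*) \<theta> ` Zt)"
    by (rule index_mult) (use zs sub Zt_integral in auto)
  also have "index ((*) \<theta> ` integers) ((*) \<theta> ` Zt) = index integers Zt"
    by (rule index_scale) (use zs Zt_integral assms in auto)
  finally have "index integers ((*) \<theta> ` integers) = nat \<bar>c0\<bar>" using pos index_Zt[OF assms] by simp
  moreover have "(\<Prod>\<sigma>\<in>complex_embeddings. cmod (\<sigma> \<theta>)) = (\<Prod>z\<in>Z. cmod z)"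
    unfolding complex_embeddings_eq by (subst prod.reindex[OF inj_emb]) (simp add: emb_simps)
  moreover have "(\<Prod>z\<in>Z. cmod z) = real (nat \<bar>c0\<bar>)"
  proof -
    have "(of_int c0 :: complex) = poly (of_int_poly m) 0" by (simp add: c0_def poly_0_coeff_0)
    also have "\<dots> = (\<Prod>z\<in>Z. - z)" unfolding M_factors[symmetric] by (simp add: poly_prod)
    finally have "cmod (of_int c0) = cmod (\<Prod>z\<in>Z. - z)" by (rule arg_cong)
    then show ?thesis by (simp add: prod_norm[symmetric])
  qed
  ultimately show ?thesis by simp
qed

text \<open>A polynomial vanishing at \<open>y\<close> vanishes at its \<open>n\<close> distinct
  conjugates. So the powers of \<open>y\<close> below \<open>n\<close> are independent, and any
  \<open>x\<close> is a combination of them by dimension.\<close>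

lemma primitive_if_embeddings_distinct:
  assumes y: "algebraic_int y" and inj: "inj_on (\<lambda>z. emb z y) Z"
  shows "\<exists>m'. integral_primitive y m'"
proof -
  have alg: "algebraic y" using y by auto
  obtain p :: "int poly" where p: "poly (of_int_poly p) y = 0" "monic p"
    using y by (auto simp: algebraic_int_altdef_ipoly)
  have "rpoly (of_int_poly p) y = 0" "of_int_poly p \<noteq> (0 :: rat poly)"
    using p by (auto simp: map_poly_of_rat_of_int)
  then obtain g where g: "minimal_poly g y" using minimal_poly_exists by metis
  obtain m' where m': "g = of_int_poly m'" using minimal_poly_integer[OF g y] .
  have deg: "n \<le> Polynomial.degree h" if "h \<noteq> 0" "rpoly h y = 0" for h
  proof -
    have "(\<lambda>z. emb z y) ` Z \<subseteq> {w. rpoly h w = 0}"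
    proof (rule image_subsetI)
      fix z assume z: "z \<in> Z"
      obtain f where f: "y = rpoly f \<theta>" using representation_ex by blast
      have "rpoly h (emb z y) = emb z (rpoly h y)"
        unfolding f emb_rpoly[OF z] by (simp only: rpoly_simps(4)[symmetric] emb_rpoly[OF z])
      then show "emb z y \<in> {w. rpoly h w = 0}" using that(2) emb_simps(4)[OF z] by simp
    qed
    then have "card ((\<lambda>z. emb z y) ` Z) \<le> card {w::complex. rpoly h w = 0}"
      by (rule card_mono[rotated]) (rule poly_roots_finite, use that(1) in simp)
    also have "\<dots> \<le> Polynomial.degree (map_poly of_rat h :: complex poly)"
      by (rule card_poly_roots_bound) (use that(1) in simp)
    finally show ?thesis using card_image[OF inj] card_Z by simp
  qed
  have "x \<in> rat_adjoin y" for x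
  proof -
    \<comment> \<open>\<open>n + 1\<close> elements of an \<open>n\<close>-dimensional space: the
      powers of \<open>y\<close>, and \<open>x\<close> in the last place.\<close>
    define u where "u = (\<lambda>j. if j < n then y ^ j else x)"
    have "\<exists>c. u j = rpoly c \<theta> \<and> Polynomial.degree c < n" for j using representation[of "u j"] by blast
    then obtain c where c: "\<And>j. u j = rpoly (c j) \<theta>" "\<And>j. Polynomial.degree (c j) < n" by metis
    obtain a where a: "\<exists>j\<in>{..n}. a j \<noteq> 0" "\<forall>i\<in>{..<n}. (\<Sum>j\<in>{..n}. a j * Polynomial.coeff (c j) i) = 0"
      using homogeneous_system_nontrivial[of "{..<n}" "{..n}" "\<lambda>j i. Polynomial.coeff (c j) i"] by auto
    define s where "s = (\<Sum>j\<le>n. Polynomial.smult (a j) (c j))"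
    have "Polynomial.coeff s i = 0" for i
    proof (cases "i < n")
      case True
      then show ?thesis using a(2) by (simp add: s_def Polynomial.coeff_sum)
    next
      case False
      then have "Polynomial.coeff (c j) i = 0" for j using c(2)[of j] by (intro coeff_eq_0) simp
      then show ?thesis by (simp add: s_def Polynomial.coeff_sum)
    qed
    then have "s = 0" by (intro poly_eqI) simp
    have "rpoly s \<theta> = (\<Sum>j\<le>n. of_rat (a j) * u j)"
    proof -
      have "rpoly (\<Sum>j\<in>J. Polynomial.smult (a j) (c j)) \<theta> = (\<Sum>j\<in>J. of_rat (a j) * u j)" for J
        by (induction J rule: infinite_finite_induct) (simp_all add: rpoly_simps c(1))
      then show ?thesis by (simp add: s_def)
    qed
    then have sum0: "(\<Sum>j\<le>n. of_rat (a j) * u j) = 0" using \<open>s = 0\<close> by (simp add: rpoly_simps)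
    define h where "h = (\<Sum>j\<le>n - 1. Polynomial.monom (a j) j)"
    have "rpoly h y = (\<Sum>j\<le>n - 1. of_rat (a j) * y ^ j)" unfolding h_def by (rule rpoly_sum_monom)
    also have "\<dots> = (\<Sum>j<n. of_rat (a j) * u j)" by (rule sum.cong) (use n_pos in \<open>auto simp: u_def\<close>)
    also have "\<dots> = - (of_rat (a n) * x)" using sum0
      by (simp add: lessThan_Suc_atMost[symmetric] u_def eq_neg_iff_add_eq_0)
    finally have hx: "rpoly h y = - (of_rat (a n) * x)" .
    have "a n \<noteq> 0"
    proof
      assume an: "a n = 0"
      then have "rpoly h y = 0" using hx by simp
      moreover have "Polynomial.degree h < n" using degree_sum_monom_le[of a "n - 1"] n_pos unfolding h_def by linarith
      ultimately have "h = 0" using deg[of h] by force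
      then have "a j = 0" if "j \<le> n - 1" for j using coeff_sum_monom[of a "n - 1" j] that by (simp add: h_def)
      then have "a j = 0" if "j \<le> n" for j using an that by (cases "j = n") auto
      with a(1) show False by auto
    qed
    then have "x = rpoly (Polynomial.smult (- inverse (a n)) h) y"
      using hx by (simp add: rpoly_simps of_rat_minus of_rat_inverse)
    then show ?thesis unfolding rat_adjoin_def by blast
  qed
  then have "rat_adjoin y = UNIV" by blast
  then have "integral_primitive y m'" using g m' by unfold_locales auto
  then show ?thesis ..
qed

text \<open>The order \<open>\<int>[\<theta>]\<close> yields the index of \<open>\<theta> O\<close> for an integral primitive element \<open>\<theta>\<close>. In general
  \<open>x\<close> is a quotient of two such elements \<open>x y\<close> and \<open>y\<close>.\<close>

theorem index_principal:
  fixes x :: 'k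
  assumes x: "algebraic_int x" "x \<noteq> 0"
  shows "real (index integers ((*) x ` integers)) = (\<Prod>\<sigma>\<in>complex_embeddings. cmod (\<sigma> x))"
proof -
  \<comment> \<open>The values of \<open>c\<close> for which two conjugates of x (\<theta> + c)
    coincide although those of \<open>x\<close> differ. Where those of \<open>x\<close> agree, the
    conjugates of \<theta> already separate the products.\<close>
  define bad where "bad = (\<lambda>(z,w). (emb w x * w - emb z x * z) / (emb z x - emb w x)) ` (Z \<times> Z)"
  have "finite bad" using finite_Z by (simp add: bad_def)
  then have "finite (of_nat -` bad :: nat set)"
    by (rule finite_vimageI) (simp add: inj_on_def)
  moreover have "finite {c::nat. \<theta> + of_nat c = 0}"
  proof (rule finite_subset)
    show "{c::nat. \<theta> + of_nat c = 0} \<subseteq> of_nat -` {- \<theta>}" by (auto simp: eq_neg_iff_add_eq_0 add.commute)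
    show "finite (of_nat -` {- \<theta>} :: nat set)" by (rule finite_vimageI) (auto simp: inj_on_def)
  qed
  ultimately have "finite (of_nat -` bad \<union> {c::nat. \<theta> + of_nat c = 0})" by blast
  from ex_new_if_finite[OF infinite_UNIV_nat this] obtain c :: nat
    where c: "of_nat c \<notin> bad" "\<theta> + of_nat c \<noteq> 0" by blast
  define y where "y = \<theta> + of_nat c"
  have y: "algebraic_int y" unfolding y_def by (intro algebraic_int_add theta_integral) auto
  have ey: "emb z y = z + of_nat c" if "z \<in> Z" for z
    using emb_simps(6)[OF that, of "of_nat c"] by (simp add: y_def emb_simps that)
  have "inj_on (\<lambda>z. emb z y) Z" by (rule inj_onI) (simp add: ey)
  then obtain m1 where m1: "integral_primitive y m1" using primitive_if_embeddings_distinct[OF y] by blast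
  have "inj_on (\<lambda>z. emb z (x * y)) Z"
  proof (rule inj_onI, rule ccontr)
    fix z w assume zw: "z \<in> Z" "w \<in> Z" "emb z (x * y) = emb w (x * y)" "z \<noteq> w"
    have eq: "emb z x * (z + of_nat c) = emb w x * (w + of_nat c)"
      using zw by (simp add: emb_simps ey)
    have ez: "emb z x \<noteq> 0" using zw(1) x(2) complex_embedding_eq_0_iff complex_embeddings_eq by blast
    show False
    proof (cases "emb z x = emb w x")
      case True
      then show ?thesis using eq ez zw(4) by simp
    next
      case False
      then have "of_nat c = (emb w x * w - emb z x * z) / (emb z x - emb w x)"
        using eq by (simp add: field_simps)
      then show ?thesis using c(1) zw(1,2) by (auto simp: bad_def)
    qed
  qed
  then obtain m2 where m2: "integral_primitive (x * y) m2"
    using primitive_if_embeddings_distinct[OF algebraic_int_mult[OF x(1) y]] by blast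
  have y0: "y \<noteq> 0" using c(2) by (simp add: y_def)
  have "(*) x ` (*) y ` integers = (*) (x * y) ` integers" by (simp add: image_image mult.assoc)
  moreover have "index integers ((*) x ` (*) y ` integers) =
      index integers ((*) x ` integers) * index ((*) x ` integers) ((*) x ` (*) y ` integers)"
    using x(1) y by (intro index_mult zsub_scale zsub_integers image_mono) (auto intro: algebraic_int_mult)
  moreover have "index ((*) x ` integers) ((*) x ` (*) y ` integers) = index integers ((*) y ` integers)"
    using x(2) y by (intro index_scale zsub_scale zsub_integers) (auto intro: algebraic_int_mult)
  ultimately have "real (index integers ((*) (x * y) ` integers)) =
      real (index integers ((*) x ` integers)) * real (index integers ((*) y ` integers))" by simp
  moreover have "(\<Prod>\<sigma>\<in>complex_embeddings. cmod (\<sigma> (x * y))) =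
      (\<Prod>\<sigma>\<in>complex_embeddings. cmod (\<sigma> x)) * (\<Prod>\<sigma>\<in>complex_embeddings. cmod (\<sigma> y))"
    by (simp add: prod.distrib[symmetric] complex_embeddingsD norm_mult)
  moreover have "(\<Prod>\<sigma>\<in>complex_embeddings. cmod (\<sigma> y)) \<noteq> 0"
    using y0 finite_Z by (simp add: complex_embeddings_eq) (metis complex_embedding_eq_0_iff complex_embeddings_eq imageI)
  ultimately show ?thesis
    using integral_primitive.index_theta[OF m1 y0] integral_primitive.index_theta[OF m2] x(2) y0 by simp
qed

end

section \<open>Fractions and residues in a number field\<close>

lemma number_field_integral_primitive:
  assumes "number_field TYPE('k::field_char_0)"
  shows "\<exists>(\<theta>::'k::field_char_0) m. integral_primitive \<theta> m"
proof -
  obtain \<theta> :: 'k where \<theta>: "algebraic_int \<theta>" "rat_adjoin \<theta> = UNIV"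
    using number_field_primitive_integer[OF assms] .
  obtain g :: "rat poly" where "g \<noteq> 0" "rpoly g \<theta> = 0" using number_field_annihilator[OF assms] by blast
  then obtain h where h: "minimal_poly h \<theta>" by (rule minimal_poly_exists)
  obtain m where "h = of_int_poly m" using minimal_poly_integer[OF h \<theta>(1)] .
  then have "integral_primitive \<theta> m" using h \<theta>(2) by unfold_locales auto
  then show ?thesis by blast
qed

text \<open>The integer is the constant term of the minimal polynomial of \<open>x\<close>, made
  positive; the rest of the polynomial provides the cofactor \<open>w\<close>.\<close>

lemma algebraic_int_divides_integer:
  assumes nf: "number_field TYPE('k::field_char_0)" and x: "algebraic_int (x::'k)" "x \<noteq> 0"
  obtains N :: int and w where "N > 0" "algebraic_int w" "w * x = of_int N"
proof -
  obtain g :: "rat poly" where "g \<noteq> 0" "rpoly g x = 0" using number_field_annihilator[OF nf] by blast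
  then obtain h where h: "minimal_poly h x" by (rule minimal_poly_exists)
  obtain m where m: "h = of_int_poly m" using minimal_poly_integer[OF h x(1)] .
  obtain a q where aq: "m = pCons a q" by (cases m)
  have root: "of_int a + x * poly (of_int_poly q) x = 0"
  proof -
    have "poly (of_int_poly m) x = 0" using minimal_polyD(2)[OF h] unfolding m map_poly_of_rat_of_int .
    then show ?thesis by (simp add: aq of_int_hom.map_poly_pCons_hom)
  qed
  have "a \<noteq> 0"
  proof
    assume "a = 0"
    with root x(2) have "rpoly (of_int_poly q) x = 0" by (simp add: map_poly_of_rat_of_int)
    moreover have "q \<noteq> 0" using minimal_poly_degree_pos[OF h] by (auto simp: m aq)
    ultimately show False using minimal_polyD(4)[OF h, of "of_int_poly q"] by (simp add: m aq)
  qed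
  define w where "w = of_int (- sgn a) * poly (of_int_poly q) x"
  have "w * x = of_int (- sgn a) * (x * poly (of_int_poly q) x)" by (simp add: w_def)
  also have "x * poly (of_int_poly q) x = - of_int a" using root by (metis add_eq_0_iff)
  also have "of_int (- sgn a) * - of_int a = (of_int (sgn a * a) :: 'k)" by simp
  also have "sgn a * a = \<bar>a\<bar>" by (simp add: mult.commute abs_sgn)
  finally have "w * x = of_int \<bar>a\<bar>" .
  moreover have "algebraic_int w" unfolding w_def poly_altdef using x(1)
    by (intro algebraic_int_mult algebraic_int_sum algebraic_int_power) auto
  ultimately show ?thesis using \<open>a \<noteq> 0\<close> that[of "\<bar>a\<bar>" w] by simp
qed

lemma number_field_fraction:
  assumes nf: "number_field TYPE('k::field_char_0)"
  obtains a :: "'k::field_char_0" and b :: 'k where "algebraic_int a" "algebraic_int b" "b \<noteq> 0" "x = a / b"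
proof -
  obtain g :: "rat poly" where g: "g \<noteq> 0" "rpoly g x = 0" using number_field_annihilator[OF nf] by blast
  have "algebraic x"
    by (rule algebraicI'[of "map_poly of_rat g"]) (use g in \<open>auto simp: of_rat_hom.coeff_map_poly_hom\<close>)
  then obtain D :: int where D: "D > 0" "algebraic_int (of_int D * x)" by (rule algebraic_int_multiple)
  show ?thesis by (rule that[of "of_int D * x" "of_int D"]) (use D in auto)
qed

text \<open>\<open>finite_residues\<close> with the primitive element hidden in a finite set
  \<open>G\<close>. The span of N G has finite index in the integers, which yields both finite
  residue rings and finite generation of ideals.\<close>

lemma number_field_residues:
  assumes nf: "number_field TYPE('k::field_char_0)" and N: "N > (0::int)"
  shows "\<exists>G R. finite G \<and> finite R \<and> G \<subseteq> (integers :: 'k set) \<and>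
    (\<forall>x\<in>integers. \<exists>r\<in>R. x - r \<in> zmod.span ((*) (of_int N) ` G))"
proof -
  obtain \<theta> :: 'k and m where "integral_primitive \<theta> m"
    using number_field_integral_primitive[OF nf] by blast
  then interpret integral_primitive \<theta> m .
  obtain R where R: "finite R" "\<forall>x. algebraic_int x \<longrightarrow> (\<exists>r\<in>R. \<exists>c. x - r = of_int N * lin_comb c)"
    using finite_residues[OF N] by blast
  define G where "G = (\<lambda>i. \<theta> ^ i) ` {..<n}"
  have lc: "of_int N * lin_comb c \<in> zmod.span ((*) (of_int N) ` G)" for c
    unfolding sum_distrib_left
  proof (rule zmod.span_sum)
    fix i assume "i \<in> {..<n}"
    then have "of_int N * \<theta> ^ i \<in> zmod.span ((*) (of_int N) ` G)" by (intro zmod.span_base imageI) (auto simp: G_def)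
    then have "of_int (c i) * (of_int N * \<theta> ^ i) \<in> zmod.span ((*) (of_int N) ` G)" by (rule zmod.span_scale)
    then show "of_int N * (of_int (c i) * \<theta> ^ i) \<in> zmod.span ((*) (of_int N) ` G)"
      by (simp only: mult.left_commute)
  qed
  have "\<exists>r\<in>R. x - r \<in> zmod.span ((*) (of_int N) ` G)" if "x \<in> integers" for x
  proof -
    have "\<exists>r\<in>R. \<exists>c. x - r = of_int N * lin_comb c" using R(2) that by simp
    then show ?thesis
    proof (elim bexE exE)
      fix r c assume "r \<in> R" "x - r = of_int N * lin_comb c"
      then show ?thesis using lc[of c] by (intro bexI[of _ r]) simp_all
    qed
  qed
  moreover have "G \<subseteq> integers" unfolding G_def using algebraic_int_power theta_integral by blast
  ultimately show ?thesis using R(1) by (intro exI[of _ G] exI[of _ R]) (auto simp: G_def)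
qed

section \<open>Localisation at a prime ideal\<close>

text \<open>Ideals of the ring of integers as plain sets; \<open>ideal_ring_of_integers_iff\<close>
  connects them with the record version. Closure under differences comes from the scalar -1.\<close>

definition integral_ideal :: "'k::field_char_0 set \<Rightarrow> bool" where
  "integral_ideal J \<longleftrightarrow> J \<subseteq> integers \<and> 0 \<in> J \<and> (\<forall>x\<in>J. \<forall>y\<in>J. x + y \<in> J) \<and>
     (\<forall>a\<in>integers. \<forall>x\<in>J. a * x \<in> J)"

lemma integral_idealD:
  assumes "integral_ideal J"
  shows "J \<subseteq> integers" "0 \<in> J" "x \<in> J \<Longrightarrow> y \<in> J \<Longrightarrow> x + y \<in> J"
    "algebraic_int a \<Longrightarrow> x \<in> J \<Longrightarrow> a * x \<in> J" "x \<in> J \<Longrightarrow> y \<in> J \<Longrightarrow> x - y \<in> J" "zsub J"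
    "x \<in> J \<Longrightarrow> algebraic_int x"
proof -
  show 1: "J \<subseteq> integers" "0 \<in> J" "x \<in> J \<Longrightarrow> y \<in> J \<Longrightarrow> x + y \<in> J" "algebraic_int a \<Longrightarrow> x \<in> J \<Longrightarrow> a * x \<in> J"
    "x \<in> J \<Longrightarrow> algebraic_int x" for x y a
    using assms by (auto simp: integral_ideal_def)
  show 2: "x \<in> J \<Longrightarrow> y \<in> J \<Longrightarrow> x - y \<in> J" for x y
    using 1(3)[of x "- 1 * y"] 1(4)[of "- 1" y] by auto
  show "zsub J" using 1 2 by (auto simp: zsub_def)
qed

definition integral_prime :: "'k::field_char_0 set \<Rightarrow> bool" where
  "integral_prime P \<longleftrightarrow> integral_ideal P \<and> P \<noteq> {0} \<and> 1 \<notin> P \<and>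
     (\<forall>a\<in>integers. \<forall>b\<in>integers. a * b \<in> P \<longrightarrow> a \<in> P \<or> b \<in> P)"

lemma integral_ideal_principal: "algebraic_int x \<Longrightarrow> integral_ideal ((*) x ` integers)"
  unfolding integral_ideal_def
proof (intro conjI ballI)
  assume x: "algebraic_int x"
  show "(*) x ` integers \<subseteq> integers" using x algebraic_int_mult by blast
  show "0 \<in> (*) x ` integers" by (intro image_eqI[of _ _ 0]) auto
  fix a b assume "a \<in> (*) x ` integers" "b \<in> (*) x ` integers"
  then obtain a' b' where "a = x * a'" "b = x * b'" "algebraic_int a'" "algebraic_int b'" by blast
  then show "a + b \<in> (*) x ` integers"
    by (intro image_eqI[of _ _ "a' + b'"]) (auto simp: distrib_left algebraic_int_add)
next
  fix c a assume "c \<in> (integers :: 'a set)" "a \<in> (*) x ` integers"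
  then obtain a' where "a = x * a'" "algebraic_int a'" "algebraic_int c" by blast
  then show "c * a \<in> (*) x ` integers"
    by (intro image_eqI[of _ _ "c * a'"]) (auto simp: algebraic_int_mult mult_ac)
qed

text \<open>With w x = N the principal ideal contains N times the integers, in particular the span
  of N G.\<close>

lemma finite_residue_classes_principal:
  assumes nf: "number_field TYPE('k::field_char_0)" and x: "algebraic_int (x::'k)" "x \<noteq> 0"
  shows "finite (residue_classes integers ((*) x ` integers))"
proof -
  obtain N w where N: "N > 0" "algebraic_int w" "w * x = of_int N"
    using algebraic_int_divides_integer[OF assms] .
  obtain G R where GR: "finite R" "G \<subseteq> (integers :: 'k set)"
    "\<forall>y\<in>integers. \<exists>r\<in>R. y - r \<in> zmod.span ((*) (of_int N) ` G)"
    using number_field_residues[OF nf N(1)] by blast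
  have id: "integral_ideal ((*) x ` integers)" by (rule integral_ideal_principal[OF x(1)])
  have "zmod.span ((*) (of_int N) ` G) \<subseteq> (*) x ` integers"
  proof (rule zmod.span_minimal)
    show "(*) (of_int N) ` G \<subseteq> (*) x ` integers"
    proof (rule image_subsetI)
      fix g assume "g \<in> G"
      then have "algebraic_int g" using GR(2) by blast
      moreover have "of_int N * g = x * (w * g)" by (simp add: N(3)[symmetric])
      ultimately show "of_int N * g \<in> (*) x ` integers"
        using algebraic_int_mult[OF N(2)] by (intro image_eqI[of _ _ "w * g"]) simp_all
    qed
    show "zmod.subspace ((*) x ` integers)"
      unfolding zmod.subspace_def
    proof (intro conjI ballI allI)
      show "of_int c * a \<in> (*) x ` integers" if "a \<in> (*) x ` integers" for c a
        by (rule integral_idealD(4)[OF id _ that]) simp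
    qed (rule integral_idealD(2)[OF id], rule integral_idealD(3)[OF id])
  qed
  then have "\<exists>r\<in>R. y - r \<in> (*) x ` integers" if "y \<in> integers" for y
    using GR(3) that by (meson subsetD)
  then show ?thesis
    by (rule finite_residue_classes[OF zsub_integers zsub_scale[OF zsub_integers] GR(1)])
qed

text \<open>An ideal containing \<open>x\<close> is a union of residue classes modulo
  \<open>x\<close>. This finiteness takes the place of the Noetherian property, and it also shows
  that only finitely many primes contain \<open>x\<close>.\<close>

lemma finite_ideals_containing:
  assumes nf: "number_field TYPE('k::field_char_0)" and x: "algebraic_int (x::'k)" "x \<noteq> 0"
  shows "finite {J. integral_ideal J \<and> x \<in> J}"
proof (rule inj_on_finite)
  let ?B = "(*) x ` integers"
  show "finite (Pow (residue_classes integers ?B))"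
    using finite_residue_classes_principal[OF assms] by simp
  let ?f = "\<lambda>J. residue_class integers ?B ` J"
  show "?f ` {J. integral_ideal J \<and> x \<in> J} \<subseteq> Pow (residue_classes integers ?B)"
    using integral_idealD(1) by blast
  have sub: "J \<subseteq> L" if J: "integral_ideal J" "x \<in> J" and L: "integral_ideal L" "x \<in> L" and eq: "?f J = ?f L" for J L
  proof
    fix a assume a: "a \<in> J"
    then have "residue_class integers ?B a \<in> ?f L" unfolding eq[symmetric] by (rule imageI)
    then obtain b where b: "b \<in> L" "residue_class integers ?B a = residue_class integers ?B b" by (elim imageE)
    then have "a - b \<in> ?B"
      using residue_class_eq_iff[OF zsub_integers zsub_scale[OF zsub_integers], of a b]
        integral_idealD(7)[OF J(1) a] integral_idealD(7)[OF L(1) b(1)] by simp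
    then obtain c where "algebraic_int c" "a - b = x * c" by blast
    then have "a = c * x + b" by (simp add: algebra_simps)
    moreover have "c * x + b \<in> L"
      by (intro integral_idealD(3)[OF L(1)] integral_idealD(4)[OF L(1)] L(2) b(1) \<open>algebraic_int c\<close>)
    ultimately show "a \<in> L" by simp
  qed
  show "inj_on ?f {J. integral_ideal J \<and> x \<in> J}"
  proof (rule inj_onI)
    fix J L assume "J \<in> {J. integral_ideal J \<and> x \<in> J}" "L \<in> {J. integral_ideal J \<and> x \<in> J}" "?f J = ?f L"
    then show "J = L" using sub[of J L] sub[of L J] by simp
  qed
qed

text \<open>An ideal that is maximal among the proper ideals above \<open>J\<close> is prime; it
  exists because there are only finitely many candidates.\<close>

lemma integral_prime_above:
  assumes nf: "number_field TYPE('k::field_char_0)" and J: "integral_ideal (J::'k set)" "J \<noteq> {0}" "1 \<notin> J"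
  obtains P where "integral_prime P" "J \<subseteq> P"
proof -
  obtain x where x: "x \<in> J" "x \<noteq> 0" using J integral_idealD(2)[OF J(1)] by blast
  define A where "A = {L. integral_ideal L \<and> J \<subseteq> L \<and> 1 \<notin> L}"
  have "A \<subseteq> {L. integral_ideal L \<and> x \<in> L}" using x by (auto simp: A_def)
  then have "finite A" using finite_ideals_containing[OF nf integral_idealD(7)[OF J(1) x(1)] x(2)] finite_subset by blast
  moreover have "J \<in> A" using J by (simp add: A_def)
  ultimately obtain P where P: "P \<in> A" "\<And>L. L \<in> A \<Longrightarrow> P \<subseteq> L \<Longrightarrow> P = L"
    using finite_has_maximal[of A] by blast
  have idP: "integral_ideal P" and JP: "J \<subseteq> P" and P1: "1 \<notin> P" using P(1) by (auto simp: A_def)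
  have "integral_prime P"
    unfolding integral_prime_def
  proof (intro conjI ballI impI)
    show "P \<noteq> {0}" using x JP by blast
    fix a b assume ab: "a \<in> integers" "b \<in> integers" "a * b \<in> P"
    show "a \<in> P \<or> b \<in> P"
    proof (rule ccontr)
      assume n: "\<not> (a \<in> P \<or> b \<in> P)"
      \<comment> \<open>The ideal generated by \<open>P\<close> and \<open>a\<close>. It is larger
        than \<open>P\<close>, hence contains 1, and multiplication by \<open>b\<close> puts
        \<open>b\<close> into \<open>P\<close>.\<close>
      define L where "L = {p + a * c | p c. p \<in> P \<and> algebraic_int c}"
      have "integral_ideal L"
        unfolding integral_ideal_def
      proof (intro conjI ballI)
        show "L \<subseteq> integers" using integral_idealD(7)[OF idP] ab
          by (auto simp: L_def intro!: algebraic_int_add algebraic_int_mult)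
        show "0 \<in> L" using integral_idealD(2)[OF idP] by (force simp: L_def)
      next
        fix s t assume "s \<in> L" "t \<in> L"
        then obtain p c q d where *: "s = p + a * c" "t = q + a * d" "p \<in> P" "q \<in> P" "algebraic_int c" "algebraic_int d"
          by (auto simp: L_def)
        have "s + t = (p + q) + a * (c + d)" by (simp add: * algebra_simps)
        then show "s + t \<in> L" using * integral_idealD(3)[OF idP] algebraic_int_add unfolding L_def by blast
      next
        fix e s assume "e \<in> (integers :: 'k set)" "s \<in> L"
        then obtain p c where *: "s = p + a * c" "p \<in> P" "algebraic_int c" "algebraic_int e" by (auto simp: L_def)
        have "e * s = e * p + a * (e * c)" by (simp add: * algebra_simps)
        then show "e * s \<in> L" using * integral_idealD(4)[OF idP] algebraic_int_mult unfolding L_def by blast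
      qed
      moreover have PL: "P \<subseteq> L"
      proof
        fix p assume "p \<in> P"
        then have "p = p + a * 0" "algebraic_int (0::'k)" by auto
        then show "p \<in> L" using \<open>p \<in> P\<close> unfolding L_def by blast
      qed
      moreover have "a \<in> L"
      proof -
        have "a = 0 + a * 1" "algebraic_int (1::'k)" by auto
        then show ?thesis using integral_idealD(2)[OF idP] unfolding L_def by blast
      qed
      then have "P \<noteq> L" using n by blast
      ultimately have "1 \<in> L" using P(2)[of L] JP by (auto simp: A_def)
      then obtain p c where pc: "1 = p + a * c" "p \<in> P" "algebraic_int c" by (auto simp: L_def)
      have "b = b * (p + a * c)" by (simp add: pc(1)[symmetric])
      also have "\<dots> = b * p + c * (a * b)" by (simp add: algebra_simps)
      also have "\<dots> \<in> P" using pc ab integral_idealD(3,4)[OF idP] by simp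
      finally show False using n by blast
    qed
  qed (use idP P1 in auto)
  then show ?thesis using JP by (rule that)
qed

text \<open>Powers of \<open>y\<close> repeat in the finite ring of residues modulo
  \<open>x\<close>. This gives nilpotence in \<open>integral_prime_local_generator\<close>, a bound
  on divisibility by \<pi> in \<open>divpow_not_all\<close>, and inverses modulo \<open>P\<close> in
  \<open>U_inverse_mod\<close>.\<close>

lemma power_pigeonhole:
  assumes nf: "number_field TYPE('k::field_char_0)" and x: "algebraic_int (x::'k)" "x \<noteq> 0" and y: "algebraic_int y"
  obtains i j where "i < j" "y ^ i - y ^ j \<in> (*) x ` integers"
proof -
  let ?c = "\<lambda>i::nat. residue_class integers ((*) x ` integers) (y ^ i)"
  have "range ?c \<subseteq> residue_classes integers ((*) x ` integers)" using algebraic_int_power[OF y] by blast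
  then have "finite (range ?c)" using finite_residue_classes_principal[OF nf x] finite_subset by blast
  then have "\<not> inj ?c" using finite_imageD infinite_UNIV_nat by blast
  then obtain i j where "i \<noteq> j" "?c i = ?c j" unfolding inj_def by blast
  then obtain i j where ij: "i < j" "?c i = ?c j" by (metis linorder_neqE_nat)
  then have "y ^ i - y ^ j \<in> (*) x ` integers"
    using residue_class_eq_iff[OF zsub_integers zsub_scale[OF zsub_integers], of "y ^ i" "y ^ j" x]
      algebraic_int_power[OF y] by simp
  with ij(1) show ?thesis by (rule that)
qed

text \<open>The localisation at a nonzero prime is a discrete valuation ring: \<open>\<pi>\<close> generates the
  maximal ideal up to the unit \<open>u\<close>.\<close>

lemma integral_prime_local_generator:
  assumes nf: "number_field TYPE('k::field_char_0)" and P: "integral_prime (P::'k set)"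
  shows "\<exists>\<pi>\<in>P. \<exists>u\<in>integers - P. \<forall>x\<in>P. \<exists>y\<in>integers. u * x = \<pi> * y"
proof -
  have idP: "integral_ideal P" and P1: "1 \<notin> P" and P0: "P \<noteq> {0}"
    and pr: "\<And>a b. algebraic_int a \<Longrightarrow> algebraic_int b \<Longrightarrow> a * b \<in> P \<Longrightarrow> a \<in> P \<or> b \<in> P"
    using P by (auto simp: integral_prime_def)
  note idPD = integral_idealD[OF idP]
  obtain x0 where x0: "x0 \<in> P" "x0 \<noteq> 0" using P0 idPD(2) by blast
  \<comment> \<open>The argument takes place in the finite ring of integers modulo N, with N in
    \<open>P\<close>; its localisation at \<open>P\<close> is a finite local ring in which
    \<open>P\<close> consists of nilpotents.\<close>
  obtain N w where N: "N > 0" "algebraic_int w" "w * x0 = of_int N"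
    using algebraic_int_divides_integer[OF nf idPD(7)[OF x0(1)] x0(2)] .
  define NO where "NO = (*) (of_int N) ` (integers :: 'k set)"
  have NP: "of_int N \<in> P" using idPD(4)[OF N(2) x0(1)] N(3) by simp
  have idN: "integral_ideal NO" unfolding NO_def by (rule integral_ideal_principal) simp
  note idND = integral_idealD[OF idN]
  have NOP: "NO \<subseteq> P" unfolding NO_def using idPD(4) NP by (auto simp: mult.commute)
  have N0: "of_int N \<noteq> (0::'k)" "algebraic_int (of_int N :: 'k)" using N(1) by auto
  obtain R where R: "R \<subseteq> integers" "\<And>x. x \<in> integers \<Longrightarrow> \<exists>r\<in>R. x - r \<in> NO"
    "\<And>r s. r \<in> R \<Longrightarrow> s \<in> R \<Longrightarrow> r - s \<in> NO \<Longrightarrow> r = s"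
    using representatives[OF zsub_integers idND(6)] by metis
  have "inj_on (residue_class integers NO) R"
    using residue_class_eq_iff[OF zsub_integers idND(6)] R(1,3) by (meson inj_onI subsetD)
  moreover have "residue_class integers NO ` R \<subseteq> residue_classes integers NO" using R(1) by blast
  ultimately have finR: "finite R"
    using finite_residue_classes_principal[OF nf N0(2,1)] unfolding NO_def[symmetric] by (meson finite_subset inj_on_finite)
  text \<open>\<open>s0\<close> kills the kernel of the localisation of \<open>O/N\<close> at \<open>P\<close>\<close>
  have "\<exists>s. s \<in> integers - P \<and> (\<forall>r\<in>F. (\<exists>t\<in>integers - P. t * r \<in> NO) \<longrightarrow> s * r \<in> NO)" if "finite F" for F
    using that
  proof (induction rule: finite_induct)
    case empty
    show ?case using P1 by (intro exI[of _ 1]) auto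
  next
    case (insert r F)
    then obtain s where s: "s \<in> integers - P" "\<forall>r\<in>F. (\<exists>t\<in>integers - P. t * r \<in> NO) \<longrightarrow> s * r \<in> NO" by blast
    show ?case
    proof (cases "\<exists>t\<in>integers - P. t * r \<in> NO")
      case True
      then obtain t where t: "t \<in> integers - P" "t * r \<in> NO" by blast
      have "s * t \<in> integers - P" using s(1) t(1) pr algebraic_int_mult by blast
      moreover have "s * t * r' \<in> NO" if "r' \<in> insert r F" "\<exists>t\<in>integers - P. t * r' \<in> NO" for r'
      proof (cases "r' = r")
        case True
        then show ?thesis using idND(4)[of s "t * r"] s(1) t by (simp add: mult.assoc)
      next
        case False
        then have "s * r' \<in> NO" using s(2) that by blast
        then show ?thesis using idND(4)[of t "s * r'"] t by (simp add: mult_ac)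
      qed
      ultimately show ?thesis by blast
    next
      case False
      then show ?thesis using s by blast
    qed
  qed
  from this[OF finR] obtain s0 where s0: "s0 \<in> integers - P"
    "\<And>r. r \<in> R \<Longrightarrow> (\<exists>t\<in>integers - P. t * r \<in> NO) \<Longrightarrow> s0 * r \<in> NO" by blast
  \<comment> \<open>In x^i (1 - x^(j - i)), a multiple of N, the second factor is 1 modulo
    \<open>P\<close>, hence a unit of the localisation, and \<open>s0\<close> removes it.\<close>
  have nil: "\<exists>e. s0 * x ^ e \<in> NO" if x: "x \<in> P" for x
  proof -
    have xi: "algebraic_int x" using idPD(7)[OF x] .
    obtain i j where ij: "i < j" "x ^ i - x ^ j \<in> NO"
      using power_pigeonhole[OF nf N0(2,1) xi] unfolding NO_def[symmetric] .
    define t where "t = 1 - x ^ (j - i)"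
    have "x ^ (j - i) = x ^ (j - i - 1) * x" using ij(1) by (metis Suc_diff_1 power_Suc2 zero_less_diff)
    then have "x ^ (j - i) \<in> P" using idPD(4)[OF algebraic_int_power[OF xi] x] by simp
    then have "t \<notin> P" using idPD(3)[of t "x ^ (j - i)"] P1 by (auto simp: t_def)
    moreover have ti: "algebraic_int t" unfolding t_def by (intro algebraic_int_diff algebraic_int_power xi) auto
    moreover have tx: "t * x ^ i \<in> NO"
    proof -
      have "x ^ j = x ^ (j - i) * x ^ i" using ij(1) by (simp flip: power_add)
      then show ?thesis using ij(2) by (simp add: t_def algebra_simps)
    qed
    obtain r where r: "r \<in> R" "x ^ i - r \<in> NO" using R(2)[of "x ^ i"] algebraic_int_power[OF xi] by blast
    have "t * r = t * x ^ i - t * (x ^ i - r)" by (simp add: algebra_simps)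
    then have "t * r \<in> NO" using idND(5)[OF tx idND(4)[OF ti r(2)]] by simp
    with \<open>t \<notin> P\<close> ti have "s0 * r \<in> NO" using s0(2)[OF r(1)] by blast
    then have "s0 * r + s0 * (x ^ i - r) \<in> NO" using idND(3) idND(4)[OF _ r(2), of s0] s0(1) by blast
    then show ?thesis by (auto simp: algebra_simps)
  qed
  \<comment> \<open>A nonzero element of the local ring that the whole maximal ideal annihilates:
    for each \<open>x\<close> in turn, \<open>b\<close> is multiplied by the highest power of
    \<open>x\<close> that leaves it nonzero.\<close>
  have "\<exists>b. algebraic_int b \<and> s0 * b \<notin> NO \<and> (\<forall>x\<in>F. s0 * b * x \<in> NO)" if "finite F" "F \<subseteq> P" for F
    using that
  proof (induction rule: finite_induct)
    case empty
    show ?case using s0(1) NOP by (intro exI[of _ 1]) auto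
  next
    case (insert x F)
    then obtain b where b: "algebraic_int b" "s0 * b \<notin> NO" "\<forall>x\<in>F. s0 * b * x \<in> NO" by blast
    have xP: "x \<in> P" using insert.prems by blast
    have xi: "algebraic_int x" using idPD(7)[OF xP] .
    obtain e where e: "s0 * x ^ e \<in> NO" using nil[OF xP] by blast
    have ex: "s0 * b * x ^ e \<in> NO" using idND(4)[OF b(1) e] by (simp add: mult_ac)
    define k where "k = (LEAST k. s0 * b * x ^ k \<in> NO)"
    have k: "s0 * b * x ^ k \<in> NO" unfolding k_def using ex by (rule LeastI)
    have "k \<noteq> 0" using k b(2) by (auto intro: ccontr)
    then obtain l where l: "k = Suc l" by (cases k) auto
    have nl: "s0 * b * x ^ l \<notin> NO" using not_less_Least[of l "\<lambda>k. s0 * b * x ^ k \<in> NO"] l by (auto simp: k_def)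
    have "s0 * (b * x ^ l) * y \<in> NO" if "y \<in> insert x F" for y
    proof (cases "y = x")
      case True
      then show ?thesis using k by (simp add: l mult_ac)
    next
      case False
      then have y: "s0 * b * y \<in> NO" using b(3) that by blast
      show ?thesis using idND(4)[OF algebraic_int_power[OF xi, of l] y] by (simp add: mult_ac)
    qed
    then show ?case using nl b(1) xi
      by (intro exI[of _ "b * x ^ l"]) (auto simp: mult.assoc intro: algebraic_int_mult algebraic_int_power)
  qed
  from this[of "R' \<inter> P" for R'] have ann: "\<exists>b. algebraic_int b \<and> s0 * b \<notin> NO \<and> (\<forall>x\<in>R' \<inter> P. s0 * b * x \<in> NO)" if "finite R'" for R'
    using that by blast
  text \<open>as \<open>NO \<subseteq> P\<close>, the representatives of the classes in \<open>P\<close> lie in \<open>P\<close>\<close>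
  obtain b where b: "algebraic_int b" "s0 * b \<notin> NO" "\<forall>x\<in>R \<inter> P. s0 * b * x \<in> NO" using ann[OF finR] by blast
  have bi: "algebraic_int (s0 * b)" using s0(1) b(1) algebraic_int_mult by blast
  have bP: "s0 * b * x \<in> NO" if x: "x \<in> P" for x
  proof -
    obtain r where r: "r \<in> R" "x - r \<in> NO" using R(2)[of x] idPD(7)[OF x] by blast
    have "x - (x - r) \<in> P" using idPD(5)[OF x] r(2) NOP by blast
    then have "s0 * b * r \<in> NO" using b(3) r(1) by simp
    then have "s0 * b * r + s0 * b * (x - r) \<in> NO" using idND(3) idND(4)[OF bi r(2)] by blast
    then show ?thesis by (simp add: algebra_simps)
  qed
  \<comment> \<open>Thus \<gamma> maps \<open>P\<close> into the integers without being an integer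
    itself; it plays the role of the inverse of a generator of \<open>P\<close>.\<close>
  define \<gamma> where "\<gamma> = s0 * b / of_int N"
  have \<gamma>P: "algebraic_int (\<gamma> * x)" if x: "x \<in> P" for x
  proof -
    obtain c where "s0 * b * x = of_int N * c" "algebraic_int c" using bP[OF x] by (auto simp: NO_def)
    then have "\<gamma> * x = c" using N0(1) by (simp add: \<gamma>_def field_simps)
    then show ?thesis using \<open>algebraic_int c\<close> by simp
  qed
  have \<gamma>n: "\<not> algebraic_int \<gamma>"
  proof
    assume "algebraic_int \<gamma>"
    moreover have "s0 * b = of_int N * \<gamma>" using N0(1) by (simp add: \<gamma>_def)
    ultimately show False using b(2) unfolding NO_def by blast
  qed
  \<comment> \<open>Otherwise \<gamma> would stabilise the finitely generated group \<open>P\<close>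
    and be integral. Generators of \<open>P\<close> are N G together with one element of
    \<open>P\<close> for every residue class that meets it; \<open>x0\<close> supplies a nonzero
    one.\<close>
  have "\<exists>\<pi>\<in>P. \<gamma> * \<pi> \<notin> P"
  proof (rule ccontr)
    assume "\<not> (\<exists>\<pi>\<in>P. \<gamma> * \<pi> \<notin> P)"
    then have stable: "\<And>x. x \<in> P \<Longrightarrow> \<gamma> * x \<in> P" by blast
    obtain G S where GS: "finite G" "finite S" "G \<subseteq> (integers :: 'k set)"
      "\<forall>y\<in>integers. \<exists>r\<in>S. y - r \<in> zmod.span ((*) (of_int N) ` G)"
      using number_field_residues[OF nf N(1)] by blast
    define H where "H = (*) (of_int N) ` G"
    define pick where "pick = (\<lambda>r. SOME y. y \<in> P \<and> y - r \<in> zmod.span H)"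
    define W where "W = insert x0 (H \<union> pick ` {r\<in>S. \<exists>y\<in>P. y - r \<in> zmod.span H})"
    have pick: "pick r \<in> P \<and> pick r - r \<in> zmod.span H" if "\<exists>y\<in>P. y - r \<in> zmod.span H" for r
      unfolding pick_def by (rule someI_ex) (use that in blast)
    have PW: "P \<subseteq> zmod.span W"
    proof
      fix x assume x: "x \<in> P"
      obtain r where r: "r \<in> S" "x - r \<in> zmod.span H" using GS(4) idPD(7)[OF x] unfolding H_def by blast
      then have p: "pick r \<in> P \<and> pick r - r \<in> zmod.span H" using pick x by blast
      have "(x - r) - (pick r - r) \<in> zmod.span H" by (rule zmod.span_diff) (use r(2) p in blast)+
      moreover have "H \<subseteq> W" by (auto simp: W_def)
      ultimately have "x - pick r \<in> zmod.span W" using zmod.span_mono[of H W] by auto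
      moreover have "pick r \<in> W" using r x by (auto simp: W_def)
      then have "pick r \<in> zmod.span W" by (rule zmod.span_base)
      ultimately have "(x - pick r) + pick r \<in> zmod.span W" by (rule zmod.span_add)
      then show "x \<in> zmod.span W" by simp
    qed
    have WP: "W \<subseteq> P"
      using x0 pick GS(3) idPD(4)[OF _ NP] by (auto simp: W_def H_def mult.commute)
    have "finite W" using GS(1,2) by (simp add: W_def H_def)
    then have "algebraic_int \<gamma>"
    proof (rule algebraic_int_stable_module)
      show "x0 \<in> W" "x0 \<noteq> 0" using x0(2) by (auto simp: W_def)
      show "\<gamma> * y \<in> zmod.span W" if "y \<in> W" for y
        using stable that WP PW by blast
    qed
    with \<gamma>n show False ..
  qed
  then obtain \<pi> where \<pi>: "\<pi> \<in> P" "\<gamma> * \<pi> \<notin> P" by blast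
  \<comment> \<open>The unit is \<gamma> \<pi> and the cofactor of \<open>x\<close> is \<gamma> x,
    so that u x = \<pi> y becomes an identity.\<close>
  show ?thesis
  proof (intro bexI ballI)
    show "\<pi> \<in> P" by (rule \<pi>)
    show "\<gamma> * \<pi> \<in> integers - P" using \<pi> \<gamma>P by blast
    fix x assume "x \<in> P"
    show "\<gamma> * \<pi> * x = \<pi> * (\<gamma> * x)" by simp
    show "\<gamma> * x \<in> integers" using \<gamma>P[OF \<open>x \<in> P\<close>] by simp
  qed
qed

section \<open>Ideals of the record \<open>ring_of_integers\<close>\<close>

lemma ring_of_integers_simps:
  "carrier ring_of_integers = integers" "x \<otimes>\<^bsub>ring_of_integers\<^esub> y = x * y"
  "x \<oplus>\<^bsub>ring_of_integers\<^esub> y = x + y" "\<zero>\<^bsub>ring_of_integers\<^esub> = 0" "\<one>\<^bsub>ring_of_integers\<^esub> = 1"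
  by (simp_all add: ring_of_integers_def ring_of_type_algebra_def)

lemma cring_ring_of_integers: "cring (ring_of_integers :: 'k::field_char_0 ring)"
proof (rule cringI)
  show "abelian_group (ring_of_integers :: 'k ring)"
  proof (rule abelian_groupI)
    fix x :: 'k assume "x \<in> carrier ring_of_integers"
    then show "\<exists>y\<in>carrier ring_of_integers. y \<oplus>\<^bsub>ring_of_integers\<^esub> x = \<zero>\<^bsub>ring_of_integers\<^esub>"
      by (intro bexI[of _ "- x"]) (auto simp: ring_of_integers_simps)
  qed (auto simp: ring_of_integers_simps algebraic_int_add add_ac)
  show "Group.comm_monoid (ring_of_integers :: 'k ring)"
    by (rule comm_monoidI) (auto simp: ring_of_integers_simps algebraic_int_mult mult_ac)
qed (auto simp: ring_of_integers_simps distrib_right)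

lemma ideal_ring_of_integers_iff: "ideal J ring_of_integers \<longleftrightarrow> integral_ideal (J :: 'k::field_char_0 set)"
proof
  interpret cring "ring_of_integers :: 'k ring" by (rule cring_ring_of_integers)
  assume "ideal J ring_of_integers"
  then interpret J: ideal J ring_of_integers .
  show "integral_ideal J"
    using J.a_subset J.zero_closed J.a_closed J.I_l_closed
    by (auto simp: integral_ideal_def ring_of_integers_simps)
next
  interpret cring "ring_of_integers :: 'k ring" by (rule cring_ring_of_integers)
  assume J: "integral_ideal J"
  note JD = integral_idealD[OF J]
  show "ideal J ring_of_integers"
  proof (rule idealI)
    show "ring (ring_of_integers :: 'k ring)" by (rule ring_axioms)
    show "subgroup J (add_monoid (ring_of_integers :: 'k ring))"
    proof (rule add.subgroupI)
      show "J \<subseteq> carrier ring_of_integers" using JD(1) by (simp add: ring_of_integers_simps)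
      show "J \<noteq> {}" using JD(2) by blast
      fix a assume a: "a \<in> J"
      have "\<ominus>\<^bsub>ring_of_integers\<^esub> a = - a"
        using a JD(7) by (intro minus_equality) (auto simp: ring_of_integers_simps)
      then show "\<ominus>\<^bsub>ring_of_integers\<^esub> a \<in> J" using JD(5)[OF JD(2) a] by simp
      fix b assume b: "b \<in> J"
      then show "a \<oplus>\<^bsub>ring_of_integers\<^esub> b \<in> J" using JD(3)[OF a b] by (simp add: ring_of_integers_simps)
    qed
    fix a x :: 'k assume "a \<in> J" "x \<in> carrier ring_of_integers"
    then show "x \<otimes>\<^bsub>ring_of_integers\<^esub> a \<in> J" "a \<otimes>\<^bsub>ring_of_integers\<^esub> x \<in> J"
      using JD(4)[of x a] by (auto simp: ring_of_integers_simps mult.commute[of a x])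
  qed
qed

lemma primeideal_ring_of_integers_iff:
  "primeideal P ring_of_integers \<and> P \<noteq> {0} \<longleftrightarrow> integral_prime (P :: 'k::field_char_0 set)"
proof
  assume P: "primeideal P ring_of_integers \<and> P \<noteq> {0}"
  then interpret P: primeideal P ring_of_integers by simp
  have id: "integral_ideal P" using P.ideal_axioms ideal_ring_of_integers_iff by blast
  moreover have "1 \<notin> P"
  proof
    assume "1 \<in> P"
    then have "integers \<subseteq> P" using integral_idealD(4)[OF id, of _ 1] by auto
    then show False using P.I_notcarr integral_idealD(1)[OF id] by (simp add: ring_of_integers_simps)
  qed
  ultimately show "integral_prime P" using P P.I_prime by (auto simp: integral_prime_def ring_of_integers_simps)
next
  assume P: "integral_prime P"
  have "primeideal P ring_of_integers"
  proof (rule primeidealI)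
    show "ideal P ring_of_integers" using P by (simp add: ideal_ring_of_integers_iff integral_prime_def)
    show "cring (ring_of_integers :: 'k ring)" by (rule cring_ring_of_integers)
    show "carrier ring_of_integers \<noteq> P" using P algebraic_int_1 by (auto simp: integral_prime_def ring_of_integers_simps)
  qed (use P in \<open>auto simp: integral_prime_def ring_of_integers_simps\<close>)
  then show "primeideal P ring_of_integers \<and> P \<noteq> {0}" using P by (simp add: integral_prime_def)
qed

lemma nonarch_places_eq: "nonarch_places = Nonarch ` {P. integral_prime P}"
  unfolding nonarch_places_def primeideal_ring_of_integers_iff ..

section \<open>The valuation at a prime ideal\<close>

locale prime_localisation =
  fixes P :: "'k::field_char_0 set" and \<pi> u :: 'k
  assumes nf: "number_field TYPE('k)" and prime: "integral_prime P"
    and pi_in: "\<pi> \<in> P" and u_in: "u \<in> integers - P"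
    and generator: "x \<in> P \<Longrightarrow> \<exists>y\<in>integers. u * x = \<pi> * y"
begin

abbreviation U where "U \<equiv> integers - P"

lemma ideal_P: "integral_ideal P" and one_notin: "1 \<notin> P"
  and prime_P: "algebraic_int a \<Longrightarrow> algebraic_int b \<Longrightarrow> a * b \<in> P \<Longrightarrow> a \<in> P \<or> b \<in> P"
  using prime by (auto simp: integral_prime_def)

lemmas PD = integral_idealD[OF ideal_P]

lemma U_mult: "s \<in> U \<Longrightarrow> t \<in> U \<Longrightarrow> s * t \<in> U"
  using prime_P algebraic_int_mult by blast

lemma U_one: "1 \<in> U" using one_notin by simp

lemma U_nonzero: "s \<in> U \<Longrightarrow> s \<noteq> 0" using PD(2) by auto

lemma pi_integral: "algebraic_int \<pi>" using PD(7) pi_in .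

lemma pi_nonzero: "\<pi> \<noteq> 0"
proof
  assume "\<pi> = 0"
  obtain x where "x \<in> P" "x \<noteq> 0" using prime PD(2) by (auto simp: integral_prime_def)
  then show False using generator[of x] U_nonzero[OF u_in] \<open>\<pi> = 0\<close> by auto
qed

text \<open>\<open>x\<close> is \<pi>^k times a unit of the localisation, written without fractions;
  the elements of \<open>U\<close> are the denominators.\<close>

definition has_ord :: "int \<Rightarrow> 'k \<Rightarrow> bool" where
  "has_ord k x \<longleftrightarrow> (\<exists>s\<in>U. \<exists>t\<in>U. s * x = \<pi> powi k * t)"

text \<open>Divisibility by \<pi>^n in the localisation, which \<open>mem_Ppow_iff\<close>
  identifies with membership in P^n.\<close>

definition divpow :: "nat \<Rightarrow> 'k \<Rightarrow> bool" where
  "divpow n x \<longleftrightarrow> algebraic_int x \<and> (\<exists>s\<in>U. \<exists>y\<in>integers. s * x = \<pi> ^ n * y)"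

lemma has_ord_unique:
  assumes "has_ord k x" "has_ord l x" shows "k = l"
proof -
  have False if k: "has_ord k x" and l: "has_ord l x" and kl: "k < l" for k l
  proof -
    obtain s t where st: "s \<in> U" "t \<in> U" "s * x = \<pi> powi k * t" using k by (auto simp: has_ord_def)
    obtain s' t' where st': "s' \<in> U" "t' \<in> U" "s' * x = \<pi> powi l * t'" using l by (auto simp: has_ord_def)
    define j where "j = nat (l - k) - 1"
    have "l = k + int (Suc j)" using kl by (simp add: j_def)
    then have "\<pi> powi l = \<pi> powi k * \<pi> ^ Suc j"
      using pi_nonzero by (simp add: power_int_add del: of_nat_Suc power_Suc)
    then have "s * (\<pi> powi k * (\<pi> ^ Suc j * t')) = s * (s' * x)" using st'(3) by (simp add: mult_ac)
    also have "\<dots> = s' * (\<pi> powi k * t)" using st(3) by (metis mult.left_commute)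
    finally have e: "s * (\<pi> powi k * (\<pi> ^ Suc j * t')) = s' * (\<pi> powi k * t)" .
    have "\<pi> powi k * (s' * t) = s' * (\<pi> powi k * t)" by (simp only: mult_ac)
    also have "\<dots> = s * (\<pi> powi k * (\<pi> ^ Suc j * t'))" by (rule e[symmetric])
    also have "\<dots> = \<pi> powi k * (\<pi> ^ j * s * t' * \<pi>)" by (simp only: mult_ac power_Suc)
    finally have "\<pi> powi k * (s' * t) = \<pi> powi k * (\<pi> ^ j * s * t' * \<pi>)" .
    moreover have "\<pi> powi k \<noteq> 0" using pi_nonzero by simp
    ultimately have eq: "s' * t = \<pi> ^ j * s * t' * \<pi>" using mult_left_cancel by blast
    have "algebraic_int (\<pi> ^ j * s * t')" using st st'
      by (intro algebraic_int_mult algebraic_int_power pi_integral) auto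
    then have "s' * t \<in> P" unfolding eq using PD(4) pi_in by blast
    moreover have "s' * t \<in> U" using U_mult st st' by blast
    ultimately show False by blast
  qed
  then show ?thesis using assms by (metis linorder_neqE_linordered_idom)
qed

lemma has_ord_nonzero: "has_ord k x \<Longrightarrow> x \<noteq> 0"
  using U_nonzero pi_nonzero by (auto simp: has_ord_def)

text \<open>Some \<pi>^i - \<pi>^j is a multiple of \<open>x\<close>, and 1 - \<pi>^(j - i) is a
  unit of the localisation. So \<open>x\<close> divides \<pi>^i there, and \<pi>^(i + 1) cannot
  divide \<open>x\<close>.\<close>

lemma divpow_not_all:
  assumes x: "algebraic_int x" "x \<noteq> 0" obtains i where "\<not> divpow (Suc i) x"
proof -
  obtain i j where ij: "i < j" "\<pi> ^ i - \<pi> ^ j \<in> (*) x ` integers"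
    using power_pigeonhole[OF nf x pi_integral] .
  then obtain w where w: "\<pi> ^ i - \<pi> ^ j = x * w" "algebraic_int w" by blast
  have "\<not> divpow (Suc i) x"
  proof
    assume "divpow (Suc i) x"
    then obtain s y where sy: "s \<in> U" "algebraic_int y" "s * x = \<pi> ^ Suc i * y" by (auto simp: divpow_def)
    define l where "l = j - i - 1"
    have "j = i + Suc l" using ij by (simp add: l_def)
    then have pj: "\<pi> ^ j = \<pi> ^ i * \<pi> ^ Suc l" by (simp only: power_add)
    have "s * (\<pi> ^ i - \<pi> ^ j) = \<pi> ^ Suc i * y * w" unfolding w(1) using sy(3) by (metis mult.assoc)
    then have "\<pi> ^ i * (s * (1 - \<pi> ^ Suc l)) = \<pi> ^ i * (y * w * \<pi>)" unfolding pj by (simp add: algebra_simps)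
    then have eq: "s * (1 - \<pi> ^ Suc l) = y * w * \<pi>" using pi_nonzero by simp
    have "y * w * \<pi> \<in> P" using PD(4)[OF algebraic_int_mult[OF sy(2) w(2)] pi_in] .
    moreover have "\<pi> ^ Suc l \<in> P" using PD(4)[OF algebraic_int_power[OF pi_integral] pi_in, of l] by (simp add: mult.commute)
    then have "1 - \<pi> ^ Suc l \<notin> P" using PD(3)[of "1 - \<pi> ^ Suc l" "\<pi> ^ Suc l"] one_notin by auto
    moreover have "algebraic_int (1 - \<pi> ^ Suc l)"
      by (intro algebraic_int_diff algebraic_int_power pi_integral) simp
    ultimately have "s * (1 - \<pi> ^ Suc l) \<in> U" "s * (1 - \<pi> ^ Suc l) \<in> P"
      using U_mult[OF sy(1), of "1 - \<pi> ^ Suc l"] eq by auto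
    then show False by blast
  qed
  then show ?thesis by (rule that)
qed

text \<open>At the highest power of \<pi> dividing \<open>x\<close> the cofactor lies outside
  \<open>P\<close>, since otherwise \<open>generator\<close> would split off one more \<pi>.\<close>

lemma has_ord_integral:
  assumes x: "algebraic_int x" "x \<noteq> 0" obtains n where "has_ord (int n) x"
proof -
  define n where "n = (LEAST i. \<not> divpow (Suc i) x)"
  obtain i0 where "\<not> divpow (Suc i0) x" using divpow_not_all[OF x] .
  then have n: "\<not> divpow (Suc n) x" unfolding n_def by (rule LeastI)
  have "divpow n x"
  proof (cases n)
    case 0
    show ?thesis unfolding divpow_def 0 using x(1) U_one
      by (intro conjI bexI[of _ 1] bexI[of _ x]) auto
  next
    case (Suc j)
    then show ?thesis using not_less_Least[of j "\<lambda>i. \<not> divpow (Suc i) x"] by (auto simp: n_def)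
  qed
  then obtain s y where sy: "s \<in> U" "algebraic_int y" "s * x = \<pi> ^ n * y" by (auto simp: divpow_def)
  have "y \<notin> P"
  proof
    assume "y \<in> P"
    then obtain z where z: "algebraic_int z" "u * y = \<pi> * z" using generator by blast
    have "u * s * x = \<pi> ^ n * (u * y)" using sy(3) by (simp add: mult_ac)
    then have "u * s * x = \<pi> ^ Suc n * z" by (simp add: z(2) mult_ac)
    then have "divpow (Suc n) x" unfolding divpow_def using x(1) z(1) U_mult[OF u_in sy(1)] by blast
    with n show False ..
  qed
  then have "has_ord (int n) x" unfolding has_ord_def using sy by (intro bexI[of _ s] bexI[of _ y]) auto
  then show ?thesis by (rule that)
qed

lemma has_ord_divide:
  assumes "has_ord k a" "has_ord l b" shows "has_ord (k - l) (a / b)"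
proof -
  obtain s t where st: "s \<in> U" "t \<in> U" "s * a = \<pi> powi k * t" using assms(1) by (auto simp: has_ord_def)
  obtain s' t' where st': "s' \<in> U" "t' \<in> U" "s' * b = \<pi> powi l * t'" using assms(2) by (auto simp: has_ord_def)
  have b: "b \<noteq> 0" by (rule has_ord_nonzero[OF assms(2)])
  have pl: "\<pi> powi l \<noteq> 0" using pi_nonzero by simp
  have "\<pi> powi l * (s * t' * a) = s * a * (s' * b)" using st' by (simp add: mult_ac)
  also have "\<dots> = \<pi> powi l * (\<pi> powi (k - l) * (t * s') * b)"
    using st(3) pi_nonzero by (simp add: power_int_diff field_simps)
  finally have "s * t' * a = \<pi> powi (k - l) * (t * s') * b" using mult_left_cancel[OF pl] by blast
  then have "s * t' * (a / b) = \<pi> powi (k - l) * (t * s')" using b by (simp add: field_simps)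
  then show ?thesis unfolding has_ord_def using U_mult st st' by blast
qed

lemma has_ord_exists:
  assumes "x \<noteq> 0" obtains k where "has_ord k x"
proof -
  obtain a b where ab: "algebraic_int a" "algebraic_int b" "b \<noteq> 0" "x = a / b"
    using number_field_fraction[OF nf] .
  have "a \<noteq> 0" using ab assms by auto
  then obtain n where n: "has_ord (int n) a" using has_ord_integral ab(1) by blast
  obtain m where m: "has_ord (int m) b" using has_ord_integral[OF ab(2,3)] .
  show ?thesis using has_ord_divide[OF n m] that ab(4) by blast
qed

definition v :: "'k \<Rightarrow> int" where "v x = (if x = 0 then 0 else THE k. has_ord k x)"

lemma v_eqI: "has_ord k x \<Longrightarrow> v x = k"
  using has_ord_unique has_ord_nonzero by (auto simp: v_def)

lemma has_ord_v: "x \<noteq> 0 \<Longrightarrow> has_ord (v x) x"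
  using has_ord_exists v_eqI by metis

lemma v_divide: "x \<noteq> 0 \<Longrightarrow> y \<noteq> 0 \<Longrightarrow> v (x / y) = v x - v y"
  by (intro v_eqI has_ord_divide has_ord_v)

lemma v_U: "s \<in> U \<Longrightarrow> v s = 0"
  by (rule v_eqI) (use U_one in \<open>auto simp: has_ord_def intro!: bexI[of _ 1]\<close>)

lemma v_pi: "v \<pi> = 1"
  by (rule v_eqI) (use U_one in \<open>auto simp: has_ord_def intro!: bexI[of _ 1]\<close>)

lemma v_mult: "x \<noteq> 0 \<Longrightarrow> y \<noteq> 0 \<Longrightarrow> v (x * y) = v x + v y"
  using v_divide[of "x * y" y] by simp

lemma v_integral:
  assumes "algebraic_int x" shows "v x \<ge> 0"
proof (cases "x = 0")
  case False
  then obtain n where "has_ord (int n) x" using has_ord_integral assms by blast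
  then show ?thesis using v_eqI by simp
qed (simp add: v_def)

lemma v_nonneg_denominator:
  assumes "x \<noteq> 0" "v x \<ge> 0" obtains s where "s \<in> U" "algebraic_int (s * x)"
proof -
  obtain s t where st: "s \<in> U" "t \<in> U" "s * x = \<pi> powi v x * t" using has_ord_v[OF assms(1)] by (auto simp: has_ord_def)
  have "\<pi> powi v x = \<pi> ^ nat (v x)" using assms(2) by (simp add: power_int_def)
  then have "algebraic_int (s * x)" using st algebraic_int_mult[OF algebraic_int_power[OF pi_integral]] by simp
  with st(1) show ?thesis by (rule that)
qed

lemma v_ge_0I: "s \<in> U \<Longrightarrow> algebraic_int (s * x) \<Longrightarrow> v x \<ge> 0"
proof (cases "x = 0")
  case False
  assume s: "s \<in> U" "algebraic_int (s * x)"
  then have "v (s * x) = v x" using v_mult[OF U_nonzero False, of s] v_U by simp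
  then show ?thesis using v_integral[OF s(2)] by simp
qed (simp add: v_def)

text \<open>Division by the element of smaller valuation reduces the claim to 1 + y/x, for which a
  denominator of y/x outside \<open>P\<close> serves as well.\<close>

lemma v_add:
  assumes "x \<noteq> 0" "y \<noteq> 0" "x + y \<noteq> 0" shows "v (x + y) \<ge> min (v x) (v y)"
proof -
  have *: "v (x + y) \<ge> v x" if "x \<noteq> 0" "y \<noteq> 0" "x + y \<noteq> 0" "v x \<le> v y" for x y
  proof -
    have "v (y / x) \<ge> 0" "y / x \<noteq> 0" using v_divide[of y x] that by auto
    then obtain s where s: "s \<in> U" "algebraic_int (s * (y / x))" using v_nonneg_denominator by blast
    have "s * ((x + y) / x) = s + s * (y / x)" using that by (simp add: field_simps)
    then have "v ((x + y) / x) \<ge> 0" using s algebraic_int_add by (intro v_ge_0I[OF s(1)]) auto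
    then show ?thesis using v_divide[of "x + y" x] that by simp
  qed
  show ?thesis using *[of x y] *[of y x] assms by (cases "v x \<le> v y") (auto simp: add.commute)
qed

lemma v_pos_iff:
  assumes "algebraic_int x" "x \<noteq> 0" shows "v x > 0 \<longleftrightarrow> x \<in> P"
proof
  assume "v x > 0"
  then show "x \<in> P" using v_U[of x] assms by auto
next
  assume x: "x \<in> P"
  obtain y where y: "algebraic_int y" "u * x = \<pi> * y" using generator[OF x] by blast
  have "y \<noteq> 0" using y(2) assms U_nonzero[OF u_in] by auto
  have "v x = v (u * x)" using v_mult[OF U_nonzero[OF u_in] assms(2)] v_U[OF u_in] by simp
  also have "\<dots> = 1 + v y" unfolding y(2) using v_mult[OF pi_nonzero \<open>y \<noteq> 0\<close>] v_pi by simp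
  finally show "v x > 0" using v_integral[OF y(1)] by simp
qed

lemma divpow_iff:
  assumes "x \<noteq> 0" "algebraic_int x" shows "divpow n x \<longleftrightarrow> int n \<le> v x"
proof
  assume "divpow n x"
  then obtain s y where sy: "s \<in> U" "algebraic_int y" "s * x = \<pi> ^ n * y" by (auto simp: divpow_def)
  have y: "y \<noteq> 0" using sy U_nonzero assms(1) by auto
  have vp: "v (\<pi> ^ n) = int n" by (rule v_eqI) (use U_one in \<open>auto simp: has_ord_def intro!: bexI[of _ 1]\<close>)
  have "v x = v (s * x)" using v_mult[OF U_nonzero assms(1)] v_U sy(1) by simp
  also have "\<dots> = int n + v y" unfolding sy(3) using v_mult[of "\<pi> ^ n" y] y pi_nonzero vp by simp
  finally show "int n \<le> v x" using v_integral[OF sy(2)] by simp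
next
  assume n: "int n \<le> v x"
  obtain s t where st: "s \<in> U" "t \<in> U" "s * x = \<pi> powi v x * t" using has_ord_v[OF assms(1)] by (auto simp: has_ord_def)
  have "\<pi> powi v x = \<pi> ^ n * \<pi> ^ (nat (v x) - n)" using n by (simp add: power_int_def flip: power_add)
  then have "s * x = \<pi> ^ n * (\<pi> ^ (nat (v x) - n) * t)" using st(3) by (simp add: mult.assoc)
  moreover have "algebraic_int (\<pi> ^ (nat (v x) - n) * t)" using st(2)
    by (intro algebraic_int_mult algebraic_int_power pi_integral) auto
  ultimately show "divpow n x" unfolding divpow_def using assms(2) st(1) by blast
qed

abbreviation Ppow where "Ppow n \<equiv> P [^]\<^bsub>ideals_set ring_of_integers\<^esub> (n::nat)"

lemma Ppow_0: "Ppow 0 = integers" and Ppow_Suc: "Ppow (Suc n) = ideal_prod ring_of_integers (Ppow n) P"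
  by (simp_all add: nat_pow_def ideals_set_def ring_of_integers_simps)

lemma ideal_Ppow: "integral_ideal (Ppow n)"
proof (induction n)
  case 0
  show ?case unfolding Ppow_0 by (auto simp: integral_ideal_def algebraic_int_add algebraic_int_mult)
next
  case (Suc n)
  interpret cring "ring_of_integers :: 'k ring" by (rule cring_ring_of_integers)
  show ?case unfolding Ppow_Suc using ideal_prod_is_ideal[of "Ppow n" P] Suc ideal_P
    by (simp add: ideal_ring_of_integers_iff)
qed

lemma Ppow_imp_divpow: "x \<in> Ppow n \<Longrightarrow> divpow n x"
proof (induction n arbitrary: x)
  case 0
  then show ?case unfolding divpow_def Ppow_0 using U_one
    by (intro conjI bexI[of _ 1] bexI[of _ x]) auto
next
  case (Suc n)
  have "x \<in> ideal_prod ring_of_integers (Ppow n) P" using Suc.prems by (simp only: Ppow_Suc)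
  then show ?case
  proof (induction rule: ideal_prod.induct)
    case (prod i j)
    obtain s y where sy: "s \<in> U" "algebraic_int y" "s * i = \<pi> ^ n * y" "algebraic_int i"
      using Suc.IH[OF prod(1)] by (auto simp: divpow_def)
    obtain z where z: "algebraic_int z" "u * j = \<pi> * z" using generator[OF prod(2)] by blast
    have "s * u * (i * j) = (s * i) * (u * j)" by (simp add: mult_ac)
    also have "\<dots> = \<pi> ^ Suc n * (y * z)" unfolding sy(3) z(2) by (simp add: mult_ac)
    finally show ?case unfolding divpow_def ring_of_integers_simps
      using sy z U_mult[OF sy(1) u_in] algebraic_int_mult[OF sy(2) z(1)] algebraic_int_mult[OF sy(4) PD(7)[OF prod(2)]] by blast
  next
    case (sum a b)
    obtain s y where sy: "s \<in> U" "algebraic_int y" "s * a = \<pi> ^ Suc n * y" "algebraic_int a"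
      using sum.IH(1) by (auto simp: divpow_def)
    obtain t z where tz: "t \<in> U" "algebraic_int z" "t * b = \<pi> ^ Suc n * z" "algebraic_int b"
      using sum.IH(2) by (auto simp: divpow_def)
    have "s * t * (a + b) = t * (s * a) + s * (t * b)" by (simp add: algebra_simps)
    also have "\<dots> = \<pi> ^ Suc n * (t * y + s * z)" unfolding sy(3) tz(3) by (simp add: algebra_simps)
    finally have eq: "s * t * (a + b) = \<pi> ^ Suc n * (t * y + s * z)" .
    have "algebraic_int (t * y + s * z)" using sy tz by (intro algebraic_int_add algebraic_int_mult) auto
    then show ?case unfolding divpow_def ring_of_integers_simps
      using eq U_mult[OF sy(1) tz(1)] algebraic_int_add[OF sy(4) tz(4)] by blast
  qed
qed

text \<open>Powers of \<open>s\<close> repeat modulo a nonzero element of \<open>P\<close>, so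
  \<open>P\<close> contains a product s^i (1 - s t) with \<open>t\<close> a power of
  \<open>s\<close>; primality removes s^i.\<close>

lemma U_inverse_mod:
  assumes "s \<in> U" obtains t where "algebraic_int t" "1 - s * t \<in> P"
proof -
  obtain x where x: "x \<in> P" "x \<noteq> 0" using prime PD(2) by (auto simp: integral_prime_def)
  have si: "algebraic_int s" using assms by simp
  obtain i j where ij: "i < j" "s ^ i - s ^ j \<in> (*) x ` integers"
    using power_pigeonhole[OF nf PD(7)[OF x(1)] x(2) si] .
  then obtain w where w: "s ^ i - s ^ j = x * w" "algebraic_int w" by blast
  define l where "l = j - i - 1"
  have "j = i + Suc l" using ij by (simp add: l_def)
  then have eq: "s ^ i - s ^ j = s ^ i * (1 - s * s ^ l)" by (simp add: power_add algebra_simps)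
  have "x * w \<in> P" using PD(4)[OF w(2) x(1)] by (simp add: mult.commute)
  then have "s ^ i * (1 - s * s ^ l) \<in> P" unfolding eq[symmetric] w(1) .
  moreover have "s ^ i \<notin> P"
  proof -
    have "s ^ i \<in> U" using U_one U_mult[OF assms] by (induction i) auto
    then show ?thesis by blast
  qed
  moreover have "algebraic_int (1 - s * s ^ l)"
    by (intro algebraic_int_diff algebraic_int_mult algebraic_int_power si) simp
  ultimately have "1 - s * s ^ l \<in> P" using prime_P[OF algebraic_int_power[OF si]] by blast
  then show ?thesis using that[OF algebraic_int_power[OF si, of l]] by blast
qed

text \<open>P^n is primary: with 1 - s t in \<open>P\<close>, the identity x = x (1 - s t) + t (s x)
  lifts membership from P^n to P^(n + 1).\<close>

lemma Ppow_cancel_U: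
  assumes s: "s \<in> U" and x: "algebraic_int x" and sx: "s * x \<in> Ppow n"
  shows "x \<in> Ppow n"
  using sx
proof (induction n)
  case 0
  then show ?case using x unfolding Ppow_0 by simp
next
  case (Suc n)
  interpret cring "ring_of_integers :: 'k ring" by (rule cring_ring_of_integers)
  have "Ppow (Suc n) \<subseteq> Ppow n" unfolding Ppow_Suc
    using ideal_prod_inter[of "Ppow n" P] ideal_Ppow ideal_P by (auto simp: ideal_ring_of_integers_iff)
  then have xn: "x \<in> Ppow n" using Suc by blast
  obtain t where t: "algebraic_int t" "1 - s * t \<in> P" using U_inverse_mod[OF s] .
  have "x * (1 - s * t) \<in> Ppow (Suc n)"
    unfolding Ppow_Suc using ideal_prod.prod[OF xn t(2), of ring_of_integers] by (simp add: ring_of_integers_simps)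
  then have "x * (1 - s * t) + t * (s * x) \<in> Ppow (Suc n)"
    using integral_idealD(3,4)[OF ideal_Ppow] Suc.prems t(1) by blast
  then show ?case by (simp add: algebra_simps)
qed

lemma pi_power_Ppow: "\<pi> ^ n \<in> Ppow n"
proof (induction n)
  case (Suc n)
  then show ?case unfolding Ppow_Suc using ideal_prod.prod[OF Suc pi_in, of ring_of_integers]
    by (simp add: ring_of_integers_simps mult.commute)
next
  case 0
  show ?case unfolding Ppow_0 by simp
qed

lemma mem_Ppow_iff: "x \<in> Ppow n \<longleftrightarrow> divpow n x"
proof
  assume "divpow n x"
  then obtain s y where sy: "algebraic_int x" "s \<in> U" "algebraic_int y" "s * x = \<pi> ^ n * y" by (auto simp: divpow_def)
  have "s * x \<in> Ppow n" unfolding sy(4)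
    using integral_idealD(4)[OF ideal_Ppow sy(3) pi_power_Ppow] by (simp add: mult.commute)
  then show "x \<in> Ppow n" by (rule Ppow_cancel_U[OF sy(2,1)])
qed (rule Ppow_imp_divpow)

lemma ord_integer_eq:
  assumes "algebraic_int x" "x \<noteq> 0" shows "int (ord_integer P x) = v x"
proof -
  have "ord_integer P x = nat (v x)"
    unfolding ord_integer_def mem_Ppow_iff divpow_iff[OF assms(2,1)]
    by (rule Greatest_equality) (use v_integral[OF assms(1)] in auto)
  then show ?thesis using v_integral[OF assms(1)] by simp
qed

text \<open>The fraction in the definition of \<open>val\<close> is not unique, but \<open>v\<close>
  is additive, so the difference of orders is the same for all of them.\<close>

lemma val_eq: "val (Nonarch P) x = v x"
proof (cases "x = 0")
  case False
  have "val (Nonarch P) x = (THE k. \<exists>a b. algebraic_int a \<and> algebraic_int b \<and> a \<noteq> 0 \<and> b \<noteq> 0 \<and> x = a / b \<and>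
       k = int (ord_integer P a) - int (ord_integer P b))"
    using False by (simp add: val_def ring_of_integers_simps)
  also have "\<dots> = v x"
  proof (rule the_equality)
    obtain a b where ab: "algebraic_int a" "algebraic_int b" "b \<noteq> 0" "x = a / b"
      using number_field_fraction[OF nf] .
    then have "a \<noteq> 0" using False by auto
    then show "\<exists>a b. algebraic_int a \<and> algebraic_int b \<and> a \<noteq> 0 \<and> b \<noteq> 0 \<and> x = a / b \<and>
       v x = int (ord_integer P a) - int (ord_integer P b)"
      using ab ord_integer_eq v_divide by (intro exI[of _ a] exI[of _ b]) auto
    fix k assume "\<exists>a b. algebraic_int a \<and> algebraic_int b \<and> a \<noteq> 0 \<and> b \<noteq> 0 \<and> x = a / b \<and>
       k = int (ord_integer P a) - int (ord_integer P b)"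
    then show "k = v x" using ord_integer_eq v_divide by auto
  qed
  finally show ?thesis .
qed (simp add: val_def v_def)

end

lemma prime_localisation_exists:
  assumes "number_field TYPE('k::field_char_0)" "integral_prime (P::'k set)"
  shows "\<exists>\<pi> u. prime_localisation P \<pi> u"
proof -
  obtain \<pi> u where "\<pi> \<in> P" "u \<in> integers - P" "\<forall>x\<in>P. \<exists>y\<in>integers. u * x = \<pi> * y"
    using integral_prime_local_generator[OF assms] by blast
  then have "prime_localisation P \<pi> u" using assms by unfold_locales auto
  then show ?thesis by blast
qed

section \<open>Valuations at nonzero primes\<close>

lemma val_zero [simp]: "val v 0 = 0"
  by (simp add: val_def)

context
  fixes P :: "'k::field_char_0 set"
  assumes nf: "number_field TYPE('k)" and P: "integral_prime P"
begin

lemma val_divide_prime: "x \<noteq> 0 \<Longrightarrow> y \<noteq> 0 \<Longrightarrow> val (Nonarch P) (x / y) = val (Nonarch P) x - val (Nonarch P) y"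
  using prime_localisation_exists[OF nf P] prime_localisation.v_divide prime_localisation.val_eq by metis

lemma val_mult_prime: "x \<noteq> 0 \<Longrightarrow> y \<noteq> 0 \<Longrightarrow> val (Nonarch P) (x * y) = val (Nonarch P) x + val (Nonarch P) y"
  using prime_localisation_exists[OF nf P] prime_localisation.v_mult prime_localisation.val_eq by metis

lemma val_add_prime:
  "x \<noteq> 0 \<Longrightarrow> y \<noteq> 0 \<Longrightarrow> x + y \<noteq> 0 \<Longrightarrow> val (Nonarch P) (x + y) \<ge> min (val (Nonarch P) x) (val (Nonarch P) y)"
  using prime_localisation_exists[OF nf P] prime_localisation.v_add prime_localisation.val_eq by metis

lemma val_integral_prime: "algebraic_int x \<Longrightarrow> val (Nonarch P) x \<ge> 0"
  using prime_localisation_exists[OF nf P] prime_localisation.v_integral prime_localisation.val_eq by metis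

lemma val_pos_iff_prime: "algebraic_int x \<Longrightarrow> x \<noteq> 0 \<Longrightarrow> val (Nonarch P) x > 0 \<longleftrightarrow> x \<in> P"
  using prime_localisation_exists[OF nf P] prime_localisation.v_pos_iff prime_localisation.val_eq by metis

lemma val_unit_prime: "algebraic_int x \<Longrightarrow> x \<notin> P \<Longrightarrow> val (Nonarch P) x = 0"
proof -
  obtain \<pi> u where "prime_localisation P \<pi> u" using prime_localisation_exists[OF nf P] by blast
  then interpret prime_localisation P \<pi> u .
  assume "algebraic_int x" "x \<notin> P"
  then show ?thesis using v_U[of x] val_eq by simp
qed

lemma val_power_prime: "x \<noteq> 0 \<Longrightarrow> val (Nonarch P) (x ^ n) = int n * val (Nonarch P) x"
proof (induction n)
  case 0
  have "val (Nonarch P) 1 = 0" using val_mult_prime[of 1 1] by simp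
  then show ?case by simp
qed (simp add: val_mult_prime algebra_simps)

text \<open>Restores the convention that 0 has infinite valuation, which the default value of
  \<open>val\<close> at 0 would break.\<close>

definition vge :: "int \<Rightarrow> 'k \<Rightarrow> bool" where
  "vge n x \<longleftrightarrow> x = 0 \<or> n \<le> val (Nonarch P) x"

lemma vge_mult: "vge n x \<Longrightarrow> vge m y \<Longrightarrow> vge (n + m) (x * y)"
  by (cases "x = 0 \<or> y = 0") (auto simp: vge_def val_mult_prime)

lemma vge_integral: "algebraic_int x \<Longrightarrow> vge 0 x"
  by (auto simp: vge_def val_integral_prime)

lemma vge_in_P: "x \<in> P \<Longrightarrow> vge 1 x"
proof -
  assume x: "x \<in> P"
  have "algebraic_int x" using P x integral_idealD(7) by (auto simp: integral_prime_def)
  then show ?thesis using val_pos_iff_prime[of x] x by (force simp: vge_def)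
qed

lemma vge_add: "vge n x \<Longrightarrow> vge n y \<Longrightarrow> vge n (x + y)"
  using val_add_prime[of x y] by (cases "x = 0 \<or> y = 0 \<or> x + y = 0") (auto simp: vge_def)

lemma vge_diff: "vge n x \<Longrightarrow> vge n y \<Longrightarrow> vge n (x - y)"
proof -
  assume x: "vge n x" and y: "vge n y"
  have "vge (0 + n) (- 1 * y)" by (rule vge_mult[OF vge_integral y]) simp
  then show ?thesis using vge_add[OF x, of "- y"] by simp
qed

lemma vge_mono: "vge n x \<Longrightarrow> m \<le> n \<Longrightarrow> vge m x"
  by (auto simp: vge_def)

end

section \<open>Integrality, ideal norms, the product formula and Northcott's finiteness\<close>

context
  assumes nf: "number_field TYPE('k::field_char_0)"
begin

text \<open>The denominators of \<open>x\<close> form an ideal. If it were proper it would lie in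
  some prime \<open>P\<close>, but a nonnegative valuation at \<open>P\<close> provides a
  denominator outside \<open>P\<close>.\<close>

lemma val_nonneg_imp_integral:
  assumes "x \<noteq> (0::'k)" "\<And>P. integral_prime P \<Longrightarrow> val (Nonarch P) x \<ge> 0"
  shows "algebraic_int x"
proof (rule ccontr)
  assume n: "\<not> algebraic_int x"
  define J where "J = {b. algebraic_int b \<and> algebraic_int (b * x)}"
  have "integral_ideal J"
    unfolding integral_ideal_def J_def
    by (auto simp: distrib_right mult.assoc intro: algebraic_int_add algebraic_int_mult)
  moreover have "J \<noteq> {0}"
  proof -
    obtain a b where "algebraic_int a" "algebraic_int b" "b \<noteq> 0" "x = a / b"
      using number_field_fraction[OF nf] .
    then have "b \<in> J" "b \<noteq> 0" by (auto simp: J_def)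
    then show ?thesis by blast
  qed
  moreover have "1 \<notin> J" using n by (simp add: J_def)
  ultimately obtain P where P: "integral_prime P" "J \<subseteq> P" using integral_prime_above[OF nf] by blast
  obtain \<pi> u where "prime_localisation P \<pi> u" using prime_localisation_exists[OF nf P(1)] by blast
  then interpret prime_localisation P \<pi> u .
  obtain s where "s \<in> U" "algebraic_int (s * x)"
    using v_nonneg_denominator[of x] assms(1) assms(2)[OF P(1)] val_eq by metis
  then show False using P(2) by (auto simp: J_def)
qed

text \<open>Such a prime contains the numerator or the denominator of \<open>x\<close>, and
  \<open>finite_ideals_containing\<close> applies.\<close>

lemma finite_val_nonzero: "finite {P. integral_prime P \<and> val (Nonarch P) (x::'k) \<noteq> 0}"
proof (cases "x = 0")
  case False
  obtain a b where ab: "algebraic_int a" "algebraic_int b" "b \<noteq> 0" "x = a / b"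
    using number_field_fraction[OF nf] .
  have "a \<noteq> 0" using ab False by auto
  have "{P. integral_prime P \<and> val (Nonarch P) x \<noteq> 0} \<subseteq> {J. integral_ideal J \<and> a \<in> J} \<union> {J. integral_ideal J \<and> b \<in> J}"
  proof
    fix P assume "P \<in> {P. integral_prime P \<and> val (Nonarch P) x \<noteq> 0}"
    then have P: "integral_prime P" "val (Nonarch P) x \<noteq> 0" by auto
    have "val (Nonarch P) a \<noteq> 0 \<or> val (Nonarch P) b \<noteq> 0"
      using P(2) val_divide_prime[OF nf P(1) \<open>a \<noteq> 0\<close> ab(3)] ab(4) by auto
    then have "a \<in> P \<or> b \<in> P" using val_unit_prime[OF nf P(1)] ab by blast
    then show "P \<in> {J. integral_ideal J \<and> a \<in> J} \<union> {J. integral_ideal J \<and> b \<in> J}"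
      using P(1) by (auto simp: integral_prime_def)
  qed
  then show ?thesis
    using finite_ideals_containing[OF nf ab(1) \<open>a \<noteq> 0\<close>] finite_ideals_containing[OF nf ab(2,3)]
    by (meson finite_UnI finite_subset)
qed simp

text \<open>The last claim is the pigeonhole principle for the integers from 0 to
  \<open>ideal_norm P\<close>. It turns a bounded norm into a bounded positive integer in
  \<open>P\<close>, with which \<open>northcott_places\<close> clears denominators.\<close>

lemma prime_residues:
  assumes P: "integral_prime (P :: 'k set)"
  shows "finite (residue_classes integers P)" "ideal_norm P = index integers P" "ideal_norm P \<ge> 2"
    "\<exists>k. 0 < k \<and> k \<le> ideal_norm P \<and> of_nat k \<in> P"
proof -
  have id: "integral_ideal P" using P by (simp add: integral_prime_def)
  note PD = integral_idealD[OF id]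
  obtain x where x: "x \<in> P" "x \<noteq> 0" using P PD(2) by (auto simp: integral_prime_def)
  obtain R where R: "R \<subseteq> integers" "\<And>y. y \<in> integers \<Longrightarrow> \<exists>r\<in>R. y - r \<in> (*) x ` integers"
    "\<And>r s. r \<in> R \<Longrightarrow> s \<in> R \<Longrightarrow> r - s \<in> (*) x ` integers \<Longrightarrow> r = s"
    using representatives[OF zsub_integers zsub_scale[OF zsub_integers, of x]] by metis
  have "card (residue_classes integers ((*) x ` integers)) = card R"
    using index_eqI[OF zsub_integers zsub_scale[OF zsub_integers] R] by (simp add: index_def)
  have "inj_on (residue_class integers ((*) x ` integers)) R"
    using residue_class_eq_iff[OF zsub_integers zsub_scale[OF zsub_integers]] R(1,3) by (meson inj_onI subsetD)
  moreover have "residue_class integers ((*) x ` integers) ` R \<subseteq> residue_classes integers ((*) x ` integers)" using R(1) by blast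
  ultimately have finR: "finite R"
    using finite_residue_classes_principal[OF nf PD(7)[OF x(1)] x(2)] by (meson finite_subset inj_on_finite)
  have sub: "(*) x ` integers \<subseteq> P" using PD(4)[OF _ x(1)] by (auto simp: mult.commute)
  have "\<exists>r\<in>R. y - r \<in> P" if "y \<in> integers" for y using R(2)[OF that] sub by blast
  then show fin: "finite (residue_classes integers P)"
    by (rule finite_residue_classes[OF zsub_integers PD(6) finR])
  have coset: "P +>\<^bsub>ring_of_integers\<^esub> a = residue_class integers P a" if "algebraic_int a" for a
  proof -
    have "P +>\<^bsub>ring_of_integers\<^esub> a = (\<lambda>p. p + a) ` P"
      by (auto simp: a_r_coset_def' ring_of_integers_simps)
    also have "\<dots> = residue_class integers P a"
    proof
      show "(\<lambda>p. p + a) ` P \<subseteq> residue_class integers P a"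
        using PD(7) that by (auto simp: residue_class_def intro: algebraic_int_add)
      show "residue_class integers P a \<subseteq> (\<lambda>p. p + a) ` P"
        by (auto simp: residue_class_def intro!: image_eqI[of _ _ "_ - a"])
    qed
    finally show ?thesis .
  qed
  have "carrier (ring_of_integers Quot P) = residue_classes integers P"
    unfolding FactRing_def A_RCOSETS_def' using coset by (auto simp: ring_of_integers_simps)
  then show norm: "ideal_norm P = index integers P" by (simp add: ideal_norm_def index_def)
  have eq: "residue_class integers P a = residue_class integers P b \<longleftrightarrow> a - b \<in> P"
    if "algebraic_int a" "algebraic_int b" for a b
    using residue_class_eq_iff[OF zsub_integers PD(6)] that by simp
  have "residue_class integers P 1 \<noteq> residue_class integers P 0"
    using eq[of 1 0] P by (auto simp: integral_prime_def)
  then have "card {residue_class integers P 1, residue_class integers P 0} = 2" by simp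
  moreover have "card {residue_class integers P 1, residue_class integers P 0} \<le> card (residue_classes integers P)"
    by (rule card_mono[OF fin]) auto
  ultimately show "ideal_norm P \<ge> 2" unfolding norm index_def by simp
  have "\<not> inj_on (\<lambda>i::nat. residue_class integers P (of_nat i)) {..ideal_norm P}"
  proof
    assume "inj_on (\<lambda>i::nat. residue_class integers P (of_nat i)) {..ideal_norm P}"
    then have "card {..ideal_norm P} \<le> card (residue_classes integers P)"
      by (rule card_inj_on_le[OF _ _ fin]) auto
    then show False by (simp add: norm index_def)
  qed
  then obtain i j where ij: "i \<le> ideal_norm P" "j \<le> ideal_norm P" "i \<noteq> j"
    "residue_class integers P (of_nat i) = residue_class integers P (of_nat j)" by (auto simp: inj_on_def)
  have *: "\<exists>k. 0 < k \<and> k \<le> ideal_norm P \<and> of_nat k \<in> P"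
    if "i < j" "j \<le> ideal_norm P" "residue_class integers P (of_nat j) = residue_class integers P (of_nat i)" for i j
  proof (intro exI conjI)
    have "of_nat j - of_nat i \<in> P" using that(3) eq[of "of_nat j" "of_nat i"] by simp
    then show "of_nat (j - i) \<in> P" using that(1) by (simp add: of_nat_diff)
  qed (use that in auto)
  then show "\<exists>k. 0 < k \<and> k \<le> ideal_norm P \<and> of_nat k \<in> P"
    using ij *[of i j] *[of j i] by (cases "i < j") auto
qed

text \<open>An element of \<open>P\<close> outside \<open>Q\<close> would be invertible modulo
  \<open>Q\<close>, which puts 1 into \<open>P\<close>.\<close>

lemma integral_prime_subset_eq:
  assumes P: "integral_prime (P :: 'k set)" and Q: "integral_prime Q" and "Q \<subseteq> P"
  shows "Q = P"
proof (rule ccontr)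
  assume "Q \<noteq> P"
  then obtain p where p: "p \<in> P" "p \<notin> Q" using assms(3) by blast
  have idP: "integral_ideal P" using P by (simp add: integral_prime_def)
  obtain \<pi> u where "prime_localisation Q \<pi> u" using prime_localisation_exists[OF nf Q] by blast
  then interpret Q: prime_localisation Q \<pi> u .
  obtain t where t: "algebraic_int t" "1 - p * t \<in> Q"
    using Q.U_inverse_mod[of p] p integral_idealD(7)[OF idP p(1)] by blast
  have "t * p \<in> P" by (rule integral_idealD(4)[OF idP t(1) p(1)])
  then have "(1 - p * t) + t * p \<in> P" using integral_idealD(3)[OF idP] t(2) assms(3) by blast
  then show False using P by (simp add: integral_prime_def mult.commute)
qed

text \<open>The product of the prime powers with exponents \<open>e\<close>, described by local
  conditions so that no multiplication of ideals enters.\<close>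

definition ideal_with :: "'k set set \<Rightarrow> ('k set \<Rightarrow> nat) \<Rightarrow> 'k set" where
  "ideal_with F e = {y. algebraic_int y \<and> (\<forall>P\<in>F. vge P (int (e P)) y)}"

lemma zsub_ideal_with:
  assumes "\<And>P. P \<in> F \<Longrightarrow> integral_prime P" shows "zsub (ideal_with F e)"
  unfolding zsub_def
proof (intro conjI ballI)
  show "0 \<in> ideal_with F e" by (simp add: ideal_with_def vge_def[OF nf assms])
  fix x y assume "x \<in> ideal_with F e" "y \<in> ideal_with F e"
  then show "x - y \<in> ideal_with F e"
    using vge_diff[OF nf assms] by (simp add: ideal_with_def algebraic_int_diff)
qed

lemma index_self: "zsub A \<Longrightarrow> index A A = 1"
  using index_eqI[of A A "{0}"] zsubD(1) by auto

text \<open>Raising one exponent by 1 multiplies the index by \<open>ideal_norm P\<close>: for an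
  element \<open>t\<close> of exact order k at \<open>P\<close> and sufficient order elsewhere, r
  \<mapsto> r t identifies the residues modulo \<open>P\<close> with the quotient of the two
  ideals.\<close>

lemma index_ideal_with:
  assumes F: "finite F" "\<And>P. P \<in> F \<Longrightarrow> integral_prime P"
  shows "index integers (ideal_with F e) = (\<Prod>P\<in>F. ideal_norm P ^ e P)"
proof (induction "\<Sum>P\<in>F. e P" arbitrary: e)
  case 0
  then have e: "\<And>P. P \<in> F \<Longrightarrow> e P = 0" using F by simp
  then have "ideal_with F e = integers" using F(2) vge_integral[OF nf] by (auto simp: ideal_with_def)
  then show ?case using e by (simp add: index_self zsub_integers)
next
  case (Suc N)
  then obtain P where P: "P \<in> F" "e P \<noteq> 0" by (metis sum.neutral nat.distinct(1))
  then obtain k where k: "e P = Suc k" by (cases "e P") auto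
  define e' where "e' = e(P := k)"
  have pP: "integral_prime P" using F(2) P(1) .
  have idP: "integral_ideal P" using pP by (simp add: integral_prime_def)
  note PD = integral_idealD[OF idP]
  obtain \<pi> u where "prime_localisation P \<pi> u" using prime_localisation_exists[OF nf pP] by blast
  then interpret P: prime_localisation P \<pi> u .
  have sumF: "(\<Sum>Q\<in>F. g Q) = g P + (\<Sum>Q\<in>F - {P}. g Q)" for g :: "'k set \<Rightarrow> nat" by (rule sum.remove[OF F(1) P(1)])
  have prodF: "(\<Prod>Q\<in>F. g Q) = g P * (\<Prod>Q\<in>F - {P}. g Q)" for g :: "'k set \<Rightarrow> nat" by (rule prod.remove[OF F(1) P(1)])
  have same: "(\<Sum>Q\<in>F - {P}. e' Q) = (\<Sum>Q\<in>F - {P}. e Q)"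
    "(\<Prod>Q\<in>F - {P}. ideal_norm Q ^ e' Q) = (\<Prod>Q\<in>F - {P}. ideal_norm Q ^ e Q)"
    by (auto simp: e'_def)
  have "N = (\<Sum>Q\<in>F. e' Q)" using Suc.hyps(2) sumF[of e] sumF[of e'] same by (simp add: k e'_def)
  then have IH: "index integers (ideal_with F e') = (\<Prod>Q\<in>F. ideal_norm Q ^ e' Q)" by (rule Suc.hyps(1))
  have z: "zsub (ideal_with F e')" "zsub (ideal_with F e)" by (rule zsub_ideal_with[OF F(2)], assumption)+
  have sub: "ideal_with F e \<subseteq> ideal_with F e'"
    using vge_mono[OF nf F(2)] by (auto simp: ideal_with_def e'_def k)
  \<comment> \<open>Distinct nonzero primes do not contain each other; powers of such elements raise
    the order of \<open>t\<close> at \<open>Q\<close> without changing it at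
    \<open>P\<close>.\<close>
  have "\<exists>q. q \<in> Q \<and> q \<notin> P" if "Q \<in> F" "Q \<noteq> P" for Q
    using integral_prime_subset_eq[OF pP F(2)[OF that(1)]] that by blast
  then obtain q where q: "\<And>Q. Q \<in> F \<Longrightarrow> Q \<noteq> P \<Longrightarrow> q Q \<in> Q \<and> q Q \<notin> P" by metis
  have qi: "algebraic_int (q Q)" if "Q \<in> F" "Q \<noteq> P" for Q
    using q[OF that] F(2)[OF that(1)] integral_idealD(7) by (auto simp: integral_prime_def)
  define t0 where "t0 = (\<Prod>Q\<in>F - {P}. q Q ^ e Q)"
  define t where "t = \<pi> ^ k * t0"
  have qU: "q Q ^ e Q \<in> P.U" if "Q \<in> F - {P}" for Q
  proof -
    have "q Q \<in> P.U" using q qi that by blast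
    then have "q Q ^ j \<in> P.U" for j using P.U_one P.U_mult by (induction j) auto
    then show ?thesis .
  qed
  have t0U: "t0 \<in> P.U"
  proof -
    have "(\<Prod>Q\<in>G. q Q ^ e Q) \<in> P.U" if "finite G" "G \<subseteq> F - {P}" for G
      using that by (induction rule: finite_induct) (use P.U_one P.U_mult qU in auto)
    then show ?thesis unfolding t0_def using F(1) by simp
  qed
  have t_nz: "t \<noteq> 0" using P.pi_nonzero P.U_nonzero[OF t0U] by (simp add: t_def)
  have ti: "algebraic_int t" unfolding t_def using t0U
    by (intro algebraic_int_mult algebraic_int_power P.pi_integral) simp
  have vt: "val (Nonarch P) t = int k"
  proof -
    have "val (Nonarch P) t = val (Nonarch P) (\<pi> ^ k) + val (Nonarch P) t0"
      unfolding t_def using P.pi_nonzero P.U_nonzero[OF t0U] by (intro val_mult_prime[OF nf pP]) auto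
    also have "val (Nonarch P) t0 = 0" using P.v_U[OF t0U] P.val_eq by simp
    also have "val (Nonarch P) (\<pi> ^ k) = int k"
      using val_power_prime[OF nf pP P.pi_nonzero, of k] P.v_pi P.val_eq by simp
    finally show ?thesis by simp
  qed
  have tQ: "vge Q (int (e Q)) t" if Q: "Q \<in> F" "Q \<noteq> P" for Q
  proof -
    have "vge Q 1 (q Q)" using q[OF Q] vge_in_P[OF nf F(2)[OF Q(1)]] by blast
    then have "vge Q (int j) (q Q ^ j)" for j
    proof (induction j)
      case 0
      show ?case using vge_integral[OF nf F(2)[OF Q(1)], of 1] by simp
    next
      case (Suc j)
      then show ?case using vge_mult[OF nf F(2)[OF Q(1)] Suc(2) Suc.IH] by simp
    qed
    then have 1: "vge Q (int (e Q)) (q Q ^ e Q)" .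
    define t1 where "t1 = \<pi> ^ k * (\<Prod>Q'\<in>F - {P} - {Q}. q Q' ^ e Q')"
    have "t0 = q Q ^ e Q * (\<Prod>Q'\<in>F - {P} - {Q}. q Q' ^ e Q')"
      unfolding t0_def using F(1) Q by (intro prod.remove) auto
    then have "t = q Q ^ e Q * t1" by (simp add: t_def t1_def mult_ac)
    moreover have "algebraic_int t1" unfolding t1_def
      by (intro algebraic_int_mult algebraic_int_power algebraic_int_prod P.pi_integral qi) auto
    ultimately show ?thesis
      using vge_mult[OF nf F(2)[OF Q(1)] 1 vge_integral[OF nf F(2)[OF Q(1)]], of t1] by simp
  qed
  have t_in: "t \<in> ideal_with F e'"
    unfolding ideal_with_def using ti tQ vt by (auto simp: e'_def vge_def[OF nf pP])
  obtain R where R: "R \<subseteq> integers" "\<And>x. x \<in> integers \<Longrightarrow> \<exists>r\<in>R. x - r \<in> P"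
    "\<And>r s. r \<in> R \<Longrightarrow> s \<in> R \<Longrightarrow> r - s \<in> P \<Longrightarrow> r = s"
    using representatives[OF zsub_integers PD(6)] by metis
  have rt_in: "r * t \<in> ideal_with F e'" if "algebraic_int r" for r
  proof -
    have "vge Q (0 + int (e' Q)) (r * t)" if "Q \<in> F" for Q
      using vge_mult[OF nf F(2)[OF that] vge_integral[OF nf F(2)[OF that] \<open>algebraic_int r\<close>]] t_in that
      by (auto simp: ideal_with_def)
    then show ?thesis using ti \<open>algebraic_int r\<close> by (auto simp: ideal_with_def intro: algebraic_int_mult)
  qed
  have "index (ideal_with F e') (ideal_with F e) = card ((\<lambda>r. r * t) ` R)"
  proof (rule index_eqI[OF z])
    show "(\<lambda>r. r * t) ` R \<subseteq> ideal_with F e'" using rt_in R(1) by blast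
    show "\<exists>r\<in>(\<lambda>r. r * t) ` R. x - r \<in> ideal_with F e" if x: "x \<in> ideal_with F e'" for x
    proof -
      have xt: "vge P 0 (x / t)"
      proof (cases "x = 0")
        case False
        have "vge P (int (e' P)) x" using x P(1) unfolding ideal_with_def by blast
        then show ?thesis using False vt t_nz val_divide_prime[OF nf pP, of x t] by (auto simp: vge_def[OF nf pP] e'_def)
      qed (simp add: vge_def[OF nf pP])
      obtain s where s: "s \<in> P.U" "algebraic_int (s * (x / t))"
      proof (cases "x = 0")
        case True
        then show ?thesis using that[OF P.U_one] by simp
      next
        case False
        then have "x / t \<noteq> 0" using t_nz by simp
        then show ?thesis using P.v_nonneg_denominator[of "x / t"] that xt P.val_eq by (auto simp: vge_def[OF nf pP])
      qed
      obtain w where w: "algebraic_int w" "1 - s * w \<in> P" using P.U_inverse_mod[OF s(1)] .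
      \<comment> \<open>x/t is integral only up to the denominator \<open>s\<close>; since s w is 1
        modulo \<open>P\<close>, the integer \<open>z\<close> is congruent to x/t at
        \<open>P\<close>.\<close>
      define z where "z = s * (x / t) * w"
      have "algebraic_int z" unfolding z_def using s(2) w(1) algebraic_int_mult by blast
      then obtain r where r: "r \<in> R" "z - r \<in> P" using R(2) by blast
      have ri: "algebraic_int r" using r(1) R(1) by blast
      have "vge P (0 + 1) (x / t * (1 - s * w))" by (rule vge_mult[OF nf pP xt vge_in_P[OF nf pP w(2)]])
      moreover have e1: "x / t * (1 - s * w) = x / t - z" by (simp add: z_def algebra_simps)
      ultimately have "vge P 1 (x / t - z)" unfolding e1 by simp
      from vge_add[OF nf pP this vge_in_P[OF nf pP r(2)]] have "vge P 1 (x / t - r)" by simp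
      moreover have "vge P (int k) t" using vt by (simp add: vge_def[OF nf pP])
      ultimately have "vge P (1 + int k) ((x / t - r) * t)" using vge_mult[OF nf pP, of 1 "x / t - r" "int k" t] by simp
      moreover have "(x / t - r) * t = x - r * t" using t_nz by (simp add: left_diff_distrib)
      ultimately have vP: "vge P (int (e P)) (x - r * t)" by (simp add: k)
      have in': "x - r * t \<in> ideal_with F e'" by (rule zsubD(2)[OF z(1) x rt_in[OF ri]])
      have "vge Q (int (e Q)) (x - r * t)" if "Q \<in> F" for Q
      proof (cases "Q = P")
        case False
        have "vge Q (int (e' Q)) (x - r * t)" using in' that unfolding ideal_with_def by blast
        then show ?thesis using False by (simp add: e'_def)
      qed (use vP in simp)
      then have "x - r * t \<in> ideal_with F e" using in' by (auto simp: ideal_with_def)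
      then show ?thesis using r(1) by blast
    qed
    show "a = b" if ab: "a \<in> (\<lambda>r. r * t) ` R" "b \<in> (\<lambda>r. r * t) ` R" "a - b \<in> ideal_with F e" for a b
    proof -
      obtain r s where rs: "r \<in> R" "s \<in> R" "a = r * t" "b = s * t" using ab by blast
      have "vge P (int (Suc k)) ((r - s) * t)" using ab(3) P(1) rs k by (auto simp: ideal_with_def left_diff_distrib)
      have "r - s \<in> P"
      proof (cases "r = s")
        case True
        then show ?thesis using PD(2) by simp
      next
        case False
        then have "val (Nonarch P) ((r - s) * t) = val (Nonarch P) (r - s) + int k"
          using val_mult_prime[OF nf pP, of "r - s" t] t_nz vt by simp
        then have "val (Nonarch P) (r - s) > 0"
          using \<open>vge P (int (Suc k)) ((r - s) * t)\<close> False t_nz by (auto simp: vge_def[OF nf pP])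
        then show ?thesis using val_pos_iff_prime[OF nf pP, of "r - s"] False rs(1,2) R(1) algebraic_int_diff by auto
      qed
      then show "a = b" using R(3)[OF rs(1,2)] rs by simp
    qed
  qed
  also have "\<dots> = card R" by (intro card_image) (use t_nz in \<open>auto simp: inj_on_def\<close>)
  also have "\<dots> = ideal_norm P"
    unfolding prime_residues(2)[OF pP] by (rule index_eqI[OF zsub_integers PD(6) R, symmetric])
  finally have "index (ideal_with F e') (ideal_with F e) = ideal_norm P" .
  moreover have "index integers (ideal_with F e) = index integers (ideal_with F e') * index (ideal_with F e') (ideal_with F e)"
    by (rule index_mult[OF zsub_integers z _ sub]) (auto simp: ideal_with_def)
  ultimately show ?case using IH prodF[of "\<lambda>Q. ideal_norm Q ^ e Q"] prodF[of "\<lambda>Q. ideal_norm Q ^ e' Q"] same(2)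
    by (simp add: k e'_def)
qed

text \<open>By \<open>val_nonneg_imp_integral\<close> the integrality of y/x can be tested prime by
  prime, and at primes outside \<open>F\<close> the order of \<open>x\<close> is 0.\<close>

lemma ideal_with_principal:
  assumes x: "algebraic_int (x::'k)" "x \<noteq> 0" and F: "\<And>P. P \<in> F \<longleftrightarrow> integral_prime P \<and> val (Nonarch P) x \<noteq> 0"
  shows "ideal_with F (\<lambda>P. nat (val (Nonarch P) x)) = (*) x ` integers"
proof
  show "(*) x ` integers \<subseteq> ideal_with F (\<lambda>P. nat (val (Nonarch P) x))"
  proof (rule image_subsetI)
    fix y :: 'k assume y: "y \<in> integers"
    have "vge P (int (nat (val (Nonarch P) x))) (x * y)" if "P \<in> F" for P
    proof -
      have P: "integral_prime P" using F that by blast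
      have "vge P (val (Nonarch P) x + 0) (x * y)"
        by (rule vge_mult[OF nf P]) (use y vge_integral[OF nf P] in \<open>auto simp: vge_def[OF nf P]\<close>)
      then show ?thesis using val_integral_prime[OF nf P x(1)] by simp
    qed
    then show "x * y \<in> ideal_with F (\<lambda>P. nat (val (Nonarch P) x))"
      using y x by (auto simp: ideal_with_def intro: algebraic_int_mult)
  qed
  show "ideal_with F (\<lambda>P. nat (val (Nonarch P) x)) \<subseteq> (*) x ` integers"
  proof
    fix y assume y: "y \<in> ideal_with F (\<lambda>P. nat (val (Nonarch P) x))"
    have "algebraic_int (y / x)"
    proof (cases "y = 0")
      case False
      have "val (Nonarch P) (y / x) \<ge> 0" if P: "integral_prime P" for P
      proof (cases "P \<in> F")
        case True
        then have "vge P (int (nat (val (Nonarch P) x))) y" using y unfolding ideal_with_def by blast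
        then have "val (Nonarch P) x \<le> val (Nonarch P) y"
          using \<open>y \<noteq> 0\<close> val_integral_prime[OF nf P x(1)] by (simp add: vge_def[OF nf P])
        then show ?thesis using val_divide_prime[OF nf P False x(2)] by simp
      next
        case False
        then have "val (Nonarch P) x = 0" using F P by blast
        then show ?thesis using val_divide_prime[OF nf P \<open>y \<noteq> 0\<close> x(2)] val_integral_prime[OF nf P] y
          by (auto simp: ideal_with_def)
      qed
      then show ?thesis by (intro val_nonneg_imp_integral) (use False x in auto)
    qed simp
    moreover have "y = x * (y / x)" using x(2) by simp
    ultimately show "y \<in> (*) x ` integers" by blast
  qed
qed

text \<open>For an integer \<open>x\<close> both sides are the logarithm of the index of its
  principal ideal, by \<open>index_ideal_with\<close> and by \<open>index_principal\<close>; both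
  are additive, which covers fractions.\<close>

theorem product_formula:
  assumes x: "(x::'k) \<noteq> 0"
  shows "(\<Sum>P | integral_prime P \<and> val (Nonarch P) x \<noteq> 0. of_int (val (Nonarch P) x) * ln (real (ideal_norm P))) =
    (\<Sum>\<sigma>\<in>complex_embeddings. ln (cmod (\<sigma> x)))"
proof -
  define S where "S = (\<lambda>x F. \<Sum>P\<in>F. of_int (val (Nonarch P) (x::'k)) * ln (real (ideal_norm P)))"
  define s where "s = (\<lambda>x::'k. {P. integral_prime P \<and> val (Nonarch P) x \<noteq> 0})"
  define T where "T = (\<lambda>x::'k. \<Sum>\<sigma>\<in>complex_embeddings. ln (cmod (\<sigma> x)))"
  have fins: "finite (s x)" for x unfolding s_def by (rule finite_val_nonzero)
  have ext: "S x (s x) = S x F" if "finite F" "s x \<subseteq> F" "\<And>P. P \<in> F \<Longrightarrow> integral_prime P" for x F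
    unfolding S_def using that by (intro sum.mono_neutral_left) (auto simp: s_def)
  have int_case: "S x (s x) = T x" if x: "algebraic_int x" "x \<noteq> 0" for x
  proof -
    obtain \<theta> :: 'k and m where "integral_primitive \<theta> m" using number_field_integral_primitive[OF nf] by blast
    then interpret integral_primitive \<theta> m .
    have "finite (complex_embeddings :: ('k \<Rightarrow> complex) set)" unfolding complex_embeddings_eq using finite_Z by blast
    have "real (index integers ((*) x ` integers)) = (\<Prod>\<sigma>\<in>complex_embeddings. cmod (\<sigma> x))"
      by (rule index_principal[OF x])
    also have "ln \<dots> = T x" unfolding T_def
      by (rule ln_prod) (use complex_embedding_eq_0_iff x(2) \<open>finite complex_embeddings\<close> in auto)
    finally have 1: "ln (real (index integers ((*) x ` integers))) = T x" by simp
    have "index integers ((*) x ` integers) = (\<Prod>P\<in>s x. ideal_norm P ^ nat (val (Nonarch P) x))"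
      using index_ideal_with[OF fins, of x "\<lambda>P. nat (val (Nonarch P) x)"] ideal_with_principal[OF x, of "s x"]
      by (auto simp: s_def)
    then have "ln (real (index integers ((*) x ` integers))) = ln (\<Prod>P\<in>s x. real (ideal_norm P) ^ nat (val (Nonarch P) x))"
      by simp
    also have "\<dots> = (\<Sum>P\<in>s x. ln (real (ideal_norm P) ^ nat (val (Nonarch P) x)))"
    proof (rule ln_prod)
      show "real (ideal_norm P) ^ nat (val (Nonarch P) x) \<noteq> 0" if "P \<in> s x" for P
        using prime_residues(3)[of P] that by (auto simp: s_def)
    qed (rule fins)
    also have "\<dots> = S x (s x)" unfolding S_def
    proof (rule sum.cong)
      fix P assume "P \<in> s x"
      then have P: "integral_prime P" by (simp add: s_def)
      have "real (ideal_norm P) > 0" using prime_residues(3)[OF P] by simp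
      then show "ln (real (ideal_norm P) ^ nat (val (Nonarch P) x)) = of_int (val (Nonarch P) x) * ln (real (ideal_norm P))"
        using val_integral_prime[OF nf P x(1)] by (simp add: ln_realpow)
    qed simp
    finally show ?thesis using 1 by simp
  qed
  obtain a b where ab: "algebraic_int a" "algebraic_int b" "b \<noteq> 0" "x = a / b"
    using number_field_fraction[OF nf] .
  have a: "a \<noteq> 0" using ab x by auto
  define F where "F = s a \<union> s b \<union> s x"
  have F: "finite F" "\<And>P. P \<in> F \<Longrightarrow> integral_prime P" unfolding F_def using fins by (auto simp: s_def)
  have "S x F = S a F - S b F" unfolding S_def sum_subtractf[symmetric]
    by (rule sum.cong) (use F(2) ab(4) val_divide_prime[OF nf _ a ab(3)] in \<open>auto simp: left_diff_distrib\<close>)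
  moreover have "T x = T a - T b" unfolding T_def sum_subtractf[symmetric]
  proof (rule sum.cong)
    fix \<sigma> :: "'k \<Rightarrow> complex" assume s: "\<sigma> \<in> complex_embeddings"
    have "\<sigma> a = \<sigma> x * \<sigma> b" using ab complex_embeddingsD(2)[OF s, of x b] by simp
    moreover have "\<sigma> x \<noteq> 0" "\<sigma> b \<noteq> 0" using complex_embedding_eq_0_iff[OF s] x ab(3) by auto
    ultimately show "ln (cmod (\<sigma> x)) = ln (cmod (\<sigma> a)) - ln (cmod (\<sigma> b))"
      by (simp add: norm_mult ln_mult)
  qed simp
  ultimately have "S x (s x) = T x"
  proof -
    have "s x \<subseteq> F" "s a \<subseteq> F" "s b \<subseteq> F" by (auto simp: F_def)
    then have "S x (s x) = S x F" "S a (s a) = S a F" "S b (s b) = S b F"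
      using ext[OF F(1) _ F(2)] by auto
    then show ?thesis
      using int_case[OF ab(1) a] int_case[OF ab(2,3)] \<open>S x F = _\<close> \<open>T x = _\<close> by simp
  qed
  then show ?thesis by (simp add: S_def s_def T_def)
qed

text \<open>A fixed integer \<open>D\<close> clears all denominators of the set, so that
  \<open>finite_bounded_integers\<close> applies.\<close>

theorem northcott_places:
  "finite {x::'k. (\<forall>P. integral_prime P \<longrightarrow> val (Nonarch P) x < 0 \<longrightarrow>
        of_int (- val (Nonarch P) x) * ln (real (ideal_norm P)) \<le> B) \<and>
      (\<forall>\<sigma>\<in>complex_embeddings. cmod (\<sigma> x) \<le> C)}" (is "finite ?X")
proof -
  obtain \<theta> :: 'k and m where "integral_primitive \<theta> m" using number_field_integral_primitive[OF nf] by blast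
  then interpret integral_primitive \<theta> m .
  \<comment> \<open>Norms are at least 2, so \<open>E\<close> bounds the order of a pole. A prime
    with a pole has norm at most \<open>M\<close>, so by \<open>prime_residues\<close> it contains a
    positive integer up to \<open>M\<close>, a divisor of \<open>fact M\<close>.\<close>
  define E where "E = nat \<lceil>B / ln 2\<rceil>"
  define M where "M = nat \<lfloor>exp B\<rfloor>"
  define D where "D = (of_nat (fact M ^ E) :: 'k)"
  have D0: "D \<noteq> 0" by (simp add: D_def)
  have Di: "algebraic_int D" unfolding D_def by (rule algebraic_int_of_nat)
  have "(*) D ` ?X \<subseteq> {y. algebraic_int y \<and> (\<forall>z\<in>Z. cmod (emb z y) \<le> real (fact M ^ E) * C)}"
  proof (rule image_subsetI, clarify, intro conjI ballI)
    fix x :: 'k assume x: "\<forall>P. integral_prime P \<longrightarrow> val (Nonarch P) x < 0 \<longrightarrow>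
        of_int (- val (Nonarch P) x) * ln (real (ideal_norm P)) \<le> B" "\<forall>\<sigma>\<in>complex_embeddings. cmod (\<sigma> x) \<le> C"
    show "algebraic_int (D * x)"
    proof (cases "x = 0")
      case False
      show ?thesis
      proof (rule val_nonneg_imp_integral)
        show "D * x \<noteq> 0" using D0 False by simp
        fix P :: "'k set" assume P: "integral_prime P"
        have m: "val (Nonarch P) (D * x) = val (Nonarch P) D + val (Nonarch P) x"
          by (rule val_mult_prime[OF nf P D0 False])
        show "val (Nonarch P) (D * x) \<ge> 0"
        proof (cases "val (Nonarch P) x < 0")
          case False
          then show ?thesis using m val_integral_prime[OF nf P Di] by simp
        next
          case True
          then have b: "of_int (- val (Nonarch P) x) * ln (real (ideal_norm P)) \<le> B" using x(1) P by blast
          have n2: "real (ideal_norm P) \<ge> 2" using prime_residues(3)[OF P] by simp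
          have l2: "ln (real (ideal_norm P)) \<ge> ln 2" using n2 by simp
          have "of_int (- val (Nonarch P) x) * ln 2 \<le> of_int (- val (Nonarch P) x) * ln (real (ideal_norm P))"
            using l2 True by (intro mult_left_mono) auto
          then have "of_int (- val (Nonarch P) x) \<le> B / ln 2" using b by (simp add: pos_le_divide_eq)
          then have "- val (Nonarch P) x \<le> \<lceil>B / ln 2\<rceil>" by linarith
          then have vE: "- val (Nonarch P) x \<le> int E" unfolding E_def by linarith
          have "1 * ln (real (ideal_norm P)) \<le> of_int (- val (Nonarch P) x) * ln (real (ideal_norm P))"
            using True n2 by (intro mult_right_mono) auto
          then have "ln (real (ideal_norm P)) \<le> B" using b by simp
          then have "real (ideal_norm P) \<le> exp B" using n2 exp_le_cancel_iff[of "ln (real (ideal_norm P))" B] by simp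
          then have "ideal_norm P \<le> M" unfolding M_def by linarith
          then obtain k where k: "0 < k" "k \<le> M" "of_nat k \<in> P" using prime_residues(4)[OF P] by auto
          then have "k dvd fact M" by (intro dvd_fact) auto
          then obtain c where c: "fact M = k * c" by (elim dvdE)
          have "(of_nat (fact M) :: 'k) = of_nat c * of_nat k" by (simp only: c of_nat_mult mult.commute)
          also have "\<dots> \<in> P" using P k(3) by (intro integral_idealD(4)) (auto simp: integral_prime_def)
          finally have "val (Nonarch P) (of_nat (fact M)) > 0"
            using val_pos_iff_prime[OF nf P, of "of_nat (fact M)"] by (simp del: of_nat_fact)
          moreover have "val (Nonarch P) D = int E * val (Nonarch P) (of_nat (fact M))"
            unfolding D_def of_nat_power by (rule val_power_prime[OF nf P]) simp
          ultimately have "val (Nonarch P) D \<ge> int E"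
            using mult_left_mono[of 1 "val (Nonarch P) (of_nat (fact M))" "int E"] by (simp del: of_nat_fact)
          then show ?thesis using m vE by simp
        qed
      qed
    qed simp
    fix z assume z: "z \<in> Z"
    then have "emb z \<in> complex_embeddings" by (simp add: complex_embeddings_eq)
    then have "cmod (emb z x) \<le> C" using x(2) by blast
    moreover have "emb z D = of_nat (fact M ^ E)" using emb_simps(6)[OF z, of "of_nat (fact M ^ E)"]
      unfolding D_def of_rat_of_nat_eq .
    ultimately show "cmod (emb z (D * x)) \<le> real (fact M ^ E) * C"
      using emb_simps(2)[OF z, of D x] by (simp add: norm_mult norm_power)
  qed
  then have "finite ((*) D ` ?X)" by (rule finite_subset) (rule finite_bounded_integers)
  then show ?thesis by (rule finite_imageD) (use D0 in \<open>auto simp: inj_on_def\<close>)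
qed

lemma finite_complex_embeddings: "finite (complex_embeddings :: ('k \<Rightarrow> complex) set)"
proof -
  obtain \<theta> :: 'k and m where "integral_primitive \<theta> m" using number_field_integral_primitive[OF nf] by blast
  then interpret integral_primitive \<theta> m .
  show ?thesis unfolding complex_embeddings_eq using finite_Z by blast
qed

end

section \<open>Heights\<close>

text \<open>The Archimedean ingredient of \<open>ht_poly\<close>.\<close>

lemma ln_max_norm_poly_bound:
  fixes q :: "complex poly"
  assumes "Polynomial.degree q = m" "m > 0"
  shows "\<exists>K. \<forall>z. \<bar>ln (max 1 (cmod (poly q z))) - real m * ln (max 1 (cmod z))\<bar> \<le> K"
proof -
  define S where "S = (\<Sum>i<m. cmod (Polynomial.coeff q i))"
  define c where "c = cmod (Polynomial.coeff q m)"
  have c: "c > 0" using assms by (auto simp: c_def)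
  have S0: "S \<ge> 0" by (simp add: S_def sum_nonneg)
  have qz: "poly q z = (\<Sum>i<m. Polynomial.coeff q i * z ^ i) + Polynomial.coeff q m * z ^ m" for z
    using assms(1) by (simp add: poly_altdef lessThan_Suc_atMost[symmetric])
  \<comment> \<open>Beyond \<open>R\<close> the terms below the leading one add up to at most half
    of it.\<close>
  define R where "R = max 1 (2 * S / c)"
  define K1 where "K1 = ln (max 1 (S + c))"
  define K2 where "K2 = max (real m * ln R) \<bar>ln (2 / c)\<bar>"
  have up: "ln (max 1 (cmod (poly q z))) \<le> real m * ln (max 1 (cmod z)) + K1" for z
  proof -
    define Z where "Z = max 1 (cmod z)"
    have Z1: "Z \<ge> 1" by (simp add: Z_def)
    have pw: "cmod z ^ i \<le> Z ^ m" if "i \<le> m" for i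
    proof -
      have "cmod z ^ i \<le> Z ^ i" by (rule power_mono) (auto simp: Z_def)
      also have "\<dots> \<le> Z ^ m" using Z1 that by (rule power_increasing[rotated])
      finally show ?thesis .
    qed
    have "cmod (poly q z) \<le> (\<Sum>i<m. cmod (Polynomial.coeff q i * z ^ i)) + cmod (Polynomial.coeff q m * z ^ m)"
      unfolding qz by (rule order.trans[OF norm_triangle_ineq add_right_mono[OF norm_sum]])
    also have "\<dots> \<le> (\<Sum>i<m. cmod (Polynomial.coeff q i) * Z ^ m) + c * Z ^ m"
      unfolding norm_mult norm_power c_def
      by (intro add_mono sum_mono mult_left_mono pw) auto
    also have "\<dots> = (S + c) * Z ^ m" by (simp add: S_def sum_distrib_right distrib_right)
    also have "\<dots> \<le> max 1 (S + c) * Z ^ m" using Z1 by (intro mult_right_mono) auto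
    finally have le: "cmod (poly q z) \<le> max 1 (S + c) * Z ^ m" .
    have "1 * 1 \<le> max 1 (S + c) * Z ^ m" using Z1 by (intro mult_mono) auto
    with le have "max 1 (cmod (poly q z)) \<le> max 1 (S + c) * Z ^ m" by simp
    then have "ln (max 1 (cmod (poly q z))) \<le> ln (max 1 (S + c) * Z ^ m)" using Z1 by (subst ln_le_cancel_iff) auto
    also have "\<dots> = ln (max 1 (S + c)) + real m * ln Z" using Z1 by (subst ln_mult) (auto simp: ln_realpow)
    finally show ?thesis by (simp add: K1_def Z_def)
  qed
  have low: "real m * ln (max 1 (cmod z)) \<le> ln (max 1 (cmod (poly q z))) + K2" for z
  proof (cases "cmod z \<le> R")
    case True
    then have "ln (max 1 (cmod z)) \<le> ln R" by (auto simp: R_def)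
    then have "real m * ln (max 1 (cmod z)) \<le> real m * ln R" by (rule mult_left_mono) simp
    then show ?thesis by (simp add: K2_def add_increasing)
  next
    case False
    define r where "r = cmod z"
    have r: "r > 1" "2 * S / c < r" using False by (auto simp: r_def R_def)
    obtain j where j: "m = Suc j" using assms(2) by (cases m) auto
    have "cmod (\<Sum>i<m. Polynomial.coeff q i * z ^ i) \<le> (\<Sum>i<m. cmod (Polynomial.coeff q i) * r ^ j)"
      by (rule order.trans[OF norm_sum])
        (use r in \<open>auto simp: norm_mult norm_power r_def[symmetric] j intro!: sum_mono mult_left_mono power_increasing\<close>)
    also have "\<dots> = S * r ^ j" by (simp add: S_def sum_distrib_right)
    also have "\<dots> \<le> (c * r / 2) * r ^ j" using r c by (intro mult_right_mono) (auto simp: field_simps)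
    also have "\<dots> = c * r ^ m / 2" by (simp add: j)
    finally have s: "cmod (\<Sum>i<m. Polynomial.coeff q i * z ^ i) \<le> c * r ^ m / 2" .
    have "c * r ^ m = cmod (Polynomial.coeff q m * z ^ m)" by (simp add: norm_mult norm_power c_def r_def)
    also have "\<dots> = cmod (poly q z - (\<Sum>i<m. Polynomial.coeff q i * z ^ i))" by (simp add: qz)
    also have "\<dots> \<le> cmod (poly q z) + c * r ^ m / 2" by (rule order.trans[OF norm_triangle_ineq4 add_left_mono[OF s]])
    finally have "c * r ^ m \<le> cmod (poly q z) + c * r ^ m / 2" .
    then have "r ^ m * (c / 2) \<le> cmod (poly q z)" by (simp add: mult.commute)
    then have "r ^ m \<le> cmod (poly q z) / (c / 2)" using c by (subst pos_le_divide_eq) auto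
    then have "r ^ m \<le> cmod (poly q z) * (2 / c)" by simp
    also have "\<dots> \<le> max 1 (cmod (poly q z)) * (2 / c)" using c by (intro mult_right_mono) auto
    finally have "ln (r ^ m) \<le> ln (max 1 (cmod (poly q z)) * (2 / c))" using r c by (subst ln_le_cancel_iff) auto
    also have "\<dots> = ln (max 1 (cmod (poly q z))) + ln (2 / c)" using c by (subst ln_mult) auto
    finally have "real m * ln r \<le> ln (max 1 (cmod (poly q z))) + ln (2 / c)" using r by (simp add: ln_realpow)
    moreover have "ln (2 / c) \<le> K2" unfolding K2_def by linarith
    moreover have "max 1 (cmod z) = r" using r(1) by (simp add: r_def)
    ultimately show ?thesis by simp
  qed
  have "\<bar>ln (max 1 (cmod (poly q z))) - real m * ln (max 1 (cmod z))\<bar> \<le> max K1 K2" for z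
    using up[of z] low[of z] by (auto simp: abs_le_iff)
  then show ?thesis by blast
qed

text \<open>\<open>V\<close> is the set of finite places with normalised valuations \<open>w v\<close>, \<open>lam v\<close> stands for
  \<open>log |1/\<pi>\<^sub>v|\<^sub>v\<close>, and \<open>Hom\<close> is the set of all complex embeddings, so that conjugate pairs are
  counted twice.\<close>

locale height_system =
  fixes V :: "'v set" and w :: "'v \<Rightarrow> 'k::field_char_0 \<Rightarrow> int" and lam :: "'v \<Rightarrow> real"
    and Hom :: "('k \<Rightarrow> complex) set" and d :: real
  assumes w_mult: "v \<in> V \<Longrightarrow> x \<noteq> 0 \<Longrightarrow> y \<noteq> 0 \<Longrightarrow> w v (x * y) = w v x + w v y"
    and w_add: "v \<in> V \<Longrightarrow> x \<noteq> 0 \<Longrightarrow> y \<noteq> 0 \<Longrightarrow> x + y \<noteq> 0 \<Longrightarrow> min (w v x) (w v y) \<le> w v (x + y)"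
    and w_zero: "w v 0 = 0"
    and finite_w: "finite {v \<in> V. w v x \<noteq> 0}"
    and lam_pos: "v \<in> V \<Longrightarrow> lam v > 0"
    and finite_Hom: "finite Hom"
    and Hom: "\<sigma> \<in> Hom \<Longrightarrow> field_hom \<sigma>"
    and d_pos: "d > 0"
    and product: "x \<noteq> 0 \<Longrightarrow> (\<Sum>v | v \<in> V \<and> w v x \<noteq> 0. of_int (w v x) * lam v) = (\<Sum>\<sigma>\<in>Hom. ln (cmod (\<sigma> x))) / d"
    and northcott: "finite {x. (\<forall>v\<in>V. w v x < 0 \<longrightarrow> of_int (- w v x) * lam v \<le> B) \<and> (\<forall>\<sigma>\<in>Hom. cmod (\<sigma> x) \<le> C)}"
begin

definition ht :: "'k \<Rightarrow> real" where
  "ht x = (\<Sum>v | v \<in> V \<and> w v x < 0. of_int (- w v x) * lam v) + (\<Sum>\<sigma>\<in>Hom. ln (max 1 (cmod (\<sigma> x)))) / d"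

text \<open>Zeros count without multiplicity, as in the logarithm of a radical. The default
  \<open>w v 0 = 0\<close> gives the value 0 at 0, whence conditions such as
  \<open>poly g \<beta> \<noteq> 0\<close> below.\<close>

definition Nz :: "'k \<Rightarrow> real" where
  "Nz x = (\<Sum>v | v \<in> V \<and> w v x > 0. lam v)"

lemma finite_neg: "finite {v. v \<in> V \<and> w v x < 0}" and finite_pos: "finite {v. v \<in> V \<and> w v x > 0}"
  by (rule finite_subset[OF _ finite_w[of x]], auto)+

lemma w_one: "v \<in> V \<Longrightarrow> w v 1 = 0"
  using w_mult[of v 1 1] by simp

lemma w_neg: "v \<in> V \<Longrightarrow> w v (- x) = w v x"
proof (cases "x = 0")
  case False
  assume v: "v \<in> V"
  have "w v (- 1) + w v (- 1) = 0" using w_mult[OF v, of "-1" "-1"] w_one[OF v] by simp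
  then show ?thesis using w_mult[OF v, of "-1" x] False by simp
qed simp

lemma w_power: "v \<in> V \<Longrightarrow> x \<noteq> 0 \<Longrightarrow> w v (x ^ n) = int n * w v x"
  by (induction n) (auto simp: w_one w_mult algebra_simps)

lemma w_inverse: "v \<in> V \<Longrightarrow> w v (inverse x) = - w v x"
proof (cases "x = 0")
  case False
  assume v: "v \<in> V"
  show ?thesis using w_mult[OF v False, of "inverse x"] w_one[OF v] False by simp
qed (simp add: w_zero)

lemma w_powi: "v \<in> V \<Longrightarrow> x \<noteq> 0 \<Longrightarrow> w v (x powi n) = n * w v x"
  by (simp add: power_int_def w_power w_inverse)

text \<open>In the ultrametric inequality for x = (x + y) - y the term \<open>y\<close> cannot
  attain the minimum.\<close>

lemma w_add_dominant:
  assumes v: "v \<in> V" and "x \<noteq> 0" "y = 0 \<or> w v x < w v y"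
  shows "x + y \<noteq> 0" "w v (x + y) = w v x"
proof -
  show nz: "x + y \<noteq> 0"
  proof
    assume "x + y = 0"
    then have "y = - x" by (simp add: add_eq_0_iff)
    then show False using assms w_neg[OF v, of x] by auto
  qed
  show "w v (x + y) = w v x"
  proof (cases "y = 0")
    case False
    then have lt: "w v x < w v y" using assms by simp
    have 1: "w v x \<le> w v (x + y)" using w_add[OF v assms(2) False nz] lt by simp
    have "min (w v (x + y)) (w v (- y)) \<le> w v ((x + y) + - y)"
      by (rule w_add[OF v nz]) (use False assms(2) in auto)
    then show ?thesis using 1 lt w_neg[OF v, of y] by (auto simp: min_def split: if_splits)
  qed simp
qed

lemma w_sum_ge:
  assumes v: "v \<in> V" and "finite I" "\<And>i. i \<in> I \<Longrightarrow> f i = 0 \<or> B \<le> w v (f i)"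
  shows "sum f I = 0 \<or> B \<le> w v (sum f I)"
  using assms(2,3)
proof (induction rule: finite_induct)
  case (insert i I)
  then have IH: "sum f I = 0 \<or> B \<le> w v (sum f I)" by blast
  have fi: "f i = 0 \<or> B \<le> w v (f i)" using insert.prems by blast
  show ?case
  proof (cases "f i = 0 \<or> sum f I = 0 \<or> f i + sum f I = 0")
    case True
    then show ?thesis using IH fi insert.hyps by auto
  next
    case False
    then show ?thesis using IH fi w_add[OF v, of "f i" "sum f I"] insert.hyps by (auto simp: min_def split: if_splits)
  qed
qed simp

text \<open>Every nonzero coefficient is a unit at \<open>v\<close>; the default at 0 takes care of
  the zero ones. At such places a pole is multiplied by the degree without error term
  (\<open>good_poly\<close>).\<close>

definition good :: "'v \<Rightarrow> 'k poly \<Rightarrow> bool" where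
  "good v p \<longleftrightarrow> (\<forall>i. w v (Polynomial.coeff p i) = 0)"

lemma finite_bad: "finite {v \<in> V. \<not> good v p}"
proof (rule finite_subset)
  show "{v \<in> V. \<not> good v p} \<subseteq> (\<Union>i\<le>Polynomial.degree p. {v \<in> V. w v (Polynomial.coeff p i) \<noteq> 0})"
  proof
    fix v assume v: "v \<in> {v \<in> V. \<not> good v p}"
    then obtain i where i: "w v (Polynomial.coeff p i) \<noteq> 0" by (auto simp: good_def)
    then have "i \<le> Polynomial.degree p" using w_zero coeff_eq_0 linorder_not_le by metis
    then show "v \<in> (\<Union>i\<le>Polynomial.degree p. {v \<in> V. w v (Polynomial.coeff p i) \<noteq> 0})" using v i by blast
  qed
  show "finite (\<Union>i\<le>Polynomial.degree p. {v \<in> V. w v (Polynomial.coeff p i) \<noteq> 0})"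
    using finite_w by blast
qed

text \<open>Once the pole of \<open>x\<close> has order beyond 2 A the leading term dominates,
  because the valuations of the coefficients differ by at most 2 A.\<close>

lemma poly_local_bounds:
  assumes v: "v \<in> V" and A: "\<And>i. \<bar>w v (Polynomial.coeff p i)\<bar> \<le> A" and m: "Polynomial.degree p = m" "p \<noteq> 0"
  shows "poly p x = 0 \<or> w v (poly p x) \<ge> - A + int m * min 0 (w v x)"
    and "w v x < - 2 * A \<Longrightarrow> poly p x \<noteq> 0 \<and> w v (poly p x) = w v (Polynomial.coeff p m) + int m * w v x"
proof -
  have px: "poly p x = (\<Sum>i\<le>m. Polynomial.coeff p i * x ^ i)" using m by (simp add: poly_altdef)
  have A0: "A \<ge> 0" using A[of 0] by linarith
  show "poly p x = 0 \<or> w v (poly p x) \<ge> - A + int m * min 0 (w v x)"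
    unfolding px
  proof (rule w_sum_ge[OF v])
    fix i assume i: "i \<in> {..m}"
    show "Polynomial.coeff p i * x ^ i = 0 \<or> - A + int m * min 0 (w v x) \<le> w v (Polynomial.coeff p i * x ^ i)"
    proof (cases "Polynomial.coeff p i = 0 \<or> x ^ i = 0")
      case False
      have wx: "w v (x ^ i) = int i * w v x"
        by (cases "x = 0") (use False in \<open>auto simp: w_power v w_zero w_one power_0_left split: if_splits\<close>)
      have "int m * min 0 (w v x) \<le> int i * min 0 (w v x)" using i by (intro mult_right_mono_neg) auto
      also have "\<dots> \<le> int i * w v x" by (rule mult_left_mono) auto
      finally have "int m * min 0 (w v x) \<le> int i * w v x" .
      moreover have "- A \<le> w v (Polynomial.coeff p i)" using A[of i] by linarith
      ultimately show ?thesis using w_mult[OF v] False wx by auto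
    qed auto
  qed simp
  assume lt: "w v x < - 2 * A"
  then have x0: "x \<noteq> 0" using A0 w_zero[of v] by auto
  have cm: "Polynomial.coeff p m \<noteq> 0" using m by auto
  have w1: "w v (Polynomial.coeff p m * x ^ m) = w v (Polynomial.coeff p m) + int m * w v x"
    using cm x0 by (simp add: w_mult w_power v)
  have split: "poly p x = Polynomial.coeff p m * x ^ m + (\<Sum>i<m. Polynomial.coeff p i * x ^ i)"
    unfolding px by (simp add: lessThan_Suc_atMost[symmetric] add.commute)
  have "(\<Sum>i<m. Polynomial.coeff p i * x ^ i) = 0 \<or>
      w v (Polynomial.coeff p m * x ^ m) + 1 \<le> w v (\<Sum>i<m. Polynomial.coeff p i * x ^ i)"
  proof (rule w_sum_ge[OF v])
    fix i assume i: "i \<in> {..<m}"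
    show "Polynomial.coeff p i * x ^ i = 0 \<or> w v (Polynomial.coeff p m * x ^ m) + 1 \<le> w v (Polynomial.coeff p i * x ^ i)"
    proof (cases "Polynomial.coeff p i = 0")
      case False
      have w2: "w v (Polynomial.coeff p i * x ^ i) = w v (Polynomial.coeff p i) + int i * w v x"
        using False x0 by (simp add: w_mult w_power v)
      obtain k where k: "m = i + 1 + k" using i by (metis Suc_eq_plus1 add.commute add_Suc_right lessThan_iff less_iff_Suc_add)
      have "int k * w v x \<le> 0" using lt A0 by (intro mult_nonneg_nonpos) auto
      then have "int m * w v x \<le> int i * w v x + w v x" by (simp add: k algebra_simps)
      moreover have "w v (Polynomial.coeff p m) \<le> A" "- A \<le> w v (Polynomial.coeff p i)" using A[of m] A[of i] by linarith+
      ultimately show ?thesis unfolding w1 w2 using lt by simp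
    qed simp
  qed simp
  then have "(\<Sum>i<m. Polynomial.coeff p i * x ^ i) = 0 \<or>
      w v (Polynomial.coeff p m * x ^ m) < w v (\<Sum>i<m. Polynomial.coeff p i * x ^ i)" by auto
  then show "poly p x \<noteq> 0 \<and> w v (poly p x) = w v (Polynomial.coeff p m) + int m * w v x"
    unfolding split using w_add_dominant[OF v, of "Polynomial.coeff p m * x ^ m"] cm x0 w1 by simp
qed

lemma good_poly:
  assumes v: "v \<in> V" and g: "good v p" and p: "p \<noteq> 0"
  shows "w v x \<ge> 0 \<Longrightarrow> w v (poly p x) \<ge> 0"
    and "w v x < 0 \<Longrightarrow> poly p x \<noteq> 0 \<and> w v (poly p x) = int (Polynomial.degree p) * w v x"
proof -
  have A: "\<bar>w v (Polynomial.coeff p i)\<bar> \<le> 0" for i using g by (simp add: good_def)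
  show "w v x \<ge> 0 \<Longrightarrow> w v (poly p x) \<ge> 0"
    using poly_local_bounds(1)[OF v A refl p, of x] w_zero[of v] by auto
  show "w v x < 0 \<Longrightarrow> poly p x \<noteq> 0 \<and> w v (poly p x) = int (Polynomial.degree p) * w v x"
    using poly_local_bounds(2)[OF v A refl p, of x] g by (simp add: good_def)
qed

lemma ht_as_sum:
  assumes "finite F" "F \<subseteq> V" "\<And>v. v \<in> V \<Longrightarrow> w v x < 0 \<Longrightarrow> v \<in> F"
  shows "ht x = (\<Sum>v\<in>F. of_int (max 0 (- w v x)) * lam v) + (\<Sum>\<sigma>\<in>Hom. ln (max 1 (cmod (\<sigma> x)))) / d"
proof -
  have "(\<Sum>v | v \<in> V \<and> w v x < 0. of_int (- w v x) * lam v) = (\<Sum>v\<in>F. of_int (max 0 (- w v x)) * lam v)"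
    by (rule sum.mono_neutral_cong_left) (use assms in \<open>auto simp: max_def\<close>)
  then show ?thesis by (simp add: ht_def)
qed

text \<open>The error vanishes at good places, so the local errors have a finite sum. It is at most
  2 m A while the pole of \<open>x\<close> is small, and at most A, from the leading coefficient,
  once it is large.\<close>

lemma poly_local_height:
  assumes v: "v \<in> V" and m: "Polynomial.degree p = m" "m > 0"
  shows "\<exists>K. (good v p \<longrightarrow> K = 0) \<and> (\<forall>x. \<bar>max 0 (- w v (poly p x)) - int m * max 0 (- w v x)\<bar> \<le> K)"
proof -
  have p0: "p \<noteq> 0" using m by auto
  define A where "A = (MAX i\<in>{..m}. \<bar>w v (Polynomial.coeff p i)\<bar>)"
  have A: "\<bar>w v (Polynomial.coeff p i)\<bar> \<le> A" for i
  proof (cases "i \<le> m")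
    case True
    then show ?thesis unfolding A_def by (intro Max_ge) auto
  next
    case False
    then have "w v (Polynomial.coeff p i) = 0" using m w_zero by (simp add: coeff_eq_0)
    also have "\<bar>w v (Polynomial.coeff p 0)\<bar> \<le> A" unfolding A_def by (intro Max_ge) auto
    finally show ?thesis using \<open>\<bar>w v (Polynomial.coeff p 0)\<bar> \<le> A\<close> \<open>w v (Polynomial.coeff p i) = 0\<close> by linarith
  qed
  have A0: "A \<ge> 0" using A[of 0] by linarith
  have "good v p \<Longrightarrow> A = 0" unfolding A_def good_def by simp
  moreover have "\<bar>max 0 (- w v (poly p x)) - int m * max 0 (- w v x)\<bar> \<le> (2 * int m + 1) * A" for x
  proof -
    have "0 \<le> int m * A" using A0 by simp
    have up: "max 0 (- w v (poly p x)) \<le> A + int m * max 0 (- w v x)"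
    proof -
      have "min 0 (w v x) = - max 0 (- w v x)" by auto
      then have "poly p x = 0 \<or> w v (poly p x) \<ge> - A - int m * max 0 (- w v x)"
        using poly_local_bounds(1)[OF v A m(1) p0, of x] by simp
      moreover have "0 \<le> int m * max 0 (- w v x)" by simp
      ultimately show ?thesis using A0 w_zero[of v] by auto
    qed
    have low: "int m * max 0 (- w v x) \<le> max 0 (- w v (poly p x)) + (2 * int m + 1) * A"
    proof (cases "w v x < - 2 * A")
      case True
      have "w v (poly p x) = w v (Polynomial.coeff p m) + int m * w v x"
        using poly_local_bounds(2)[OF v A m(1) p0 True] by blast
      moreover have "w v (Polynomial.coeff p m) \<le> A" using A[of m] by linarith
      moreover have "max 0 (- w v x) = - w v x" using True A0 by auto
      ultimately show ?thesis using \<open>0 \<le> int m * A\<close> by (simp add: algebra_simps max_def)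
    next
      case False
      then have "int m * max 0 (- w v x) \<le> int m * (2 * A)" using A0 by (intro mult_left_mono) auto
      also have "\<dots> \<le> (2 * int m + 1) * A" using A0 by (simp add: algebra_simps)
      finally show ?thesis by linarith
    qed
    show ?thesis using up low \<open>0 \<le> int m * A\<close> by (simp add: abs_le_iff algebra_simps)
  qed
  ultimately show ?thesis by (intro exI[of _ "(2 * int m + 1) * A"]) auto
qed

text \<open>The local estimates are added up: \<open>poly_local_height\<close> at the finite places
  and \<open>ln_max_norm_poly_bound\<close> at each embedding.\<close>

lemma ht_poly:
  assumes m: "Polynomial.degree p = m" "m > 0"
  shows "\<exists>C. \<forall>x. \<bar>ht (poly p x) - real m * ht x\<bar> \<le> C"
proof -
  have "\<forall>v\<in>V. \<exists>K. (good v p \<longrightarrow> K = 0) \<and> (\<forall>x. \<bar>max 0 (- w v (poly p x)) - int m * max 0 (- w v x)\<bar> \<le> K)"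
    using poly_local_height[OF _ m] by blast
  then obtain K where K: "\<And>v. v \<in> V \<Longrightarrow> good v p \<Longrightarrow> K v = 0"
    "\<And>v x. v \<in> V \<Longrightarrow> \<bar>max 0 (- w v (poly p x)) - int m * max 0 (- w v x)\<bar> \<le> K v" by metis
  have "\<forall>\<sigma>\<in>Hom. \<exists>K. \<forall>x. \<bar>ln (max 1 (cmod (\<sigma> (poly p x)))) - real m * ln (max 1 (cmod (\<sigma> x)))\<bar> \<le> K"
  proof
    fix \<sigma> assume "\<sigma> \<in> Hom"
    then interpret s: field_hom \<sigma> by (rule Hom)
    have "Polynomial.degree (map_poly \<sigma> p) = m" using m(1) by simp
    from ln_max_norm_poly_bound[OF this m(2)] obtain K where
      "\<And>z. \<bar>ln (max 1 (cmod (poly (map_poly \<sigma> p) z))) - real m * ln (max 1 (cmod z))\<bar> \<le> K" by blast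
    then have "\<bar>ln (max 1 (cmod (\<sigma> (poly p x)))) - real m * ln (max 1 (cmod (\<sigma> x)))\<bar> \<le> K" for x
      unfolding s.poly_map_poly[symmetric] .
    then show "\<exists>K. \<forall>x. \<bar>ln (max 1 (cmod (\<sigma> (poly p x)))) - real m * ln (max 1 (cmod (\<sigma> x)))\<bar> \<le> K" by blast
  qed
  then obtain L where L: "\<And>\<sigma> x. \<sigma> \<in> Hom \<Longrightarrow> \<bar>ln (max 1 (cmod (\<sigma> (poly p x)))) - real m * ln (max 1 (cmod (\<sigma> x)))\<bar> \<le> L \<sigma>"
    by metis
  define B where "B = {v \<in> V. \<not> good v p}"
  have B: "finite B" "B \<subseteq> V" unfolding B_def using finite_bad by auto
  define C where "C = (\<Sum>v\<in>B. of_int (K v) * lam v) + (\<Sum>\<sigma>\<in>Hom. L \<sigma>) / d"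
  have "\<bar>ht (poly p x) - real m * ht x\<bar> \<le> C" for x
  proof -
    define F where "F = B \<union> {v. v \<in> V \<and> w v x < 0} \<union> {v. v \<in> V \<and> w v (poly p x) < 0}"
    have F: "finite F" "F \<subseteq> V" "B \<subseteq> F" unfolding F_def using B finite_neg by auto
    define a where "a = (\<lambda>v. of_int (max 0 (- w v (poly p x)) - int m * max 0 (- w v x)) * lam v)"
    define b where "b = (\<lambda>\<sigma>::'k \<Rightarrow> complex. ln (max 1 (cmod (\<sigma> (poly p x)))) - real m * ln (max 1 (cmod (\<sigma> x))))"
    have "ht (poly p x) = (\<Sum>v\<in>F. of_int (max 0 (- w v (poly p x))) * lam v) + (\<Sum>\<sigma>\<in>Hom. ln (max 1 (cmod (\<sigma> (poly p x))))) / d"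
      by (rule ht_as_sum) (use F in \<open>auto simp: F_def\<close>)
    moreover have "ht x = (\<Sum>v\<in>F. of_int (max 0 (- w v x)) * lam v) + (\<Sum>\<sigma>\<in>Hom. ln (max 1 (cmod (\<sigma> x)))) / d"
      by (rule ht_as_sum) (use F in \<open>auto simp: F_def\<close>)
    moreover have "(\<Sum>v\<in>F. a v) = (\<Sum>v\<in>F. of_int (max 0 (- w v (poly p x))) * lam v) - real m * (\<Sum>v\<in>F. of_int (max 0 (- w v x)) * lam v)"
      unfolding a_def sum_distrib_left sum_subtractf[symmetric]
      by (rule sum.cong) (simp_all add: left_diff_distrib del: of_int_max)
    moreover have "(\<Sum>\<sigma>\<in>Hom. b \<sigma>) = (\<Sum>\<sigma>\<in>Hom. ln (max 1 (cmod (\<sigma> (poly p x))))) - real m * (\<Sum>\<sigma>\<in>Hom. ln (max 1 (cmod (\<sigma> x))))"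
      unfolding b_def sum_distrib_left sum_subtractf ..
    ultimately have eq: "ht (poly p x) - real m * ht x = (\<Sum>v\<in>F. a v) + (\<Sum>\<sigma>\<in>Hom. b \<sigma>) / d"
      by (simp add: right_diff_distrib diff_divide_distrib distrib_left)
    have "\<bar>\<Sum>v\<in>F. a v\<bar> \<le> (\<Sum>v\<in>F. \<bar>a v\<bar>)" by (rule sum_abs)
    also have "\<dots> \<le> (\<Sum>v\<in>F. of_int (K v) * lam v)"
    proof (rule sum_mono)
      fix v assume v: "v \<in> F"
      then have vV: "v \<in> V" using F by blast
      have "\<bar>a v\<bar> = of_int \<bar>max 0 (- w v (poly p x)) - int m * max 0 (- w v x)\<bar> * lam v"
        unfolding a_def abs_mult using lam_pos[OF vV] by simp
      also have "\<dots> \<le> of_int (K v) * lam v" using K(2)[OF vV] lam_pos[OF vV] by (intro mult_right_mono) (auto simp del: of_int_abs)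
      finally show "\<bar>a v\<bar> \<le> of_int (K v) * lam v" .
    qed
    also have "\<dots> = (\<Sum>v\<in>B. of_int (K v) * lam v)"
      by (rule sum.mono_neutral_right) (use F K(1) in \<open>auto simp: B_def\<close>)
    finally have 1: "\<bar>\<Sum>v\<in>F. a v\<bar> \<le> (\<Sum>v\<in>B. of_int (K v) * lam v)" .
    have "\<bar>\<Sum>\<sigma>\<in>Hom. b \<sigma>\<bar> \<le> (\<Sum>\<sigma>\<in>Hom. \<bar>b \<sigma>\<bar>)" by (rule sum_abs)
    also have "\<dots> \<le> (\<Sum>\<sigma>\<in>Hom. L \<sigma>)" by (rule sum_mono) (use L in \<open>auto simp: b_def\<close>)
    finally have "\<bar>(\<Sum>\<sigma>\<in>Hom. b \<sigma>) / d\<bar> \<le> (\<Sum>\<sigma>\<in>Hom. L \<sigma>) / d" using d_pos by (simp add: divide_right_mono)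
    then show ?thesis unfolding eq C_def using 1 by linarith
  qed
  then show ?thesis by blast
qed

lemma lam_nonneg: "v \<in> V \<Longrightarrow> lam v \<ge> 0"
  using lam_pos less_imp_le by blast

lemma pole_term_nonneg: "v \<in> V \<Longrightarrow> w v x < 0 \<Longrightarrow> of_int (- w v x) * lam v \<ge> 0"
  using lam_nonneg[of v] by (intro mult_nonneg_nonneg) auto

lemma ht_nonneg: "ht x \<ge> 0"
proof -
  have "(\<Sum>v | v \<in> V \<and> w v x < 0. of_int (- w v x) * lam v) \<ge> 0"
    by (rule sum_nonneg) (use pole_term_nonneg in blast)
  moreover have "(\<Sum>\<sigma>\<in>Hom. ln (max 1 (cmod (\<sigma> x)))) / d \<ge> 0"
    using d_pos by (intro divide_nonneg_pos sum_nonneg) auto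
  ultimately show ?thesis by (simp add: ht_def)
qed

lemma ht_zero: "ht 0 = 0"
proof -
  have "\<sigma> 0 = 0" if "\<sigma> \<in> Hom" for \<sigma>
  proof -
    interpret field_hom \<sigma> by (rule Hom[OF that])
    show ?thesis by simp
  qed
  then have "ln (max 1 (cmod (\<sigma> 0))) = 0" if "\<sigma> \<in> Hom" for \<sigma>
    unfolding \<open>\<And>\<sigma>. \<sigma> \<in> Hom \<Longrightarrow> \<sigma> 0 = 0\<close>[OF that] by simp
  then have "(\<Sum>\<sigma>\<in>Hom. ln (max 1 (cmod (\<sigma> 0)))) = 0" by (intro sum.neutral ballI)
  then show ?thesis by (simp add: ht_def w_zero)
qed

text \<open>The product formula trades the zeros of \<open>x\<close> for its poles and Archimedean
  terms, as in h(1/x) = h(x).\<close>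

lemma sum_pos_val_le_ht:
  assumes x: "x \<noteq> 0"
  shows "(\<Sum>v | v \<in> V \<and> w v x > 0. of_int (w v x) * lam v) \<le> ht x"
proof -
  have "{v. v \<in> V \<and> w v x \<noteq> 0} = {v. v \<in> V \<and> w v x > 0} \<union> {v. v \<in> V \<and> w v x < 0}" by auto
  then have "(\<Sum>v | v \<in> V \<and> w v x \<noteq> 0. of_int (w v x) * lam v) =
      (\<Sum>v | v \<in> V \<and> w v x > 0. of_int (w v x) * lam v) + (\<Sum>v | v \<in> V \<and> w v x < 0. of_int (w v x) * lam v)"
    using finite_pos finite_neg by (simp add: sum.union_disjoint disjoint_iff)
  moreover have "(\<Sum>v | v \<in> V \<and> w v x < 0. of_int (- w v x) * lam v) = - (\<Sum>v | v \<in> V \<and> w v x < 0. of_int (w v x) * lam v)"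
    by (simp add: sum_negf)
  moreover have "(\<Sum>\<sigma>\<in>Hom. ln (cmod (\<sigma> x))) \<le> (\<Sum>\<sigma>\<in>Hom. ln (max 1 (cmod (\<sigma> x))))"
  proof (rule sum_mono)
    fix \<sigma> assume "\<sigma> \<in> Hom"
    then interpret s: field_hom \<sigma> by (rule Hom)
    have "\<sigma> x \<noteq> 0" using x by simp
    then show "ln (cmod (\<sigma> x)) \<le> ln (max 1 (cmod (\<sigma> x)))" by simp
  qed
  then have "(\<Sum>\<sigma>\<in>Hom. ln (cmod (\<sigma> x))) / d \<le> (\<Sum>\<sigma>\<in>Hom. ln (max 1 (cmod (\<sigma> x)))) / d"
    using d_pos by (simp add: divide_right_mono)
  ultimately show ?thesis using product[OF x] by (simp add: ht_def)
qed

lemma Nz_le_sum_pos: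
  "Nz x \<le> (\<Sum>v | v \<in> V \<and> w v x > 0. of_int (w v x) * lam v)"
  unfolding Nz_def
proof (rule sum_mono)
  fix v assume "v \<in> {v. v \<in> V \<and> w v x > 0}"
  then have "1 * lam v \<le> of_int (w v x) * lam v" using lam_pos[of v] by (intro mult_right_mono) auto
  then show "lam v \<le> of_int (w v x) * lam v" by simp
qed

lemma Nz_le_ht: "Nz x \<le> ht x"
proof (cases "x = 0")
  case True
  then show ?thesis by (simp add: Nz_def w_zero ht_nonneg)
next
  case False
  show ?thesis by (rule order.trans[OF Nz_le_sum_pos sum_pos_val_le_ht[OF False]])
qed

lemma Nz_inverse_le_ht: "Nz (inverse x) \<le> ht x"
proof -
  have "Nz (inverse x) = (\<Sum>v | v \<in> V \<and> w v x < 0. lam v)"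
    unfolding Nz_def by (rule sum.cong) (auto simp: w_inverse)
  also have "\<dots> \<le> (\<Sum>v | v \<in> V \<and> w v x < 0. of_int (- w v x) * lam v)"
  proof (rule sum_mono)
    fix v assume "v \<in> {v. v \<in> V \<and> w v x < 0}"
    then have "1 * lam v \<le> of_int (- w v x) * lam v" using lam_pos[of v] by (intro mult_right_mono) auto
    then show "lam v \<le> of_int (- w v x) * lam v" by simp
  qed
  also have "\<dots> \<le> ht x" unfolding ht_def using d_pos by (simp add: sum_nonneg)
  finally show ?thesis .
qed

lemma Nz_nonneg: "Nz x \<ge> 0"
  unfolding Nz_def by (rule sum_nonneg) (use lam_nonneg in blast)

text \<open>The exceptional places \<open>B\<close> cost only the constant \<open>sum lam B\<close>,
  which later disappears into O(1).\<close>

lemma Nz_mono: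
  assumes "finite B" "B \<subseteq> V" "\<And>v. v \<in> V \<Longrightarrow> v \<notin> B \<Longrightarrow> w v x > 0 \<Longrightarrow> w v y > 0"
  shows "Nz x \<le> Nz y + sum lam B"
proof -
  have "Nz x \<le> sum lam ({v. v \<in> V \<and> w v y > 0} \<union> B)"
    unfolding Nz_def
  proof (rule sum_mono2)
    show "0 \<le> lam b" if "b \<in> {v. v \<in> V \<and> w v y > 0} \<union> B - {v. v \<in> V \<and> w v x > 0}" for b
      using lam_pos[of b] assms(2) that by auto
  qed (use assms finite_pos in auto)
  also have "\<dots> \<le> sum lam {v. v \<in> V \<and> w v y > 0} + sum lam B"
  proof -
    have "sum lam ({v. v \<in> V \<and> w v y > 0} \<inter> B) \<ge> 0"
      by (rule sum_nonneg) (use lam_nonneg in blast)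
    then show ?thesis using sum.union_inter[OF finite_pos assms(1), of lam y] by linarith
  qed
  finally show ?thesis by (simp add: Nz_def)
qed

lemma Nz_mult_le: "x \<noteq> 0 \<Longrightarrow> y \<noteq> 0 \<Longrightarrow> Nz (x * y) \<le> Nz x + Nz y"
proof -
  assume "x \<noteq> 0" "y \<noteq> 0"
  then have "Nz (x * y) \<le> Nz x + sum lam {v. v \<in> V \<and> w v y > 0}"
  proof (intro Nz_mono[OF finite_pos])
    fix v assume "v \<in> V" "v \<notin> {v. v \<in> V \<and> w v y > 0}" "w v (x * y) > 0"
    then show "w v x > 0" using w_mult[of v x y] \<open>x \<noteq> 0\<close> \<open>y \<noteq> 0\<close> by simp
  qed auto
  then show ?thesis by (simp add: Nz_def)
qed

lemma northcott_ht: "finite {x. ht x \<le> B}"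
proof (rule finite_subset[OF _ northcott[of "B" "exp (B * d)"]])
  show "{x. ht x \<le> B} \<subseteq> {x. (\<forall>v\<in>V. w v x < 0 \<longrightarrow> of_int (- w v x) * lam v \<le> B) \<and> (\<forall>\<sigma>\<in>Hom. cmod (\<sigma> x) \<le> exp (B * d))}"
  proof (intro subsetI CollectI conjI ballI impI)
    fix x assume "x \<in> {x. ht x \<le> B}"
    then have x: "ht x \<le> B" by simp
    define s1 where "s1 = (\<Sum>v | v \<in> V \<and> w v x < 0. of_int (- w v x) * lam v)"
    define s2 where "s2 = (\<Sum>\<sigma>\<in>Hom. ln (max 1 (cmod (\<sigma> x))))"
    have s1: "s1 \<ge> 0" unfolding s1_def by (rule sum_nonneg) (use pole_term_nonneg in blast)
    have s2: "s2 \<ge> 0" unfolding s2_def by (intro sum_nonneg) auto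
    have b: "s1 + s2 / d \<le> B" using x by (simp add: ht_def s1_def s2_def)
    have "s2 / d \<ge> 0" using s2 d_pos by simp
    then have b1: "s1 \<le> B" using b by linarith
    have "s2 / d \<le> B" using b s1 by linarith
    then have b2: "s2 \<le> B * d" using d_pos by (simp add: field_simps)
    show "of_int (- w v x) * lam v \<le> B" if "v \<in> V" "w v x < 0" for v
    proof -
      have "of_int (- w v x) * lam v \<le> s1" unfolding s1_def
        by (rule member_le_sum[where f = "\<lambda>v. of_int (- w v x) * lam v"])
          (use that pole_term_nonneg finite_neg in blast)+
      with b1 show ?thesis by linarith
    qed
    show "cmod (\<sigma> x) \<le> exp (B * d)" if "\<sigma> \<in> Hom" for \<sigma>
    proof -
      have "ln (max 1 (cmod (\<sigma> x))) \<le> s2" unfolding s2_def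
        by (rule member_le_sum[where f = "\<lambda>\<sigma>. ln (max 1 (cmod (\<sigma> x)))"]) (use that finite_Hom in auto)
      then have "max 1 (cmod (\<sigma> x)) \<le> exp (B * d)"
      proof -
        have "ln (max 1 (cmod (\<sigma> x))) \<le> B * d" using b2 \<open>ln _ \<le> s2\<close> by linarith
        then have "exp (ln (max 1 (cmod (\<sigma> x)))) \<le> exp (B * d)" by (simp only: exp_le_cancel_iff)
        moreover have "exp (ln (max 1 (cmod (\<sigma> x)))) = max 1 (cmod (\<sigma> x))" by (rule exp_ln) simp
        ultimately show ?thesis by simp
      qed
      then show ?thesis by simp
    qed
  qed
qed

end

section \<open>Belyi maps\<close>

lemma rpoly_linear: "rpoly [:a, b:] z = of_rat a + z * of_rat b"
  by (simp add: of_rat_hom.map_poly_pCons_hom)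

lemma order_power:
  assumes "p \<noteq> 0" shows "Polynomial.order x (p ^ k) = k * Polynomial.order x (p :: 'a::idom poly)"
  by (induction k) (use assms in \<open>auto simp: order_mult order_0I\<close>)

text \<open>The powers of \<open>p\<close> modulo \<open>q\<close> are dependent in a space of
  dimension deg q. The roots of \<open>s\<close> include the images under \<open>p\<close> of the
  roots of \<open>q\<close>, and the degree bound is what makes the induction in
  \<open>belyi_prod_list\<close> terminate.\<close>

lemma pcompose_multiple_exists:
  fixes p q :: "rat poly"
  assumes "q \<noteq> 0"
  shows "\<exists>s. s \<noteq> 0 \<and> Polynomial.degree s \<le> Polynomial.degree q \<and> q dvd s \<circ>\<^sub>p p"
proof (cases "Polynomial.degree q = 0")
  case True
  then have "q dvd 1" using assms by (simp add: is_unit_iff_degree)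
  then have "q dvd 1 \<circ>\<^sub>p p" by (metis dvd_trans one_dvd)
  then show ?thesis by (intro exI[of _ 1]) auto
next
  case False
  define k where "k = Polynomial.degree q"
  obtain a where a: "\<exists>j\<in>{..k}. a j \<noteq> 0" "\<forall>i\<in>{..<k}. (\<Sum>j\<in>{..k}. a j * Polynomial.coeff (p ^ j mod q) i) = 0"
    using homogeneous_system_nontrivial[of "{..<k}" "{..k}" "\<lambda>j i. Polynomial.coeff (p ^ j mod q) i"] by auto
  define s where "s = (\<Sum>j\<le>k. Polynomial.monom (a j) j)"
  have "s \<noteq> 0"
  proof
    assume "s = 0"
    then have "a j = 0" if "j \<le> k" for j using that coeff_sum_monom[of a k j] by (simp add: s_def)
    with a(1) show False by auto
  qed
  moreover have "Polynomial.degree s \<le> k" unfolding s_def by (rule degree_sum_monom_le)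
  moreover have "q dvd s \<circ>\<^sub>p p"
  proof -
    have sp: "s \<circ>\<^sub>p p = (\<Sum>j\<le>k. Polynomial.smult (a j) (p ^ j))"
      unfolding s_def pcompose_sum by (rule sum.cong) (simp_all add: monom_altdef pcompose_smult pcompose_hom.hom_power pcompose_pCons)
    have "(\<Sum>j\<le>k. Polynomial.smult (a j) (p ^ j mod q)) = 0"
    proof (rule poly_eqI)
      fix i
      show "Polynomial.coeff (\<Sum>j\<le>k. Polynomial.smult (a j) (p ^ j mod q)) i = Polynomial.coeff 0 i"
      proof (cases "i < k")
        case True
        then show ?thesis using a(2) by (simp add: Polynomial.coeff_sum)
      next
        case False2: False
        have "Polynomial.coeff (p ^ j mod q) i = 0" for j
          using degree_mod_less[OF assms, of "p ^ j"] False False2 by (intro coeff_eq_0) (auto simp: k_def)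
        then show ?thesis by (simp add: Polynomial.coeff_sum)
      qed
    qed
    then have "s \<circ>\<^sub>p p = (\<Sum>j\<le>k. Polynomial.smult (a j) (p ^ j) - Polynomial.smult (a j) (p ^ j mod q))"
      unfolding sp sum_subtractf by simp
    also have "q dvd \<dots>"
      by (rule dvd_sum) (simp add: smult_diff_right[symmetric] dvd_smult minus_mod_eq_mult_div)
    finally show ?thesis .
  qed
  ultimately show ?thesis unfolding k_def by blast
qed

text \<open>K[X] modulo \<open>f\<close> has dimension deg f times \<open>n\<close> over the
  rationals, so the powers of X satisfy a rational relation modulo \<open>f\<close>.\<close>

lemma rational_multiple_exists:
  fixes f :: "'k::field_char_0 poly"
  assumes nf: "number_field TYPE('k)" and f: "f \<noteq> 0"
  shows "\<exists>R::rat poly. R \<noteq> 0 \<and> f dvd map_poly of_rat R"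
proof -
  obtain \<theta> :: 'k and m where "integral_primitive \<theta> m" using number_field_integral_primitive[OF nf] by blast
  then interpret integral_primitive \<theta> m .
  define k where "k = Polynomial.degree f"
  define N where "N = k * n"
  have "\<exists>g. Polynomial.degree g < n \<and> x = rpoly g \<theta>" for x using representation[of x] by blast
  then obtain rep where rep: "\<And>x. Polynomial.degree (rep x) < n" "\<And>x. rpoly (rep x) \<theta> = x" by metis
  define Y where "Y = (\<lambda>j. Polynomial.monom (1::'k) j mod f)"
  define c where "c = (\<lambda>j (i,l). Polynomial.coeff (rep (Polynomial.coeff (Y j) i)) l)"
  obtain a where a: "\<exists>j\<in>{..N}. a j \<noteq> 0" "\<forall>i\<in>{..<k} \<times> {..<n}. (\<Sum>j\<in>{..N}. a j * c j i) = 0"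
    using homogeneous_system_nontrivial[of "{..<k} \<times> {..<n}" "{..N}" c] by (auto simp: N_def)
  define R where "R = (\<Sum>j\<le>N. Polynomial.monom (a j) j)"
  have "R \<noteq> 0"
  proof
    assume "R = 0"
    then have "a j = 0" if "j \<le> N" for j using that coeff_sum_monom[of a N j] by (simp add: R_def)
    with a(1) show False by auto
  qed
  moreover have "f dvd map_poly of_rat R"
  proof -
    have mR: "map_poly of_rat R = (\<Sum>j\<le>N. Polynomial.smult (of_rat (a j)) (Polynomial.monom 1 j))"
      by (rule poly_eqI) (simp add: R_def of_rat_hom.coeff_map_poly_hom coeff_sum_monom Polynomial.coeff_sum if_distrib cong: if_cong)
    have "(\<Sum>j\<le>N. Polynomial.smult (of_rat (a j)) (Y j)) = 0"
    proof (rule poly_eqI)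
      fix i
      show "Polynomial.coeff (\<Sum>j\<le>N. Polynomial.smult (of_rat (a j)) (Y j)) i = Polynomial.coeff 0 i"
      proof (cases "i < k")
        case True
        have "(\<Sum>j\<le>N. of_rat (a j) * Polynomial.coeff (Y j) i) = (\<Sum>j\<le>N. of_rat (a j) * (\<Sum>l\<le>n - 1. of_rat (c j (i,l)) * \<theta> ^ l))"
        proof (rule sum.cong)
          fix j
          have "Polynomial.coeff (Y j) i = rpoly (rep (Polynomial.coeff (Y j) i)) \<theta>" by (simp only: rep(2))
          also have "\<dots> = (\<Sum>l\<le>n - 1. of_rat (c j (i,l)) * \<theta> ^ l)"
            using rep(1)[of "Polynomial.coeff (Y j) i"]
            by (subst poly_sum_le[of _ "n - 1"]) (auto simp: c_def of_rat_hom.coeff_map_poly_hom)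
          finally show "of_rat (a j) * Polynomial.coeff (Y j) i = of_rat (a j) * (\<Sum>l\<le>n - 1. of_rat (c j (i,l)) * \<theta> ^ l)" by simp
        qed simp
        also have "\<dots> = (\<Sum>j\<le>N. \<Sum>l\<le>n - 1. of_rat (a j * c j (i,l)) * \<theta> ^ l)"
          by (simp only: sum_distrib_left of_rat_mult mult.assoc)
        also have "\<dots> = (\<Sum>l\<le>n - 1. \<Sum>j\<le>N. of_rat (a j * c j (i,l)) * \<theta> ^ l)" by (rule sum.swap)
        also have "\<dots> = (\<Sum>l\<le>n - 1. of_rat (\<Sum>j\<le>N. a j * c j (i,l)) * \<theta> ^ l)"
          by (simp only: sum_distrib_right of_rat_sum)
        also have "\<dots> = 0"
        proof (rule sum.neutral, rule ballI)
          fix l assume "l \<in> {..n - 1}"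
          then have "(i,l) \<in> {..<k} \<times> {..<n}" using True n_pos by auto
          then have "(\<Sum>j\<le>N. a j * c j (i,l)) = 0" using a(2) by blast
          then show "of_rat (\<Sum>j\<le>N. a j * c j (i,l)) * \<theta> ^ l = 0" by simp
        qed
        finally show ?thesis by (simp add: Polynomial.coeff_sum)
      next
        case False
        have "Polynomial.coeff (Y j) i = 0" for j
        proof (cases "Y j = 0")
          case False2: False
          then have "Polynomial.degree (Y j) < k"
            using degree_mod_less[OF f, of "Polynomial.monom 1 j"] by (auto simp: Y_def k_def)
          then show ?thesis using False by (intro coeff_eq_0) simp
        qed simp
        then show ?thesis by (simp add: Polynomial.coeff_sum)
      qed
    qed
    then have "map_poly of_rat R = (\<Sum>j\<le>N. Polynomial.smult (of_rat (a j)) (Polynomial.monom 1 j) - Polynomial.smult (of_rat (a j)) (Y j))"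
      unfolding mR sum_subtractf by simp
    also have "f dvd \<dots>"
      unfolding Y_def by (rule dvd_sum) (simp add: smult_diff_right[symmetric] dvd_smult minus_mod_eq_mult_div)
    finally show ?thesis .
  qed
  ultimately show ?thesis by blast
qed

text \<open>The quotient of \<open>R\<close> by its gcd with R'; the Bezout identity for the gcd
  stays valid in the extension field.\<close>

lemma squarefree_part_exists:
  fixes R :: "rat poly"
  assumes "R \<noteq> 0"
  shows "\<exists>G. G \<noteq> 0 \<and> rsquarefree (map_poly of_rat G :: 'a::field_char_0 poly) \<and>
    (\<forall>z::'a. rpoly G z = 0 \<longleftrightarrow> rpoly R z = 0)"
proof (cases "pderiv R = 0")
  case True
  then obtain c where "R = [:c:]" "c \<noteq> 0" using assms by (auto simp: pderiv_eq_0_iff elim!: degree_eq_zeroE)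
  then show ?thesis by (intro exI[of _ 1]) (auto simp: rsquarefree_roots rpoly_simps)
next
  case False
  define d where "d = gcd R (pderiv R)"
  obtain q where q: "R = q * d" using gcd_dvd1[of R "pderiv R"] unfolding d_def by (metis dvd_div_mult_self)
  obtain e where e: "pderiv R = e * d" using gcd_dvd2[of R "pderiv R"] unfolding d_def by (metis dvd_div_mult_self)
  obtain r s where rs: "r * R + s * pderiv R = d" unfolding d_def using bezout_coefficients_fst_snd by blast
  let ?m = "map_poly of_rat :: rat poly \<Rightarrow> 'a poly"
  have "rsquarefree (?m q) \<and> (\<forall>z. (poly (?m q) z = 0) = (poly (?m R) z = 0))"
  proof (rule poly_squarefree_decomp)
    show "pderiv (?m R) \<noteq> 0" using False by (simp add: of_rat_hom.map_poly_pderiv[symmetric])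
    show "?m R = ?m q * ?m d" using q of_rat_poly_hom.hom_mult by metis
    show "pderiv (?m R) = ?m e * ?m d" using e of_rat_poly_hom.hom_mult of_rat_hom.map_poly_pderiv by metis
    show "?m d = ?m r * ?m R + ?m s * pderiv (?m R)"
      unfolding of_rat_hom.map_poly_pderiv[symmetric] of_rat_poly_hom.hom_mult[symmetric] of_rat_poly_hom.hom_add[symmetric] rs ..
  qed
  moreover have "q \<noteq> 0" using q assms by auto
  ultimately show ?thesis by blast
qed

section \<open>The generalised abc inequality under polynomial maps\<close>

context height_system
begin

text \<open>For \<open>g\<close> with simple roots, deg g - 1 is the number of points in the union
  of its zeros with infinity, minus 2; for X (X - 1) it is 1, as in the abc inequality.\<close>

definition abc_bound :: "'k poly \<Rightarrow> bool" where
  "abc_bound g \<longleftrightarrow> (\<forall>\<epsilon>>0. \<exists>C. \<forall>\<beta>. poly g \<beta> \<noteq> 0 \<longrightarrow>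
     (real (Polynomial.degree g) - 1 - \<epsilon>) * ht \<beta> \<le> Nz (poly g \<beta>) + Nz (inverse \<beta>) + C)"

lemma ht_poly_upper: "\<exists>C. \<forall>x. ht (poly p x) \<le> real (Polynomial.degree p) * ht x + C"
proof (cases "Polynomial.degree p > 0")
  case True
  then obtain C where C: "\<And>x. \<bar>ht (poly p x) - real (Polynomial.degree p) * ht x\<bar> \<le> C" using ht_poly[OF refl] by blast
  have "ht (poly p x) \<le> real (Polynomial.degree p) * ht x + C" for x using C[of x] by linarith
  then show ?thesis by blast
next
  case False
  then obtain c where "p = [:c:]" by (auto elim: degree_eq_zeroE)
  then show ?thesis by (intro exI[of _ "ht c"]) simp
qed

text \<open>Dropping \<open>h\<close> loses N(h(\<beta>)), which is at most deg h times h(\<beta>)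
  up to O(1), exactly the loss in degree. The finitely many zeros of \<open>h\<close>, where the
  hypothesis says nothing, go into the constant.\<close>

lemma abc_bound_factor:
  assumes gh: "abc_bound (g * h)" and nz: "g * h \<noteq> 0" shows "abc_bound g"
  unfolding abc_bound_def
proof (intro allI impI)
  fix \<epsilon> :: real assume "\<epsilon> > 0"
  then obtain C where C: "\<And>\<beta>. poly (g * h) \<beta> \<noteq> 0 \<Longrightarrow>
     (real (Polynomial.degree (g * h)) - 1 - \<epsilon>) * ht \<beta> \<le> Nz (poly (g * h) \<beta>) + Nz (inverse \<beta>) + C"
    using gh unfolding abc_bound_def by blast
  obtain C1 where C1: "\<And>x. ht (poly h x) \<le> real (Polynomial.degree h) * ht x + C1" using ht_poly_upper by blast
  define Z where "Z = {\<beta>. poly h \<beta> = 0}"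
  have "finite Z" unfolding Z_def using nz by (intro poly_roots_finite) auto
  define C2 where "C2 = (\<Sum>\<beta>\<in>Z. \<bar>(real (Polynomial.degree g) - 1 - \<epsilon>) * ht \<beta>\<bar>)"
  have C2: "C2 \<ge> 0" unfolding C2_def by (rule sum_nonneg) simp
  have deg: "real (Polynomial.degree (g * h)) = real (Polynomial.degree g) + real (Polynomial.degree h)"
    using nz by (simp add: degree_mult_eq)
  have "(real (Polynomial.degree g) - 1 - \<epsilon>) * ht \<beta> \<le> Nz (poly g \<beta>) + Nz (inverse \<beta>) + (\<bar>C\<bar> + \<bar>C1\<bar> + C2)"
    if g: "poly g \<beta> \<noteq> 0" for \<beta>
  proof (cases "poly h \<beta> = 0")
    case True
    have "\<bar>(real (Polynomial.degree g) - 1 - \<epsilon>) * ht \<beta>\<bar> \<le> C2" unfolding C2_def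
      by (rule member_le_sum[where f = "\<lambda>\<beta>. \<bar>(real (Polynomial.degree g) - 1 - \<epsilon>) * ht \<beta>\<bar>"])
        (use True \<open>finite Z\<close> in \<open>auto simp: Z_def\<close>)
    then show ?thesis using Nz_nonneg[of "poly g \<beta>"] Nz_nonneg[of "inverse \<beta>"] by linarith
  next
    case False
    have "(real (Polynomial.degree g) - 1 - \<epsilon>) * ht \<beta> + real (Polynomial.degree h) * ht \<beta> =
        (real (Polynomial.degree (g * h)) - 1 - \<epsilon>) * ht \<beta>" unfolding deg by (simp add: algebra_simps)
    also have "\<dots> \<le> Nz (poly (g * h) \<beta>) + Nz (inverse \<beta>) + C" by (rule C) (use g False in simp)
    also have "Nz (poly (g * h) \<beta>) \<le> Nz (poly g \<beta>) + Nz (poly h \<beta>)"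
      using Nz_mult_le[OF g False] by simp
    also have "Nz (poly h \<beta>) \<le> real (Polynomial.degree h) * ht \<beta> + C1"
      using Nz_le_ht[of "poly h \<beta>"] C1[of \<beta>] by linarith
    finally show ?thesis using C2 by linarith
  qed
  then show "\<exists>C. \<forall>\<beta>. poly g \<beta> \<noteq> 0 \<longrightarrow> (real (Polynomial.degree g) - 1 - \<epsilon>) * ht \<beta> \<le> Nz (poly g \<beta>) + Nz (inverse \<beta>) + C"
    by blast
qed

text \<open>The bound for \<open>g\<close> is applied at p(\<beta>). The degree relation deg W - 1 =
  (deg g - 1) m is of Riemann-Hurwitz type and shows that nothing is lost. The factor p' adds almost
  no zeros to those of \<open>W\<close>, as it divides a power of \<open>W\<close>, and
  \<open>p\<close>, being a polynomial, creates almost no poles; the exceptions lie in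
  \<open>B\<close>.\<close>

lemma abc_bound_compose:
  assumes g: "abc_bound g" "g \<noteq> 0" and p: "Polynomial.degree p = m" "m > 0"
    and W: "g \<circ>\<^sub>p p = pderiv p * W" "pderiv p dvd W ^ k"
  shows "abc_bound W"
  unfolding abc_bound_def
proof (intro allI impI)
  fix \<epsilon> :: real assume \<epsilon>: "\<epsilon> > 0"
  obtain q where q: "W ^ k = pderiv p * q" using W(2) by (elim dvdE)
  have p0: "p \<noteq> 0" using p by auto
  have dp0: "pderiv p \<noteq> 0" using p by (simp add: pderiv_eq_0_iff)
  have "g \<circ>\<^sub>p p \<noteq> 0" using g(2) p by (simp add: pcompose_eq_0_iff)
  then have W0: "W \<noteq> 0" using W(1) by auto
  then have q0: "q \<noteq> 0" using q by auto
  have "Polynomial.degree g * m = (m - 1) + Polynomial.degree W"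
    using arg_cong[OF W(1), of Polynomial.degree] W0 dp0 p by (simp add: degree_mult_eq degree_pderiv)
  then have "real (Polynomial.degree g) * real m = real m - 1 + real (Polynomial.degree W)"
    using p(2) by (metis (no_types, lifting) of_nat_1 of_nat_add of_nat_diff of_nat_mult Suc_leI One_nat_def)
  then have degW: "real (Polynomial.degree W) - 1 = (real (Polynomial.degree g) - 1) * real m" by (simp add: algebra_simps)
  \<comment> \<open>Heights grow by the factor \<open>m\<close>, so \<epsilon> is divided by
    it.\<close>
  define \<delta> where "\<delta> = \<epsilon> / real m"
  have "\<delta> > 0" using \<epsilon> p(2) by (simp add: \<delta>_def)
  then obtain C where C: "\<And>\<beta>. poly g \<beta> \<noteq> 0 \<Longrightarrow>
     (real (Polynomial.degree g) - 1 - \<delta>) * ht \<beta> \<le> Nz (poly g \<beta>) + Nz (inverse \<beta>) + C"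
    using g(1) unfolding abc_bound_def by blast
  obtain C1 where C1: "\<And>x. \<bar>ht (poly p x) - real m * ht x\<bar> \<le> C1" using ht_poly[OF p] by blast
  define B where "B = {v \<in> V. \<not> good v p} \<union> {v \<in> V. \<not> good v (pderiv p)} \<union> {v \<in> V. \<not> good v q}"
  have B: "finite B" "B \<subseteq> V" unfolding B_def using finite_bad by auto
  define c where "c = real (Polynomial.degree g) - 1 - \<delta>"
  have "(real (Polynomial.degree W) - 1 - \<epsilon>) * ht \<beta> \<le> Nz (poly W \<beta>) + Nz (inverse \<beta>) + (C + 2 * sum lam B + \<bar>c\<bar> * C1)"
    if Wb: "poly W \<beta> \<noteq> 0" for \<beta>
  proof -
    have "poly (W ^ k) \<beta> \<noteq> 0" using Wb by simp
    then have nz: "poly (pderiv p) \<beta> \<noteq> 0" "poly q \<beta> \<noteq> 0" unfolding q by auto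
    have gp: "poly g (poly p \<beta>) = poly (pderiv p) \<beta> * poly W \<beta>"
      using arg_cong[OF W(1), of "\<lambda>P. poly P \<beta>"] by (simp add: poly_pcompose)
    have "c * (real m * ht \<beta>) \<le> c * ht (poly p \<beta>) + \<bar>c\<bar> * C1"
    proof -
      have "c * (real m * ht \<beta> - ht (poly p \<beta>)) \<le> \<bar>c\<bar> * \<bar>real m * ht \<beta> - ht (poly p \<beta>)\<bar>"
        by (metis abs_ge_self abs_mult)
      also have "\<dots> \<le> \<bar>c\<bar> * C1" using C1[of \<beta>] by (intro mult_left_mono) (auto simp: abs_minus_commute)
      finally show ?thesis by (simp add: algebra_simps)
    qed
    also have "c * ht (poly p \<beta>) \<le> Nz (poly g (poly p \<beta>)) + Nz (inverse (poly p \<beta>)) + C"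
      unfolding c_def by (rule C) (use gp nz Wb in simp)
    also have "Nz (inverse (poly p \<beta>)) \<le> Nz (inverse \<beta>) + sum lam B"
    proof (rule Nz_mono[OF B])
      fix v assume v: "v \<in> V" "v \<notin> B" "w v (inverse (poly p \<beta>)) > 0"
      then have "good v p" "w v (poly p \<beta>) < 0" by (auto simp: B_def w_inverse)
      then have "w v \<beta> < 0" using good_poly(1)[OF v(1) _ p0, of \<beta>] by force
      then show "w v (inverse \<beta>) > 0" by (simp add: w_inverse v)
    qed
    also have "Nz (poly g (poly p \<beta>)) \<le> Nz (poly W \<beta>) + sum lam B"
    proof (rule Nz_mono[OF B])
      fix v assume v: "v \<in> V" "v \<notin> B" "w v (poly g (poly p \<beta>)) > 0"
      then have gd: "good v (pderiv p)" "good v q" by (auto simp: B_def)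
      have s: "w v (poly (pderiv p) \<beta>) + w v (poly W \<beta>) > 0"
        using v(3) unfolding gp w_mult[OF v(1) nz(1) Wb] .
      show "w v (poly W \<beta>) > 0"
      proof (rule ccontr)
        assume n: "\<not> w v (poly W \<beta>) > 0"
        then have d: "w v (poly (pderiv p) \<beta>) > 0" using s by linarith
        have "w v \<beta> \<ge> 0"
        proof (rule ccontr)
          assume "\<not> w v \<beta> \<ge> 0"
          then have "w v (poly (pderiv p) \<beta>) = int (Polynomial.degree (pderiv p)) * w v \<beta>" "w v \<beta> \<le> 0"
            using good_poly(2)[OF v(1) gd(1) dp0, of \<beta>] by auto
          then show False using d by (metis linorder_not_le mult_nonneg_nonpos of_nat_0_le_iff)
        qed
        then have "w v (poly q \<beta>) \<ge> 0" by (rule good_poly(1)[OF v(1) gd(2) q0])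
        moreover have "int k * w v (poly W \<beta>) = w v (poly (pderiv p) \<beta>) + w v (poly q \<beta>)"
          using arg_cong[OF q, of "\<lambda>P. w v (poly P \<beta>)"] w_power[OF v(1) Wb] w_mult[OF v(1) nz] by simp
        ultimately have "int k * w v (poly W \<beta>) > 0" using d by linarith
        then show False using n by (simp add: zero_less_mult_iff)
      qed
    qed
    finally have "c * (real m * ht \<beta>) \<le> Nz (poly W \<beta>) + Nz (inverse \<beta>) + (C + 2 * sum lam B + \<bar>c\<bar> * C1)" by simp
    moreover have "real (Polynomial.degree W) - 1 - \<epsilon> = c * real m"
      unfolding degW c_def using p(2) by (simp add: \<delta>_def left_diff_distrib)
    ultimately show ?thesis by (simp add: mult.assoc)
  qed
  then show "\<exists>C. \<forall>\<beta>. poly W \<beta> \<noteq> 0 \<longrightarrow>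
     (real (Polynomial.degree W) - 1 - \<epsilon>) * ht \<beta> \<le> Nz (poly W \<beta>) + Nz (inverse \<beta>) + C" by blast
qed

text \<open>Belyi's theorem in the form of an induction on the branch locus, which is given as the
  zero set of a rational polynomial.\<close>

definition belyi :: "rat poly \<Rightarrow> bool" where
  "belyi R \<longleftrightarrow> (\<forall>g::'k poly. only_simple_roots g \<longrightarrow>
     (\<forall>z. poly (map_poly to_ac g) z = 0 \<longrightarrow> rpoly R z = 0) \<longrightarrow> abc_bound g)"

lemma to_ac_of_rat: "to_ac (of_rat q :: 'k) = of_rat q"
  by (cases q) (simp add: of_rat_rat)

lemma map_to_ac_of_rat: "map_poly to_ac (map_poly of_rat p :: 'k poly) = map_poly of_rat p"
  by (rule poly_eqI) (simp add: to_ac_hom.coeff_map_poly_hom of_rat_hom.coeff_map_poly_hom to_ac_of_rat)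

text \<open>Simplicity of the roots enters here: multiplicities at most 1 reduce divisibility to
  containment of roots. Divisibility over the algebraic closure descends to the field.\<close>

lemma dvd_if_simple_roots:
  fixes g W :: "'k poly"
  assumes g: "only_simple_roots g" and W: "W \<noteq> 0"
    and roots: "\<And>z. poly (map_poly to_ac g) z = 0 \<Longrightarrow> poly (map_poly to_ac W) z = 0"
  shows "g dvd W"
proof -
  have "map_poly to_ac g dvd map_poly to_ac W"
  proof (rule dvd_if_order_le)
    show g0: "map_poly to_ac g \<noteq> 0" using g by (auto simp: only_simple_roots_def rsquarefree_def)
    show W0: "map_poly to_ac W \<noteq> 0" using W by simp
    fix z
    show "Polynomial.order z (map_poly to_ac g) \<le> Polynomial.order z (map_poly to_ac W)"
    proof (cases "poly (map_poly to_ac g) z = 0")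
      case True
      then have "Polynomial.order z (map_poly to_ac W) \<noteq> 0" using roots W0 by (simp add: order_root)
      moreover have "Polynomial.order z (map_poly to_ac g) \<le> 1"
        using g unfolding only_simple_roots_def rsquarefree_def by (metis le_numeral_extra(4) zero_le_one)
      ultimately show ?thesis by linarith
    qed (simp add: order_0I)
  qed
  then show ?thesis by (rule to_ac_hom.dvd_map_poly_hom_imp_dvd)
qed

text \<open>\<open>G\<close> has the roots of \<open>R'\<close>, each once, and \<open>W\<close> is
  the quotient of G \<circ> p by p'. The critical values of \<open>p\<close> are roots of
  \<open>G\<close>, so a critical point is a root of G \<circ> p of higher order than of p'. Hence
  \<open>W\<close> is a polynomial with the same roots as G \<circ> p, and every admissible
  \<open>g\<close> divides it.\<close>

lemma belyi_step:
  assumes R': "belyi R'" "R' \<noteq> 0" and p: "Polynomial.degree p > 0"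
    and roots: "\<And>z::'k alg_closure. rpoly R z = 0 \<Longrightarrow> rpoly R' (rpoly p z) = 0"
    and crit: "\<And>z::'k alg_closure. rpoly (pderiv p) z = 0 \<Longrightarrow> rpoly R' (rpoly p z) = 0"
  shows "belyi R"
proof -
  let ?m = "map_poly of_rat :: rat poly \<Rightarrow> 'k alg_closure poly"
  let ?k = "map_poly of_rat :: rat poly \<Rightarrow> 'k poly"
  obtain G where G: "G \<noteq> 0" "rsquarefree (?m G)" "\<And>z::'k alg_closure. rpoly G z = 0 \<longleftrightarrow> rpoly R' z = 0"
    using squarefree_part_exists[OF R'(2), where 'a = "'k alg_closure"] by blast
  have "abc_bound (?k G)"
    using R'(1) G unfolding belyi_def only_simple_roots_def map_to_ac_of_rat by (metis map_to_ac_of_rat)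
  have dp0: "pderiv p \<noteq> 0" using p by (simp add: pderiv_eq_0_iff)
  have Q0: "G \<circ>\<^sub>p p \<noteq> 0" using G(1) p by (simp add: pcompose_eq_0_iff)
  have ord: "Polynomial.order x (?m (G \<circ>\<^sub>p p)) > Polynomial.order x (?m (pderiv p))"
    if x: "rpoly (pderiv p) x = 0" for x
  proof -
    define y where "y = rpoly p x"
    have "rpoly G y = 0" using crit[OF x] G(3) by (simp add: y_def)
    then have "[:- y, 1:] dvd ?m G" by (simp add: poly_eq_0_iff_dvd)
    then have "[:- y, 1:] \<circ>\<^sub>p ?m p dvd ?m G \<circ>\<^sub>p ?m p" by (rule pcompose_hom.hom_dvd)
    moreover have "[:- y, 1:] \<circ>\<^sub>p ?m p = ?m p - [:y:]" by (simp add: pcompose_pCons)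
    ultimately have dv: "?m p - [:y:] dvd ?m (G \<circ>\<^sub>p p)" by (simp only: of_rat_hom.map_poly_pcompose)
    have nz: "?m p - [:y:] \<noteq> 0"
    proof
      assume "?m p - [:y:] = 0"
      then have "?m p = [:y:]" by simp
      then have "Polynomial.degree (?m p) = 0" by simp
      then show False using p by simp
    qed
    \<comment> \<open>p - y vanishes at \<open>x\<close> to one order more than its derivative, and
      it divides G \<circ> p.\<close>
    have "Polynomial.order x (?m p - [:y:]) = Suc (Polynomial.order x (pderiv (?m p - [:y:])))"
      by (rule order_pderiv[OF nz]) (simp add: y_def)
    also have "pderiv (?m p - [:y:]) = ?m (pderiv p)" by (simp add: pderiv_diff of_rat_hom.map_poly_pderiv)
    finally show ?thesis using dvd_imp_order_le[OF _ dv, of x] Q0 by simp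
  qed
  have "?m (pderiv p) dvd ?m (G \<circ>\<^sub>p p)"
  proof (rule dvd_if_order_le)
    show "Polynomial.order x (?m (pderiv p)) \<le> Polynomial.order x (?m (G \<circ>\<^sub>p p))" for x
      using ord[of x] by (cases "rpoly (pderiv p) x = 0") (auto simp: order_0I)
  qed (use dp0 Q0 in simp_all)
  then have "pderiv p dvd G \<circ>\<^sub>p p" by (rule of_rat_hom.dvd_map_poly_hom_imp_dvd)
  then obtain W where W: "G \<circ>\<^sub>p p = pderiv p * W" by (elim dvdE)
  have W0: "W \<noteq> 0" using W Q0 by auto
  have Wm: "?m (G \<circ>\<^sub>p p) = ?m (pderiv p) * ?m W" unfolding W by (rule of_rat_poly_hom.hom_mult)
  have Wroot: "rpoly W x = 0" if "rpoly (pderiv p) x = 0" for x :: "'k alg_closure"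
  proof -
    have "Polynomial.order x (?m (G \<circ>\<^sub>p p)) = Polynomial.order x (?m (pderiv p)) + Polynomial.order x (?m W)"
      unfolding Wm by (rule order_mult) (use dp0 W0 in simp)
    then have "Polynomial.order x (?m W) \<noteq> 0" using ord[OF that] by linarith
    then show ?thesis by (meson order_root)
  qed
  \<comment> \<open>No multiplicity in p' exceeds its degree, so this power of \<open>W\<close> is
    divisible by p'.\<close>
  define k where "k = Polynomial.degree (pderiv p)"
  have "?m (pderiv p) dvd ?m (W ^ k)"
  proof (rule dvd_if_order_le)
    fix x
    show "Polynomial.order x (?m (pderiv p)) \<le> Polynomial.order x (?m (W ^ k))"
    proof (cases "rpoly (pderiv p) x = 0")
      case True
      have "Polynomial.order x (?m (pderiv p)) \<le> k" using order_degree[of "?m (pderiv p)" x] dp0 by (simp add: k_def)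
      also have "k * 1 \<le> k * Polynomial.order x (?m W)"
        using Wroot[OF True] W0 by (intro mult_left_mono) (auto simp: order_root Suc_le_eq)
      also have "k * Polynomial.order x (?m W) = Polynomial.order x (?m (W ^ k))"
        using order_power[of "?m W" x k] W0 by (simp add: of_rat_poly_hom.hom_power)
      finally show ?thesis by simp
    qed (simp add: order_0I)
  qed (use dp0 W0 in simp_all)
  then have "pderiv p dvd W ^ k" by (rule of_rat_hom.dvd_map_poly_hom_imp_dvd)
  have "abc_bound (?k W)"
  proof (rule abc_bound_compose[OF \<open>abc_bound (?k G)\<close>])
    show "?k G \<noteq> 0" using G(1) by simp
    show "Polynomial.degree (?k p) = Polynomial.degree p" by simp
    show "?k G \<circ>\<^sub>p ?k p = pderiv (?k p) * ?k W"
      using W by (metis of_rat_hom.map_poly_pcompose of_rat_hom.map_poly_pderiv of_rat_poly_hom.hom_mult)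
    show "pderiv (?k p) dvd ?k W ^ k"
      using of_rat_poly_hom.hom_dvd[OF \<open>pderiv p dvd W ^ k\<close>] by (simp add: of_rat_hom.map_poly_pderiv of_rat_poly_hom.hom_power)
  qed (rule p)
  show ?thesis
    unfolding belyi_def
  proof (intro allI impI)
    fix g :: "'k poly" assume g: "only_simple_roots g" "\<forall>z. poly (map_poly to_ac g) z = 0 \<longrightarrow> rpoly R z = 0"
    have "g dvd ?k W"
    proof (rule dvd_if_simple_roots[OF g(1)])
      show "?k W \<noteq> 0" using W0 by simp
      fix z assume "poly (map_poly to_ac g) z = 0"
      then have "rpoly R z = 0" using g(2) by blast
      then have "rpoly G (rpoly p z) = 0" using roots G(3) by blast
      then have "rpoly (pderiv p) z * rpoly W z = 0" using W by (metis rpoly_simps(3,4))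
      then show "poly (map_poly to_ac (?k W)) z = 0" using Wroot[of z] by (auto simp: map_to_ac_of_rat)
    qed
    then obtain h where h: "?k W = g * h" by (elim dvdE)
    have "?k W \<noteq> 0" using W0 by simp
    then show "abc_bound g" using abc_bound_factor[of g h] \<open>abc_bound (?k W)\<close> unfolding h by blast
  qed
qed

lemma belyi_mono: "belyi R \<Longrightarrow> (\<And>z::'k alg_closure. rpoly R' z = 0 \<Longrightarrow> rpoly R z = 0) \<Longrightarrow> belyi R'"
  unfolding belyi_def by blast

definition vanishing :: "rat set \<Rightarrow> rat poly" where
  "vanishing T = (\<Prod>t\<in>T. [:- t, 1:])"

lemma vanishing_nonzero: "vanishing T \<noteq> 0"
  unfolding vanishing_def by (cases "finite T") auto

lemma vanishing_root:
  assumes "finite T" shows "rpoly (vanishing T) (z::'a::field_char_0) = 0 \<longleftrightarrow> z \<in> of_rat ` T"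
  using assms unfolding vanishing_def
proof (induction rule: finite_induct)
  case (insert t T)
  have "rpoly (\<Prod>t\<in>insert t T. [:- t, 1:]) z = (- of_rat t + z) * rpoly (\<Prod>t\<in>T. [:- t, 1:]) z"
    unfolding prod.insert[OF insert.hyps] rpoly_simps(3,6) of_rat_minus ..
  then show ?case using insert.IH by (auto simp: add_eq_0_iff)
qed (simp add: rpoly_simps)

end

section \<open>Reduction of the branch points to 0 and 1\<close>

locale abc_height_system = height_system V w lam Hom d
  for V :: "'v set" and w :: "'v \<Rightarrow> 'k::field_char_0 \<Rightarrow> int" and lam :: "'v \<Rightarrow> real"
    and Hom :: "('k \<Rightarrow> complex) set" and d :: real +
  assumes abc: "\<epsilon> > 0 \<Longrightarrow> \<exists>C. \<forall>\<alpha>. \<alpha> \<notin> {0, 1} \<longrightarrow>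
    (1 - \<epsilon>) * ht \<alpha> \<le> Nz \<alpha> + Nz (1 - \<alpha>) + Nz (inverse \<alpha>) + C"
begin

text \<open>\<beta> and 1 - \<beta> have no common zeros, so together they count at most the zeros
  of \<beta> (\<beta> - 1).\<close>

lemma abc_bound_base: "abc_bound [:0, -1, 1:]"
  unfolding abc_bound_def
proof (intro allI impI)
  fix \<epsilon> :: real assume "\<epsilon> > 0"
  then obtain C where C: "\<And>\<alpha>. \<alpha> \<notin> {0, 1} \<Longrightarrow>
    (1 - \<epsilon>) * ht \<alpha> \<le> Nz \<alpha> + Nz (1 - \<alpha>) + Nz (inverse \<alpha>) + C" using abc by blast
  have "(real (Polynomial.degree [:0, -1, 1 :: 'k:]) - 1 - \<epsilon>) * ht \<beta> \<le> Nz (poly [:0, -1, 1:] \<beta>) + Nz (inverse \<beta>) + C"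
    if nz: "poly [:0, -1, 1:] \<beta> \<noteq> 0" for \<beta>
  proof -
    have p: "poly [:0, -1, 1:] \<beta> = \<beta> * (\<beta> - 1)" by (simp add: algebra_simps)
    have b: "\<beta> \<noteq> 0" "\<beta> \<noteq> 1" using nz unfolding p by auto
    have b1: "\<beta> - 1 \<noteq> 0" using b by simp
    have w1: "w v (1 - \<beta>) = w v (\<beta> - 1)" if "v \<in> V" for v using w_neg[OF that, of "\<beta> - 1"] by simp
    have wp: "w v (poly [:0, -1, 1:] \<beta>) = w v \<beta> + w v (\<beta> - 1)" if "v \<in> V" for v
      unfolding p by (rule w_mult[OF that b(1) b1])
    have u: "w v (\<beta> - 1) = 0" if "v \<in> V" "w v \<beta> > 0" for v
      using w_add_dominant(2)[OF that(1), of "- 1" \<beta>] that w_one w_neg by simp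
    have u': "w v \<beta> = 0" if "v \<in> V" "w v (\<beta> - 1) > 0" for v
      using w_add_dominant(2)[OF that(1), of 1 "\<beta> - 1"] that w_one by simp
    have "Nz \<beta> + Nz (1 - \<beta>) = sum lam ({v. v \<in> V \<and> w v \<beta> > 0} \<union> {v. v \<in> V \<and> w v (1 - \<beta>) > 0})"
      unfolding Nz_def by (rule sum.union_disjoint[symmetric]) (use finite_pos u w1 in auto)
    also have "\<dots> \<le> Nz (poly [:0, -1, 1:] \<beta>)"
      unfolding Nz_def
    proof (rule sum_mono2[OF finite_pos])
      show "{v. v \<in> V \<and> w v \<beta> > 0} \<union> {v. v \<in> V \<and> w v (1 - \<beta>) > 0} \<subseteq> {v. v \<in> V \<and> w v (poly [:0, -1, 1:] \<beta>) > 0}"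
        using u u' w1 wp by auto
    qed (use lam_nonneg in auto)
    finally have "Nz \<beta> + Nz (1 - \<beta>) \<le> Nz (poly [:0, -1, 1:] \<beta>)" .
    then show ?thesis using C[of \<beta>] b by simp
  qed
  then show "\<exists>C. \<forall>\<beta>. poly [:0, -1, 1:] \<beta> \<noteq> 0 \<longrightarrow>
     (real (Polynomial.degree [:0, -1, 1 :: 'k:]) - 1 - \<epsilon>) * ht \<beta> \<le> Nz (poly [:0, -1, 1:] \<beta>) + Nz (inverse \<beta>) + C" by blast
qed

lemma belyi_base: "belyi (vanishing {0, 1})"
  unfolding belyi_def
proof (intro allI impI)
  fix g :: "'k poly" assume g: "only_simple_roots g" "\<forall>z. poly (map_poly to_ac g) z = 0 \<longrightarrow> rpoly (vanishing {0, 1}) z = 0"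
  have "g dvd [:0, -1, 1:]"
  proof (rule dvd_if_simple_roots[OF g(1)])
    fix z assume "poly (map_poly to_ac g) z = 0"
    then have "z = 0 \<or> z = 1" using g(2) vanishing_root[of "{0, 1}" z] by auto
    then show "poly (map_poly to_ac [:0, -1, 1:]) z = 0" by (auto simp: to_ac_hom.map_poly_pCons_hom)
  qed simp
  then obtain h where h: "[:0, -1, 1:] = g * h" by (elim dvdE)
  have "[:0, -1, 1:] \<noteq> (0 :: 'k poly)" by simp
  then show "abc_bound g" using abc_bound_factor[of g h] abc_bound_base unfolding h by blast
qed

text \<open>Each Belyi polynomial merges two of the rational branch points, and its critical points
  are themselves branch points; with at most two points left an affine map moves them into {0,
  1}.\<close>

lemma belyi_rational:
  assumes "finite T" shows "belyi (vanishing T)"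
  using assms
proof (induction "card T" arbitrary: T rule: less_induct)
  case less
  note finT = less.prems
  show ?case
  proof (cases "card T \<le> 2")
    case True
    obtain s t :: rat where st: "T \<subseteq> {s, t}" "s \<noteq> t"
    proof -
      consider "card T = 0" | "card T = 1" | "card T = 2" using True by linarith
      then show ?thesis
      proof cases
        case 1
        then show ?thesis using finT that[of 0 1] by auto
      next
        case 2
        then obtain s where "T = {s}" by (auto simp: card_1_singleton_iff)
        then show ?thesis using that[of s "s + 1"] by auto
      next
        case 3
        then obtain s t where "T = {s, t}" "s \<noteq> t" by (auto simp: card_2_iff)
        then show ?thesis using that by blast
      qed
    qed
    define p where "p = [:- s / (t - s), 1 / (t - s):]"
    have pz: "rpoly p (of_rat x) = of_rat ((x - s) / (t - s))" for x
      by (simp add: p_def diff_divide_distrib)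
    show ?thesis
    proof (rule belyi_step[OF belyi_base vanishing_nonzero])
      show "Polynomial.degree p > 0" using st(2) by (simp add: p_def)
      fix z :: "'k alg_closure"
      show "rpoly (vanishing {0, 1}) (rpoly p z) = 0" if "rpoly (vanishing T) z = 0"
      proof -
        have "z \<in> of_rat ` T" using that vanishing_root[OF finT] by blast
        then have "z = of_rat s \<or> z = of_rat t" using st(1) by blast
        then have "rpoly p z \<in> of_rat ` {0, 1}" using pz[of s] pz[of t] st(2) by auto
        then show ?thesis using vanishing_root[of "{0, 1}" "rpoly p z"] by simp
      qed
      show "rpoly (vanishing {0, 1}) (rpoly p z) = 0" if "rpoly (pderiv p) z = 0"
      proof -
        have "pderiv p = [:1 / (t - s):]" by (simp add: p_def pderiv_pCons)
        then have "rpoly (pderiv p) z = of_rat (1 / (t - s))" by (simp only: rpoly_simps)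
        then have False using that st(2) by simp
        then show ?thesis ..
      qed
    qed
  next
    case False
    have ne: "T \<noteq> {}" using False by auto
    \<comment> \<open>The extreme points leave \<open>t\<close> strictly between them, so the ratio
      that determines the exponents is positive.\<close>
    define s where "s = Min T"
    define r where "r = Max T"
    have sr: "s \<in> T" "r \<in> T" unfolding s_def r_def using finT ne by auto
    have "card (T - {s, r}) > 0"
      using False card_Diff_subset[of "{s, r}" T] sr card_insert_le_m1[of 2 "{r}" s] by (auto simp: card_insert_if split: if_splits)
    then obtain t where t: "t \<in> T" "t \<noteq> s" "t \<noteq> r" by (auto simp: card_gt_0_iff)
    have lt: "s < t" "t < r" using t finT by (auto simp: s_def r_def order.strict_iff_order)
    have q0: "(t - s) / (r - t) > 0" using lt by simp
    obtain a' b' where ab': "quotient_of ((t - s) / (r - t)) = (a', b')" by (cases "quotient_of ((t - s) / (r - t))")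
    have b'0: "b' > 0" using quotient_of_denom_pos[OF ab'] .
    have qe: "(t - s) / (r - t) = of_int a' / of_int b'" using quotient_of_div[OF ab'] .
    then have "(of_int a' :: rat) > 0" using q0 b'0 by (simp add: zero_less_divide_iff)
    then have a'0: "a' > 0" by simp
    define a where "a = nat a'"
    define b where "b = nat b'"
    have ab: "a > 0" "b > 0" "of_nat a = (of_int a' :: rat)" "of_nat b = (of_int b' :: rat)"
      using a'0 b'0 by (auto simp: a_def b_def)
    \<comment> \<open>The logarithmic derivative a/(x - s) - b/(r - x) of the polynomial below
      vanishes exactly at x = t.\<close>
    have rel: "of_nat b * (t - s) = of_nat a * (r - t)"
      using qe lt ab by (simp add: field_simps)
    text \<open>Belyi's polynomial: it identifies \<open>s\<close> and \<open>r\<close>, and \<open>a\<close> and \<open>b\<close> are chosen such that its only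
      critical point besides these is \<open>t\<close>.\<close>
    define p where "p = [:- s, 1:] ^ a * [:r, - 1:] ^ b"
    define T' where "T' = poly p ` T"
    have ps: "poly p s = 0" "poly p r = 0" using ab by (auto simp: p_def)
    have "T' = poly p ` (T - {s})"
    proof
      show "T' \<subseteq> poly p ` (T - {s})"
      proof
        fix y assume "y \<in> T'"
        then obtain x where x: "x \<in> T" "y = poly p x" by (auto simp: T'_def)
        show "y \<in> poly p ` (T - {s})"
        proof (cases "x = s")
          case True
          then have "y = poly p r" using x ps by simp
          moreover have "r \<in> T - {s}" using sr lt by auto
          ultimately show ?thesis by blast
        qed (use x in blast)
      qed
    qed (auto simp: T'_def)
    then have "card T' \<le> card (T - {s})" using card_image_le finT by (metis finite_Diff)
    then have cT': "card T' < card T" using sr(1) finT card_Diff1_less[of T s] by linarith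
    have finT': "finite T'" using finT by (simp add: T'_def)
    have IH: "belyi (vanishing T')" by (rule less.hyps[OF cT' finT'])
    have p0: "p \<noteq> 0" by (simp add: p_def)
    have degp: "Polynomial.degree p = a + b"
      unfolding p_def by (subst degree_mult_eq) (auto simp: degree_power_eq)
    show ?thesis
    proof (rule belyi_step[OF IH vanishing_nonzero])
      show "Polynomial.degree p > 0" using degp ab by simp
      fix z :: "'k alg_closure"
      have im: "rpoly (vanishing T') (rpoly p z) = 0" if "z \<in> of_rat ` T"
      proof -
        obtain x where x: "x \<in> T" "z = of_rat x" using \<open>z \<in> of_rat ` T\<close> by blast
        then have "rpoly p z = of_rat (poly p x)" by simp
        then show ?thesis unfolding vanishing_root[OF finT'] using x(1) by (auto simp: T'_def)
      qed
      show "rpoly (vanishing T') (rpoly p z) = 0" if "rpoly (vanishing T) z = 0"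
        using im that unfolding vanishing_root[OF finT] .
      show "rpoly (vanishing T') (rpoly p z) = 0" if cr: "rpoly (pderiv p) z = 0"
      proof -
        obtain a1 where a1: "a = Suc a1" using ab(1) by (cases a) auto
        obtain b1 where b1: "b = Suc b1" using ab(2) by (cases b) auto
        have pd0: "pderiv (A ^ Suc a1 * B ^ Suc b1) = A ^ a1 * B ^ b1 * ([:of_nat (Suc a1):] * B - [:of_nat (Suc b1):] * A)"
          if "pderiv A = 1" "pderiv B = - 1" for A B :: "rat poly"
          unfolding pderiv_mult pderiv_power_Suc that by (simp add: algebra_simps del: of_nat_Suc)
        have "pderiv p = [:- s, 1:] ^ a1 * [:r, - 1:] ^ b1 *
            ([:of_nat a:] * [:r, - 1:] - [:of_nat b:] * [:- s, 1:])"
          unfolding p_def a1 b1 by (rule pd0) (simp_all add: pderiv_pCons one_pCons)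
        also have "[:of_nat a:] * [:r, - 1:] - [:of_nat b:] * [:- s, 1:] = [:of_nat a * r + of_nat b * s, - (of_nat a + of_nat b) :: rat:]"
          by simp
        also have "of_nat a * r + of_nat b * s = (of_nat a + of_nat b) * t" using rel by (simp add: algebra_simps)
        finally have pd: "pderiv p = [:- s, 1:] ^ a1 * [:r, - 1:] ^ b1 * [:(of_nat a + of_nat b) * t, - (of_nat a + of_nat b):]" .
        have l1: "rpoly [:- s, 1:] z = z - of_rat s" by (simp add: of_rat_minus)
        have l2: "rpoly [:r, - 1:] z = of_rat r - z" by (simp add: of_rat_minus)
        have l3: "rpoly [:(of_nat a + of_nat b) * t, - (of_nat a + of_nat b):] z = of_nat (a + b) * (of_rat t - z)"
          unfolding rpoly_linear by (simp add: of_rat_minus of_rat_diff of_rat_add of_rat_mult algebra_simps)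
        have pw: "rpoly (q ^ n) z = rpoly q z ^ n" for q n by (induction n) (simp_all add: rpoly_simps)
        have "(z - of_rat s) ^ a1 * (of_rat r - z) ^ b1 * (of_nat (a + b) * (of_rat t - z)) = 0"
          using cr unfolding pd rpoly_simps(3) pw l1 l2 l3 .
        moreover have "(of_nat (a + b) :: 'k alg_closure) \<noteq> 0" using ab by (simp del: of_nat_add)
        ultimately have "z = of_rat s \<or> z = of_rat r \<or> z = of_rat t" by (auto simp del: of_nat_add)
        then show ?thesis using im sr t(1) by blast
      qed
    qed
  qed
qed

lemma rpoly_prod_list: "rpoly (prod_list L) z = 0 \<longleftrightarrow> (\<exists>q\<in>set L. rpoly q z = 0)"
  by (induction L) (auto simp: rpoly_simps)

text \<open>The branch locus is kept as a list of factors, since roots are pushed forward factor by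
  factor to control the degrees. If all degrees are at most 1, the roots are rational and
  \<open>belyi_rational\<close> finishes.\<close>

lemma belyi_prod_list:
  assumes "\<And>q. q \<in> set L \<Longrightarrow> q \<noteq> 0" shows "belyi (prod_list L)"
  using assms
\<comment> \<open>The measure must decrease when \<open>p\<close> of degree e \<ge> 2 gives way to
  factors of degrees 1 and at most e - 1: indeed 3 + 3^(e - 1) < 3^e, while base 2 would give
  equality for e = 2.\<close>
proof (induction "\<Sum>q\<leftarrow>L. (3::nat) ^ Polynomial.degree q" arbitrary: L rule: less_induct)
  case less
  show ?case
  proof (cases "\<exists>p\<in>set L. Polynomial.degree p \<ge> 2")
    case False
    define T where "T = (\<lambda>q. - Polynomial.coeff q 0 / Polynomial.coeff q 1) ` set L"
    have fT: "finite T" by (simp add: T_def)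
    show ?thesis
    proof (rule belyi_mono[OF belyi_rational[OF fT]])
      fix z :: "'k alg_closure" assume "rpoly (prod_list L) z = 0"
      then obtain q where q: "q \<in> set L" "rpoly q z = 0" unfolding rpoly_prod_list by blast
      have dq: "Polynomial.degree q \<le> 1" using False q(1) by force
      have "q = [:Polynomial.coeff q 0, Polynomial.coeff q 1:]"
        by (rule poly_eqI) (use dq in \<open>auto simp: coeff_pCons coeff_eq_0 split: nat.splits\<close>)
      then obtain a b where ab: "q = [:a, b:]" by blast
      have eq: "of_rat a + z * of_rat b = 0" using q(2) unfolding ab rpoly_linear .
      have "b \<noteq> 0"
      proof
        assume "b = 0"
        then have "a = 0" using eq by simp
        then show False using less.prems[OF q(1)] \<open>b = 0\<close> by (simp add: ab)
      qed
      then have "z = of_rat (- a / b)" using eq by (simp add: of_rat_divide of_rat_minus field_simps eq_neg_iff_add_eq_0)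
      moreover have "- a / b \<in> T" unfolding T_def using q(1) by (intro image_eqI[of _ _ q]) (simp_all add: ab)
      ultimately show "rpoly (vanishing T) z = 0" unfolding vanishing_root[OF fT] by blast
    qed
  next
    case True
    then obtain p where p: "p \<in> set L" "Polynomial.degree p \<ge> 2" by blast
    have "\<forall>q. \<exists>s. q \<noteq> 0 \<longrightarrow> s \<noteq> 0 \<and> Polynomial.degree s \<le> Polynomial.degree q \<and> q dvd s \<circ>\<^sub>p p"
      using pcompose_multiple_exists by blast
    then obtain S where S: "\<And>q. q \<noteq> 0 \<Longrightarrow> S q \<noteq> 0 \<and> Polynomial.degree (S q) \<le> Polynomial.degree q \<and> q dvd S q \<circ>\<^sub>p p" by metis
    text \<open>Pushing forward along a factor \<open>p\<close> itself replaces it by \<open>X\<close> and the critical values, at the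
      cost of degree \<open>deg p - 1\<close> only.\<close>
    define L' where "L' = remove1 p L"
    define M where "M = [:0, 1:] # S (pderiv p) # map S L'"
    have L'L: "set L' \<subseteq> set L" unfolding L'_def by (rule set_remove1_subset)
    have dp: "pderiv p \<noteq> 0" using p(2) by (simp add: pderiv_eq_0_iff)
    have M0: "q \<noteq> 0" if "q \<in> set M" for q
      using that S dp less.prems L'L by (auto simp: M_def)
    have sumL: "(\<Sum>q\<leftarrow>L. (3::nat) ^ Polynomial.degree q) = 3 ^ Polynomial.degree p + (\<Sum>q\<leftarrow>L'. 3 ^ Polynomial.degree q)"
      unfolding L'_def using p(1) by (rule sum_list_map_remove1)
    have "(\<Sum>q\<leftarrow>M. (3::nat) ^ Polynomial.degree q) =
        3 + (3 ^ Polynomial.degree (S (pderiv p)) + (\<Sum>q\<leftarrow>L'. 3 ^ Polynomial.degree (S q)))"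
      by (simp add: M_def o_def)
    also have "(\<Sum>q\<leftarrow>L'. (3::nat) ^ Polynomial.degree (S q)) \<le> (\<Sum>q\<leftarrow>L'. 3 ^ Polynomial.degree q)"
      by (rule sum_list_mono) (use S less.prems L'L in \<open>auto intro!: power_increasing\<close>)
    also have "(3::nat) ^ Polynomial.degree (S (pderiv p)) \<le> 3 ^ (Polynomial.degree p - 1)"
      using S[OF dp] by (intro power_increasing) (auto simp: degree_pderiv)
    also have "3 + (3 ^ (Polynomial.degree p - 1) + (\<Sum>q\<leftarrow>L'. 3 ^ Polynomial.degree q)) <
        3 ^ Polynomial.degree p + (\<Sum>q\<leftarrow>L'. (3::nat) ^ Polynomial.degree q)"
    proof -
      obtain j where "Polynomial.degree p = 2 + j" using le_Suc_ex[OF p(2)] by blast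
      then have j: "Polynomial.degree p = Suc (Suc j)" by simp
      have "(3::nat) ^ j \<ge> 1" by simp
      then show ?thesis unfolding j power_Suc diff_Suc_1 by linarith
    qed
    finally have lt: "(\<Sum>q\<leftarrow>M. (3::nat) ^ Polynomial.degree q) < (\<Sum>q\<leftarrow>L. 3 ^ Polynomial.degree q)"
      unfolding sumL by simp
    have IH: "belyi (prod_list M)" by (rule less.hyps[OF lt M0])
    have Sroot: "rpoly (S q) (rpoly p z) = 0" if "q \<noteq> 0" "rpoly q z = 0" for q and z :: "'k alg_closure"
    proof -
      have "q dvd S q \<circ>\<^sub>p p" using S[OF that(1)] by blast
      then obtain h where "S q \<circ>\<^sub>p p = q * h" by (elim dvdE)
      then have "rpoly (S q) (rpoly p z) = rpoly q z * rpoly h z" by (metis rpoly_simps(3,4))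
      then show ?thesis using that(2) by simp
    qed
    show ?thesis
    proof (rule belyi_step[OF IH])
      show "prod_list M \<noteq> 0" using M0 by (auto simp: prod_list_zero_iff)
      show "Polynomial.degree p > 0" using p(2) by simp
      fix z :: "'k alg_closure"
      show "rpoly (prod_list M) (rpoly p z) = 0" if "rpoly (prod_list L) z = 0"
      proof -
        obtain q where q: "q \<in> set L" "rpoly q z = 0" using \<open>rpoly (prod_list L) z = 0\<close> unfolding rpoly_prod_list by blast
        show ?thesis
        proof (cases "q = p")
          case True
          then have "rpoly [:0, 1:] (rpoly p z) = 0" using q(2) by (simp add: rpoly_simps)
          then show ?thesis unfolding rpoly_prod_list M_def by simp
        next
          case False
          then have "q \<in> set L'" using q(1) by (simp add: L'_def)
          moreover have "rpoly (S q) (rpoly p z) = 0" by (rule Sroot[OF less.prems[OF q(1)] q(2)])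
          ultimately show ?thesis unfolding rpoly_prod_list M_def by auto
        qed
      qed
      show "rpoly (prod_list M) (rpoly p z) = 0" if "rpoly (pderiv p) z = 0"
        using Sroot[OF dp that] unfolding rpoly_prod_list M_def by simp
    qed
  qed
qed

text \<open>A rational multiple \<open>R\<close> of \<open>f\<close> supplies a branch locus defined
  over the rationals.\<close>

theorem abc_bound_simple_roots:
  assumes nf: "number_field TYPE('k)" and f: "only_simple_roots f"
  shows "abc_bound f"
proof -
  have "f \<noteq> 0" using f by (auto simp: only_simple_roots_def rsquarefree_def)
  then obtain R :: "rat poly" where R: "R \<noteq> 0" "f dvd map_poly of_rat R"
    using rational_multiple_exists[OF nf] by blast
  have "belyi (prod_list [R])" by (rule belyi_prod_list) (use R in auto)
  moreover have "rpoly R z = 0" if "poly (map_poly to_ac f) z = 0" for z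
  proof -
    have "map_poly to_ac f dvd map_poly to_ac (map_poly of_rat R)" using R(2) by (rule to_ac_poly_hom.hom_dvd)
    then show ?thesis using that unfolding map_to_ac_of_rat by (auto elim!: dvdE)
  qed
  ultimately show ?thesis using f unfolding belyi_def by simp
qed

end

section \<open>Orbits\<close>

context abc_height_system
begin

text \<open>Coefficients integral at \<open>v\<close> respect congruences; the Horner step writes
  the difference of values as (x - y) p(x) + (p(x) - p(y)) y.\<close>

lemma good_congruence:
  assumes v: "v \<in> V" and good: "good v p" and x: "w v x \<ge> 0" and y: "w v y \<ge> 0"
    and xy: "x = y \<or> w v (x - y) > 0"
  shows "poly p x = poly p y \<or> w v (poly p x - poly p y) > 0"
proof -
  define pos where "pos = (\<lambda>z. z = 0 \<or> w v z > 0)"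
  have pos_add: "pos (a + b)" if "pos a" "pos b" for a b
    using that w_add[OF v, of a b] by (cases "a = 0 \<or> b = 0 \<or> a + b = 0") (auto simp: pos_def)
  have pos_mult: "pos (a * b)" if "pos a" "w v b \<ge> 0" for a b
    using that w_mult[OF v, of a b] by (cases "a = 0 \<or> b = 0") (auto simp: pos_def)
  have "pos (poly p x - poly p y)" using good
  proof (induction p)
    case (pCons a p)
    have gp: "good v p"
      unfolding good_def
    proof
      fix i show "w v (Polynomial.coeff p i) = 0"
        using pCons.prems spec[of "\<lambda>i. w v (Polynomial.coeff (pCons a p) i) = 0" "Suc i"] by (simp add: good_def)
    qed
    have wp: "w v (poly p x) \<ge> 0"
      by (cases "p = 0") (use good_poly(1)[OF v gp] x in \<open>auto simp: w_zero\<close>)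
    have "poly (pCons a p) x - poly (pCons a p) y = (x - y) * poly p x + (poly p x - poly p y) * y"
      by (simp add: algebra_simps)
    moreover have "pos ((x - y) * poly p x)" using xy wp by (intro pos_mult) (auto simp: pos_def)
    moreover have "pos ((poly p x - poly p y) * y)" using pCons.IH[OF gp] y by (intro pos_mult)
    ultimately show ?case using pos_add by simp
  qed (simp add: pos_def)
  then show ?thesis by (auto simp: pos_def)
qed

text \<open>Stated for an abstract height system, with \<open>B\<close> as the set of places where
  \<open>a\<close> may have poles. All constants of the proof are independent of \<open>n\<close>,
  \<open>l\<close> and \<open>a\<close>, so one bound on h(\<alpha>) covers the whole set.\<close>

theorem finite_power_multiples_in_orbits:
  fixes f :: "'k poly"
  assumes nf: "number_field TYPE('k)" and deg: "Polynomial.degree f \<ge> 3" and simple: "only_simple_roots f"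
    and nonper: "\<And>n. n \<ge> 1 \<Longrightarrow> (poly f ^^ n) 0 \<noteq> 0" and B: "finite B" "B \<subseteq> V"
  shows "finite {\<alpha>. \<exists>(n::nat) (l::int) a. n \<ge> 1 \<and> l \<noteq> 0 \<and> l \<noteq> 1 \<and> (\<forall>v\<in>V - B. w v a \<ge> 0) \<and>
     (l < 0 \<longrightarrow> a \<noteq> 0) \<and> (poly f ^^ n) \<alpha> = (a powi l) * \<alpha>}" (is "finite ?A")
proof -
  define D where "D = Polynomial.degree f"
  have D3: "D \<ge> 3" using deg by (simp add: D_def)
  have f0: "f \<noteq> 0" using deg by auto
  obtain C0 where C0: "\<And>x. \<bar>ht (poly f x) - real D * ht x\<bar> \<le> C0" using ht_poly[of f D] D3 D_def by auto
  have C0n: "C0 \<ge> 0" using C0[of 0] by linarith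
  \<comment> \<open>The offset \<open>C0\<close> reproduces itself in the recursion h(f(x)) \<ge> D
    h(x) - C0, because 2 C0 \<le> D C0.\<close>
  have iter: "ht ((poly f ^^ k) x) \<ge> real D ^ k * (ht x - C0) + C0" for k x
  proof (induction k)
    case (Suc k)
    have "real D ^ Suc k * (ht x - C0) + C0 \<le> real D * (real D ^ k * (ht x - C0) + C0) - C0"
    proof -
      have "2 * C0 \<le> real D * C0" using D3 C0n by (intro mult_right_mono) auto
      then show ?thesis by (simp add: algebra_simps)
    qed
    also have "\<dots> \<le> real D * ht ((poly f ^^ k) x) - C0" using Suc by (intro diff_right_mono mult_left_mono) auto
    also have "\<dots> \<le> ht (poly f ((poly f ^^ k) x))" using C0[of "(poly f ^^ k) x"] by linarith
    finally show ?case by simp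
  qed simp
  have iter': "ht x \<le> ht ((poly f ^^ k) x) / real D ^ k + C0" for k x
  proof -
    have "(ht x - C0) * real D ^ k \<le> ht ((poly f ^^ k) x)" using iter[of k x] C0n by (simp add: mult.commute)
    moreover have "real D ^ k > 0" using D3 by simp
    ultimately have "ht x - C0 \<le> ht ((poly f ^^ k) x) / real D ^ k" by (simp add: pos_le_divide_eq)
    then show ?thesis by linarith
  qed
  have iter1: "ht x \<le> ht ((poly f ^^ k) x) + C0" for k x
  proof -
    have "real D ^ k \<ge> 1" using D3 by (intro one_le_power) simp
    then have "ht ((poly f ^^ k) x) / real D ^ k \<le> ht ((poly f ^^ k) x) / 1"
      using ht_nonneg D3 by (intro divide_left_mono) auto
    then show ?thesis using iter'[of x k] by simp
  qed
  have "abc_bound f" by (rule abc_bound_simple_roots[OF nf simple])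
  then have "\<exists>C. \<forall>\<beta>. poly f \<beta> \<noteq> 0 \<longrightarrow>
      (real (Polynomial.degree f) - 1 - 1 / 8) * ht \<beta> \<le> Nz (poly f \<beta>) + Nz (inverse \<beta>) + C"
    unfolding abc_bound_def by (meson zero_less_divide_1_iff zero_less_numeral)
  then obtain C2 where C2: "\<And>\<beta>. poly f \<beta> \<noteq> 0 \<Longrightarrow>
      (real D - 1 - 1 / 8) * ht \<beta> \<le> Nz (poly f \<beta>) + Nz (inverse \<beta>) + C2"
    unfolding D_def by blast
  \<comment> \<open>Outside \<open>S\<close> the number \<open>a\<close> is integral and
    \<open>f\<close> has good coefficients, so integrality, poles and congruences propagate along
    orbits.\<close>
  define S where "S = B \<union> {v \<in> V. \<not> good v f}"
  have S: "finite S" "S \<subseteq> V" unfolding S_def using B finite_bad by auto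
  define s where "s = sum lam S"
  have s0: "s \<ge> 0" unfolding s_def by (rule sum_nonneg) (use S lam_nonneg in blast)
  define M where "M = Nz (poly f 0) + Nz (poly f (poly f 0))"
  have M0: "M \<ge> 0" using Nz_nonneg by (simp add: M_def)
  define K0 where "K0 = 2 * s + 2 * C0 + M + C2"
  define K where "K = 4 * \<bar>K0\<bar> + C0"
  have goodS: "good v f" if "v \<in> V" "v \<notin> S" for v using that by (auto simp: S_def)
  have iter_int: "w v ((poly f ^^ k) x) \<ge> 0" if "v \<in> V" "v \<notin> S" "w v x \<ge> 0" for v k x
    by (induction k) (use that good_poly(1)[OF that(1) goodS[OF that(1,2)] f0] in auto)
  have iter_pole: "w v ((poly f ^^ k) x) = int (D ^ k) * w v x" if v: "v \<in> V" "v \<notin> S" and x: "w v x < 0" for v k x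
  proof (induction k)
    case (Suc k)
    have "w v ((poly f ^^ k) x) < 0" unfolding Suc using x D3 by (intro mult_pos_neg) auto
    then have "w v (poly f ((poly f ^^ k) x)) = int D * w v ((poly f ^^ k) x)"
      using good_poly(2)[OF v(1) goodS[OF v] f0] by (simp add: D_def)
    then show ?case using Suc by simp
  qed simp
  text \<open>A place outside \<open>S\<close> at which both \<open>\<alpha>\<close> and its image vanish divides \<open>f^n(0)\<close>. This
    settles \<open>n \<le> 2\<close>; for larger \<open>n\<close> the height of \<open>\<alpha>\<close> is negligible.\<close>
  have common: "Nz' \<le> ht ((poly f ^^ k) \<alpha>) / 8 + C0 + M"
    if Nz': "Nz' = sum lam {v \<in> V - S. w v \<alpha> > 0 \<and> w v ((poly f ^^ Suc k) \<alpha>) > 0}" for \<alpha> k Nz'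
  proof (cases "k \<ge> 2")
    case True
    have "Nz' \<le> Nz \<alpha>" unfolding Nz' Nz_def by (rule sum_mono2[OF finite_pos]) (use lam_nonneg in auto)
    also have "\<dots> \<le> ht \<alpha>" by (rule Nz_le_ht)
    also have "\<dots> \<le> ht ((poly f ^^ k) \<alpha>) / real D ^ k + C0" by (rule iter')
    also have "ht ((poly f ^^ k) \<alpha>) / real D ^ k \<le> ht ((poly f ^^ k) \<alpha>) / 8"
    proof -
      have "(8::real) \<le> 3 ^ 2" by simp
      also have "\<dots> \<le> real D ^ 2" using D3 by (intro power_mono) auto
      also have "\<dots> \<le> real D ^ k" using D3 True by (intro power_increasing) auto
      finally show ?thesis using ht_nonneg D3 by (intro divide_left_mono) auto
    qed
    finally show ?thesis using M0 by simp
  next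
    case False
    then have k: "k = 0 \<or> k = 1" by linarith
    have "Nz' \<le> Nz ((poly f ^^ Suc k) 0)"
      unfolding Nz' Nz_def
    proof (rule sum_mono2[OF finite_pos])
      show "{v \<in> V - S. w v \<alpha> > 0 \<and> w v ((poly f ^^ Suc k) \<alpha>) > 0} \<subseteq> {v. v \<in> V \<and> w v ((poly f ^^ Suc k) 0) > 0}"
      proof
        fix v assume "v \<in> {v \<in> V - S. w v \<alpha> > 0 \<and> w v ((poly f ^^ Suc k) \<alpha>) > 0}"
        then have v: "v \<in> V" "v \<notin> S" "w v \<alpha> > 0" "w v ((poly f ^^ Suc k) \<alpha>) > 0" by auto
        have cong: "(poly f ^^ j) \<alpha> = (poly f ^^ j) 0 \<or> w v ((poly f ^^ j) \<alpha> - (poly f ^^ j) 0) > 0" for j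
        proof (induction j)
          case (Suc j)
          show ?case using good_congruence[OF v(1) goodS[OF v(1,2)] _ _ Suc] iter_int[OF v(1,2)] v(3)
            by (simp add: w_zero)
        qed (use v in simp)
        define a where "a = (poly f ^^ Suc k) \<alpha>"
        define b where "b = (poly f ^^ Suc k) 0"
        \<comment> \<open>Nonperiodicity of 0 makes \<open>b\<close> nonzero; only then is its
          valuation meaningful, and positive at the common zeros.\<close>
        have ab: "a = b \<or> w v (a - b) > 0" "w v a > 0" "b \<noteq> 0"
          using cong[of "Suc k"] v(4) nonper[of "Suc k"] by (auto simp: a_def b_def)
        have "w v b > 0"
        proof (cases "a = b")
          case False
          then have "w v (- (a - b)) > 0" using ab w_neg[OF v(1), of "a - b"] by simp
          moreover have "a \<noteq> 0" using ab(2) w_zero by auto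
          ultimately show ?thesis using w_add[OF v(1), of a "- (a - b)"] ab False by auto
        qed (use ab in simp)
        then show "v \<in> {v. v \<in> V \<and> w v ((poly f ^^ Suc k) 0) > 0}" using v(1) by (simp add: b_def)
      qed
    qed (use lam_nonneg in auto)
    also have "\<dots> \<le> M" using k Nz_nonneg[of "poly f 0"] Nz_nonneg[of "poly f (poly f 0)"] by (auto simp: M_def)
    finally show ?thesis using ht_nonneg[of "(poly f ^^ k) \<alpha>"] C0n by simp
  qed
  have "?A \<subseteq> {\<alpha>. ht \<alpha> \<le> K}"
  proof
    fix \<alpha> assume "\<alpha> \<in> ?A"
    then obtain n :: nat and l :: int and a where n: "n \<ge> 1" and l: "l \<noteq> 0" "l \<noteq> 1"
      and a: "\<forall>v\<in>V - B. w v a \<ge> 0" "l < 0 \<longrightarrow> a \<noteq> 0" and eq: "(poly f ^^ n) \<alpha> = (a powi l) * \<alpha>" by blast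
    obtain k where k: "n = Suc k" using n by (cases n) auto
    define \<beta> where "\<beta> = (poly f ^^ k) \<alpha>"
    have f\<beta>: "poly f \<beta> = a powi l * \<alpha>" using eq by (simp add: k \<beta>_def)
    show "\<alpha> \<in> {\<alpha>. ht \<alpha> \<le> K}"
    proof (cases "poly f \<beta> = 0")
      case True
      \<comment> \<open>Here the abc bound says nothing, but f^n(\<alpha>) = 0 bounds h(\<alpha>)
        directly.\<close>
      then have "ht \<alpha> \<le> ht 0 + C0" using iter1[of \<alpha> n] by (simp add: k \<beta>_def)
      then show ?thesis by (simp add: ht_zero K_def)
    next
      case nz: False
      then have \<alpha>0: "\<alpha> \<noteq> 0" and al0: "a powi l \<noteq> 0" unfolding f\<beta> by auto
      have a0: "a \<noteq> 0"
      proof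
        assume "a = 0"
        then have "a powi l = 0" using l(1) by simp
        with al0 show False ..
      qed
      have wf: "w v (poly f \<beta>) = l * w v a + w v \<alpha>" if "v \<in> V" for v
        unfolding f\<beta> using w_mult[OF that al0 \<alpha>0] w_powi[OF that a0] by simp
      have wa: "w v a \<ge> 0" if "v \<in> V" "v \<notin> S" for v using a(1) that by (auto simp: S_def)
      define Nz' where "Nz' = sum lam {v \<in> V - S. w v \<alpha> > 0 \<and> w v (poly f \<beta>) > 0}"
      have fin': "finite {v \<in> V - S. w v \<alpha> > 0 \<and> w v (poly f \<beta>) > 0}"
        by (rule finite_subset[OF _ finite_pos[of \<alpha>]]) auto
      have N': "Nz' \<le> ht \<beta> / 8 + C0 + M" using common[of Nz' \<alpha> k] by (simp add: Nz'_def \<beta>_def)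
      have main: "(real D - 1 - 1 / 8) * ht \<beta> \<le> Nz (poly f \<beta>) + Nz (inverse \<beta>) + C2" by (rule C2[OF nz])
      have h\<beta>: "ht \<beta> \<ge> 0" by (rule ht_nonneg)
      have "ht \<beta> \<le> 4 * \<bar>K0\<bar>"
      proof (cases "l < 0")
        case True
        have "Nz (poly f \<beta>) \<le> sum lam ({v \<in> V - S. w v \<alpha> > 0 \<and> w v (poly f \<beta>) > 0} \<union> S)"
          unfolding Nz_def
        proof (rule sum_mono2)
          show "{v. v \<in> V \<and> w v (poly f \<beta>) > 0} \<subseteq> {v \<in> V - S. w v \<alpha> > 0 \<and> w v (poly f \<beta>) > 0} \<union> S"
          proof (intro subsetI UnCI, goal_cases)
            case (1 v)
            then have "l * w v a \<le> 0" using True wa[of v] by (intro mult_nonpos_nonneg) auto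
            then show ?case using 1 wf[of v] by auto
          qed
        qed (use fin' S lam_nonneg in auto)
        also have "\<dots> \<le> Nz' + s" unfolding Nz'_def s_def
          by (subst sum.union_disjoint) (use fin' S in auto)
        finally have "Nz (poly f \<beta>) \<le> Nz' + s" .
        moreover have "Nz (inverse \<beta>) \<le> ht \<beta>" by (rule Nz_inverse_le_ht)
        ultimately have "(real D - 1 - 1 / 8) * ht \<beta> \<le> ht \<beta> / 8 + C0 + M + s + ht \<beta> + C2" using main N' by linarith
        \<comment> \<open>One h(\<beta>) pays for the poles of \<beta> and two eighths are lost; 3/4
          of h(\<beta>) remain.\<close>
        moreover have "2 * ht \<beta> \<le> (real D - 1) * ht \<beta>" using D3 h\<beta> by (intro mult_right_mono) auto
        ultimately have "3 / 4 * ht \<beta> \<le> K0" unfolding K0_def using s0 C0n by (simp add: left_diff_distrib)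
        then show ?thesis using h\<beta> by linarith
      next
        case False
        then have l2: "l \<ge> 2" using l by linarith
        \<comment> \<open>At a pole of \<alpha> outside \<open>S\<close> the order of the pole of
          f^n(\<alpha>) is multiplied by D^n, whereas a^l \<alpha> has at most the pole of \<alpha>.
          So \<alpha> is integral there, and with it the orbit.\<close>
        have w\<alpha>: "w v \<alpha> \<ge> 0" if v: "v \<in> V" "v \<notin> S" for v
        proof (rule ccontr)
          assume n0: "\<not> w v \<alpha> \<ge> 0"
          then have "w v (poly f \<beta>) = int (D ^ n) * w v \<alpha>"
            using iter_pole[OF v, of \<alpha> n] by (simp add: k \<beta>_def)
          moreover have "w v (poly f \<beta>) \<ge> w v \<alpha>" using wf[OF v(1)] wa[OF v] l2 by simp
          moreover have "int (D ^ n) * w v \<alpha> \<le> 2 * w v \<alpha>"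
          proof (rule mult_right_mono_neg)
            have "D ^ 1 \<le> D ^ n" using n D3 by (intro power_increasing) auto
            then show "2 \<le> int (D ^ n)" using D3 by (simp del: of_nat_power)
          qed (use n0 in simp)
          ultimately show False using n0 by linarith
        qed
        have "Nz (inverse \<beta>) \<le> Nz 1 + sum lam S"
        proof (rule Nz_mono[OF S])
          fix v assume v: "v \<in> V" "v \<notin> S" "w v (inverse \<beta>) > 0"
          then show "w v 1 > 0" using iter_int[OF v(1,2) w\<alpha>[OF v(1,2)], of k] by (simp add: w_inverse \<beta>_def)
        qed
        moreover have "Nz 1 = 0"
        proof -
          have "{v. v \<in> V \<and> w v 1 > 0} = {}" using w_one by auto
          then show ?thesis unfolding Nz_def by (simp only: sum.empty)
        qed
        ultimately have inv: "Nz (inverse \<beta>) \<le> s" by (simp add: s_def)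
        define A where "A = {v \<in> V - S. w v a > 0}"
        have finA: "finite A" unfolding A_def by (rule finite_subset[OF _ finite_pos[of a]]) auto
        have A2: "w v (poly f \<beta>) \<ge> 2" if "v \<in> A" for v
        proof -
          have v: "v \<in> V" "v \<notin> S" "w v a \<ge> 1" using that by (auto simp: A_def)
          have "2 * 1 \<le> l * w v a" using l2 v(3) by (intro mult_mono) auto
          then show ?thesis using wf[OF v(1)] w\<alpha>[OF v(1,2)] by simp
        qed
        have "2 * sum lam A = (\<Sum>v\<in>A. 2 * lam v)" by (simp add: sum_distrib_left)
        also have "\<dots> \<le> (\<Sum>v\<in>A. of_int (w v (poly f \<beta>)) * lam v)"
        proof (rule sum_mono, rule mult_right_mono)
          fix v assume v: "v \<in> A"
          show "2 \<le> real_of_int (w v (poly f \<beta>))" using A2[OF v] by linarith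
          show "0 \<le> lam v" using v lam_nonneg by (auto simp: A_def)
        qed
        also have "\<dots> \<le> (\<Sum>v | v \<in> V \<and> w v (poly f \<beta>) > 0. of_int (w v (poly f \<beta>)) * lam v)"
        proof (rule sum_mono2[OF finite_pos])
          show "A \<subseteq> {v. v \<in> V \<and> w v (poly f \<beta>) > 0}" using A2 by (force simp: A_def)
        qed (use lam_nonneg in auto)
        also have "\<dots> \<le> ht (poly f \<beta>)" by (rule sum_pos_val_le_ht[OF nz])
        also have "\<dots> \<le> real D * ht \<beta> + C0" using C0[of \<beta>] by linarith
        finally have sA: "2 * sum lam A \<le> real D * ht \<beta> + C0" .
        \<comment> \<open>From here on \<open>B\<close> is the set of common zeros counted by
          \<open>Nz'\<close>, no longer the exceptional set.\<close>
        define B where "B = {v \<in> V - S. w v \<alpha> > 0 \<and> w v (poly f \<beta>) > 0}"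
        have finB: "finite B" unfolding B_def by (rule fin')
        have "Nz (poly f \<beta>) \<le> sum lam (A \<union> B \<union> S)"
          unfolding Nz_def
        proof (rule sum_mono2)
          show "{v. v \<in> V \<and> w v (poly f \<beta>) > 0} \<subseteq> A \<union> B \<union> S"
          proof
            fix v assume v: "v \<in> {v. v \<in> V \<and> w v (poly f \<beta>) > 0}"
            then show "v \<in> A \<union> B \<union> S"
              using wf[of v] wa[of v] w\<alpha>[of v] by (cases "w v a = 0") (auto simp: A_def B_def)
          qed
        qed (use finB finA S lam_nonneg in \<open>auto simp: A_def B_def\<close>)
        also have "\<dots> \<le> sum lam (A \<union> B) + s"
          unfolding s_def by (subst sum.union_disjoint) (use finB finA S in \<open>auto simp: A_def B_def\<close>)
        finally have "Nz (poly f \<beta>) \<le> sum lam (A \<union> B) + s" .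
        moreover have "sum lam (A \<union> B) \<le> sum lam A + Nz'"
        proof -
          have "sum lam (A \<inter> B) \<ge> 0"
            by (rule sum_nonneg) (use lam_nonneg in \<open>auto simp: A_def\<close>)
          then show ?thesis using sum.union_inter[OF finA finB, of lam] by (simp add: Nz'_def B_def)
        qed
        ultimately have "Nz (poly f \<beta>) \<le> sum lam A + Nz' + s" by linarith
        then have "2 * Nz (poly f \<beta>) \<le> real D * ht \<beta> + C0 + 2 * (ht \<beta> / 8 + C0 + M) + 2 * s"
          using sA N' unfolding distrib_left by linarith
        then have "2 * ((real D - 1 - 1 / 8) * ht \<beta>) \<le> real D * ht \<beta> + C0 + 2 * (ht \<beta> / 8 + C0 + M) + 4 * s + 2 * C2"
          using main inv by linarith
        moreover have "3 * ht \<beta> \<le> real D * ht \<beta>" using D3 h\<beta> by (intro mult_right_mono) auto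
        \<comment> \<open>Everything is doubled: the coefficient of h(\<beta>) is 2 (D - 9/8) - D -
          1/4 = D - 5/2 \<ge> 1/2.\<close>
        ultimately have "1 / 2 * ht \<beta> \<le> 2 * K0" unfolding K0_def using s0 C0n by (simp add: left_diff_distrib)
        then show ?thesis using h\<beta> by linarith
      qed
      then show ?thesis using iter1[of \<alpha> k] by (simp add: K_def \<beta>_def)
    qed
  qed
  then show ?thesis by (rule finite_subset) (rule northcott_ht)
qed

end

section \<open>Number fields\<close>

lemma field_degree_pos:
  assumes "number_field TYPE('k::field_char_0)" shows "field_degree TYPE('k) > 0"
proof -
  obtain B where "finite_dimensional_vector_space (rat_scale :: rat \<Rightarrow> 'k \<Rightarrow> 'k) B"
    using assms by (auto simp: number_field_def)
  then interpret V: finite_dimensional_vector_space "rat_scale :: rat \<Rightarrow> 'k \<Rightarrow> 'k" B .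
  have "B \<noteq> {}"
  proof
    assume "B = {}"
    then have "(1::'k) \<in> {0}" using V.span_Basis V.span_empty by (metis UNIV_I)
    then show False by simp
  qed
  then have "card B > 0" using V.finite_Basis by (simp add: card_gt_0_iff)
  moreover have "V.dim UNIV = card B" by (rule V.dim_UNIV)
  ultimately show ?thesis by (simp add: field_degree_def)
qed

lemma cnj_embedding: "\<sigma> \<in> complex_embeddings \<Longrightarrow> cnj \<circ> \<sigma> \<in> complex_embeddings"
  by (auto simp: complex_embeddings_def Ring.ring_hom_def ring_of_type_algebra_def)

lemma ln_max_powr: "r \<ge> 0 \<Longrightarrow> e > 0 \<Longrightarrow> ln (max (r powr e) 1) = e * ln (max 1 (r::real))"
proof (cases "r \<le> 1")
  case True
  assume "r \<ge> 0" "e > 0"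
  then have "r powr e \<le> 1 powr e" using True by (intro powr_mono2) auto
  then show ?thesis using True by (simp add: max_def)
next
  case False
  assume "e > 0"
  then have "1 powr e \<le> r powr e" using False by (intro powr_mono2) auto
  then show ?thesis using False by (simp add: max_def ln_powr)
qed

context
  assumes nf: "number_field TYPE('k::field_char_0)"
begin

definition weight :: "'k place \<Rightarrow> real" where
  "weight v = ln (real (ideal_norm (prime_of v))) / real (field_degree TYPE('k))"

text \<open>The weights carry the factor 1/degree, which turns \<open>product_formula\<close> and
  \<open>northcott_places\<close> into their normalised forms.\<close>

lemma height_system: "height_system (nonarch_places :: 'k place set) val weight complex_embeddings (real (field_degree TYPE('k)))"
proof (rule height_system.intro)
  let ?V = "nonarch_places :: 'k place set"
  have deg: "real (field_degree TYPE('k)) > 0" using field_degree_pos[OF nf] by simp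
  then show "real (field_degree TYPE('k)) > 0" .
  have V: "\<exists>P. v = Nonarch P \<and> integral_prime P" if "v \<in> ?V" for v
    using that by (auto simp: nonarch_places_eq)
  fix v :: "'k place" and x y :: 'k
  show "val v (x * y) = val v x + val v y" if "v \<in> ?V" "x \<noteq> 0" "y \<noteq> 0"
    using V[OF that(1)] that val_mult_prime[OF nf] by blast
  show "min (val v x) (val v y) \<le> val v (x + y)" if "v \<in> ?V" "x \<noteq> 0" "y \<noteq> 0" "x + y \<noteq> 0"
    using V[OF that(1)] that val_add_prime[OF nf] by blast
  show "val v 0 = 0" by simp
  have sets: "{v \<in> ?V. val v x \<noteq> 0} = Nonarch ` {P. integral_prime P \<and> val (Nonarch P) x \<noteq> 0}" for x
    by (auto simp: nonarch_places_eq)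
  show "finite {v \<in> ?V. val v x \<noteq> 0}"
    unfolding sets by (rule finite_imageI) (rule finite_val_nonzero[OF nf])
  show "weight v > 0" if v: "v \<in> ?V"
  proof -
    obtain P where P: "v = Nonarch P" "integral_prime P" using V[OF v] by blast
    have "real (ideal_norm P) \<ge> 2" using prime_residues(3)[OF nf P(2)] by simp
    then show ?thesis using deg by (simp add: weight_def P)
  qed
  show "finite (complex_embeddings :: ('k \<Rightarrow> complex) set)" by (rule finite_complex_embeddings[OF nf])
  show "field_hom \<sigma>" if "\<sigma> \<in> complex_embeddings" for \<sigma> :: "'k \<Rightarrow> complex"
    by (rule complex_embeddingsD(5)[OF that])
  show "(\<Sum>v | v \<in> ?V \<and> val v x \<noteq> 0. of_int (val v x) * weight v) =
      (\<Sum>\<sigma>\<in>complex_embeddings. ln (cmod (\<sigma> x))) / real (field_degree TYPE('k))" if x: "x \<noteq> 0"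
  proof -
    have "(\<Sum>v\<in>{v \<in> ?V. val v x \<noteq> 0}. of_int (val v x) * weight v) =
        (\<Sum>P | integral_prime P \<and> val (Nonarch P) x \<noteq> 0. of_int (val (Nonarch P) x) * weight (Nonarch P))"
      unfolding sets by (subst sum.reindex) (auto simp: inj_on_def)
    also have "\<dots> = (\<Sum>P | integral_prime P \<and> val (Nonarch P) x \<noteq> 0. of_int (val (Nonarch P) x) * ln (real (ideal_norm P))) / real (field_degree TYPE('k))"
      by (simp add: weight_def sum_divide_distrib)
    finally show ?thesis using product_formula[OF nf x] by simp
  qed
  show "finite {x::'k. (\<forall>v\<in>?V. val v x < 0 \<longrightarrow> of_int (- val v x) * weight v \<le> B) \<and>
      (\<forall>\<sigma>\<in>complex_embeddings. cmod (\<sigma> x) \<le> C)}" for B C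
  proof (rule finite_subset[OF _ northcott_places[OF nf, of "B * real (field_degree TYPE('k))" C]], rule subsetI)
    fix x :: 'k assume "x \<in> {x. (\<forall>v\<in>?V. val v x < 0 \<longrightarrow> of_int (- val v x) * weight v \<le> B) \<and>
      (\<forall>\<sigma>\<in>complex_embeddings. cmod (\<sigma> x) \<le> C)}"
    then have x: "\<And>v. v \<in> ?V \<Longrightarrow> val v x < 0 \<Longrightarrow> of_int (- val v x) * weight v \<le> B"
      "\<forall>\<sigma>\<in>complex_embeddings. cmod (\<sigma> x) \<le> C" by auto
    have "of_int (- val (Nonarch P) x) * ln (real (ideal_norm P)) \<le> B * real (field_degree TYPE('k))"
      if "integral_prime P" "val (Nonarch P) x < 0" for P
    proof -
      have "of_int (- val (Nonarch P) x) * weight (Nonarch P) \<le> B"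
        by (rule x(1)) (use that in \<open>auto simp: nonarch_places_eq\<close>)
      then show ?thesis using deg by (simp add: weight_def pos_divide_le_eq pos_le_divide_eq field_simps)
    qed
    then show "x \<in> {x. (\<forall>P. integral_prime P \<longrightarrow> val (Nonarch P) x < 0 \<longrightarrow>
        of_int (- val (Nonarch P) x) * ln (real (ideal_norm P)) \<le> B * real (field_degree TYPE('k))) \<and>
      (\<forall>\<sigma>\<in>complex_embeddings. cmod (\<sigma> x) \<le> C)}" using x(2) by blast
  qed
qed

interpretation hs: height_system "nonarch_places :: 'k place set" val weight complex_embeddings "real (field_degree TYPE('k))"
  by (rule height_system)

text \<open>The local degree \<open>card E\<close> in the exponent counts the embeddings of the
  conjugate pair, which share one absolute value. So summing over pairs is summing over all
  embeddings, real ones forming singletons.\<close>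

lemma arch_places_sum:
  "(\<Sum>v\<in>arch_places. ln (max (place_abs v (x::'k)) 1)) =
    (\<Sum>\<sigma>\<in>complex_embeddings. ln (max 1 (cmod (\<sigma> x)))) / real (field_degree TYPE('k))"
proof -
  define E where "E = (\<lambda>\<sigma>::'k \<Rightarrow> complex. {\<sigma>, cnj \<circ> \<sigma>}) ` complex_embeddings"
  define L where "L = (\<lambda>\<sigma>::'k \<Rightarrow> complex. ln (max 1 (cmod (\<sigma> x))))"
  have ap: "arch_places = Arch ` E"
    unfolding arch_places_def E_def complex_embeddings_def by (simp add: image_image)
  have deg: "real (field_degree TYPE('k)) > 0" using field_degree_pos[OF nf] by simp
  have local_term: "ln (max (place_abs (Arch e) x) 1) = (\<Sum>\<sigma>\<in>e. L \<sigma>) / real (field_degree TYPE('k))" if e: "e \<in> E" for e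
  proof -
    obtain \<sigma> where \<sigma>: "\<sigma> \<in> complex_embeddings" "e = {\<sigma>, cnj \<circ> \<sigma>}" using e unfolding E_def by blast
    have same: "cmod (\<tau> x) = cmod (\<sigma> x)" if "\<tau> \<in> e" for \<tau> using that \<sigma>(2) by auto
    define \<tau> where "\<tau> = (SOME \<tau>. \<tau> \<in> e)"
    have "\<tau> \<in> e" unfolding \<tau>_def by (rule someI[of _ \<sigma>]) (simp add: \<sigma>)
    have card: "card e > 0" using \<sigma>(2) by (simp add: card_gt_0_iff)
    have "place_abs (Arch e) x = cmod (\<sigma> x) powr (real (card e) / real (field_degree TYPE('k)))"
      using same[OF \<open>\<tau> \<in> e\<close>] by (simp add: place_abs_def \<tau>_def)
    then have "ln (max (place_abs (Arch e) x) 1) = real (card e) / real (field_degree TYPE('k)) * L \<sigma>"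
      using ln_max_powr[of "cmod (\<sigma> x)" "real (card e) / real (field_degree TYPE('k))"] card deg by (simp add: L_def)
    also have "real (card e) * L \<sigma> = (\<Sum>\<tau>\<in>e. L \<tau>)"
      using same by (simp add: L_def)
    then have "real (card e) / real (field_degree TYPE('k)) * L \<sigma> = (\<Sum>\<tau>\<in>e. L \<tau>) / real (field_degree TYPE('k))" by simp
    finally show ?thesis .
  qed
  have "(\<Sum>v\<in>arch_places. ln (max (place_abs v x) 1)) = (\<Sum>e\<in>E. ln (max (place_abs (Arch e) x) 1))"
    unfolding ap by (subst sum.reindex) (auto simp: inj_on_def)
  also have "\<dots> = (\<Sum>e\<in>E. \<Sum>\<sigma>\<in>e. L \<sigma>) / real (field_degree TYPE('k))"
    unfolding sum_divide_distrib by (rule sum.cong) (auto simp: local_term sum_divide_distrib)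
  also have "(\<Sum>e\<in>E. \<Sum>\<sigma>\<in>e. L \<sigma>) = (\<Sum>\<sigma>\<in>\<Union>E. L \<sigma>)"
  proof (rule sum.Union_disjoint[symmetric, unfolded o_def])
    show "\<forall>A\<in>E. finite A" by (auto simp: E_def)
    have cc: "cnj \<circ> (cnj \<circ> \<sigma>) = \<sigma>" for \<sigma> :: "'k \<Rightarrow> complex" by (simp add: fun_eq_iff)
    have cls: "e = {\<tau>, cnj \<circ> \<tau>}" if "e \<in> E" "\<tau> \<in> e" for e \<tau>
      using that cc by (auto simp: E_def)
    show "\<forall>A\<in>E. \<forall>B\<in>E. A \<noteq> B \<longrightarrow> A \<inter> B = {}" using cls by blast
  qed
  also have "\<Union>E = complex_embeddings" using cnj_embedding by (auto simp: E_def)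
  finally show ?thesis by (simp add: L_def)
qed

lemma place_abs_nonarch:
  assumes v: "v \<in> nonarch_places" and x: "(x::'k) \<noteq> 0"
  shows "ln (place_abs v x) = of_int (- val v x) * weight v" "place_abs v x > 0"
proof -
  obtain P where P: "v = Nonarch P" "integral_prime P" using v by (auto simp: nonarch_places_eq)
  have "real (ideal_norm P) \<ge> 2" using prime_residues(3)[OF nf P(2)] by simp
  then have N: "real (ideal_norm P) > 0" by simp
  have abs: "place_abs v x = real (ideal_norm P) powr (- of_int (val v x) / real (field_degree TYPE('k)))"
    using x by (simp add: place_abs_def P)
  show "place_abs v x > 0" unfolding abs using N by simp
  show "ln (place_abs v x) = of_int (- val v x) * weight v"
    unfolding abs using N by (simp add: ln_powr weight_def P)
qed

text \<open>At finite places without a pole the summand vanishes, also for x = 0, where the absolute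
  value is 0. So the infinite sum is finite and matches \<open>hs.ht\<close> at the finite places
  term by term.\<close>

lemma weil_height_eq: "weil_height x = hs.ht (x::'k)"
proof -
  define g where "g = (\<lambda>v. ln (max (place_abs v x) 1))"
  define F where "F = {v. v \<in> nonarch_places \<and> val v x < 0}"
  have finA: "finite (arch_places :: 'k place set)"
    using finite_complex_embeddings[OF nf] by (simp add: arch_places_def complex_embeddings_def)
  have finF: "finite F" unfolding F_def by (rule hs.finite_neg)
  have zero: "g v = 0" if v: "v \<in> nonarch_places" "v \<notin> F" for v
  proof (cases "x = 0")
    case True
    then show ?thesis using v(1) by (auto simp: g_def place_abs_def nonarch_places_def)
  next
    case False
    have "ln (place_abs v x) \<le> 0" using place_abs_nonarch(1)[OF v(1) False] v hs.lam_pos[OF v(1)]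
      by (auto simp: F_def mult_nonneg_nonneg less_imp_le)
    then have "place_abs v x \<le> 1" using place_abs_nonarch(2)[OF v(1) False] by simp
    then show ?thesis by (simp add: g_def max_def)
  qed
  have val_g: "g v = of_int (- val v x) * weight v" if v: "v \<in> F" for v
  proof -
    have x: "x \<noteq> 0" and vn: "v \<in> nonarch_places" using v by (auto simp: F_def)
    have "of_int (- val v x) * weight v \<ge> 0" using v hs.pole_term_nonneg by (simp add: F_def)
    then have "place_abs v x \<ge> 1" using place_abs_nonarch[OF vn x] by (metis ln_ge_zero_imp_ge_one)
    then show ?thesis using place_abs_nonarch(1)[OF vn x] by (simp add: g_def max_def)
  qed
  have "weil_height x = (\<Sum>\<^sub>\<infinity>v\<in>places. g v)" by (simp add: weil_height_def g_def)
  also have "\<dots> = (\<Sum>\<^sub>\<infinity>v\<in>F \<union> arch_places. g v)"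
    by (rule infsum_cong_neutral) (use zero in \<open>auto simp: places_def F_def\<close>)
  also have "\<dots> = (\<Sum>v\<in>F \<union> arch_places. g v)" using finF finA by (intro infsum_finite) auto
  also have "\<dots> = (\<Sum>v\<in>F. g v) + (\<Sum>v\<in>arch_places. g v)"
    by (rule sum.union_disjoint[OF finF finA]) (auto simp: F_def nonarch_places_def arch_places_def)
  also have "(\<Sum>v\<in>F. g v) = (\<Sum>v\<in>F. of_int (- val v x) * weight v)" using val_g by (intro sum.cong) auto
  also have "(\<Sum>v\<in>arch_places. g v) = (\<Sum>\<sigma>\<in>complex_embeddings. ln (max 1 (cmod (\<sigma> x)))) / real (field_degree TYPE('k))"
    unfolding g_def by (rule arch_places_sum)
  finally show ?thesis by (simp add: hs.ht_def F_def)
qed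

text \<open>A uniformizer has valuation 1, so the logarithm of the absolute value of its inverse is
  the weight of the place, whichever uniformizer is chosen.\<close>

lemma abc_height_system_if_abc_conjecture:
  assumes \<pi>: "uniformizers (\<pi> :: 'k place \<Rightarrow> 'k)" and abc: "abc_conjecture \<pi>"
  shows "abc_height_system (nonarch_places :: 'k place set) val weight complex_embeddings (real (field_degree TYPE('k)))"
proof (intro abc_height_system.intro height_system, unfold_locales)
  fix \<epsilon> :: real assume \<epsilon>: "\<epsilon> > 0"
  have w: "ln (place_abs v (1 / \<pi> v)) = weight v" if v: "v \<in> nonarch_places" for v
  proof -
    have one: "val v (\<pi> v) = 1" using \<pi> v by (simp add: uniformizers_def)
    then have nz: "\<pi> v \<noteq> 0" by auto
    have "val v (1 / \<pi> v) = - 1" using hs.w_inverse[OF v, of "\<pi> v"] one by (simp add: inverse_eq_divide)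
    then show ?thesis using place_abs_nonarch(1)[OF v, of "1 / \<pi> v"] nz by simp
  qed
  have N: "(\<Sum>v \<in> {v \<in> nonarch_places. val v y > 0}. ln (place_abs v (1 / \<pi> v))) = hs.Nz y" for y
    unfolding hs.Nz_def by (rule sum.cong) (auto simp: w)
  obtain C where "\<forall>\<alpha>. \<alpha> \<notin> {0, 1} \<longrightarrow> (1 - \<epsilon>) * weil_height \<alpha> \<le>
      (\<Sum>v \<in> {v \<in> nonarch_places. val v \<alpha> > 0}. ln (place_abs v (1 / \<pi> v)))
    + (\<Sum>v \<in> {v \<in> nonarch_places. val v (1 - \<alpha>) > 0}. ln (place_abs v (1 / \<pi> v)))
    + (\<Sum>v \<in> {v \<in> nonarch_places. val v (1 / \<alpha>) > 0}. ln (place_abs v (1 / \<pi> v))) + C"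
    using abc \<epsilon> unfolding abc_conjecture_def by blast
  then show "\<exists>C. \<forall>\<alpha>. \<alpha> \<notin> {0, 1} \<longrightarrow>
      (1 - \<epsilon>) * hs.ht \<alpha> \<le> hs.Nz \<alpha> + hs.Nz (1 - \<alpha>) + hs.Nz (inverse \<alpha>) + C"
    unfolding N weil_height_eq inverse_eq_divide by blast
qed

end

lemma to_ac_iterate:
  "(poly (map_poly to_ac f) ^^ n) (to_ac x) = to_ac ((poly f ^^ n) (x::'k::field_char_0))"
  by (induction n) (simp_all add: to_ac_hom.poly_map_poly)

theorem theorem1p6:
  fixes f :: "'k::field_char_0 poly"
    and \<pi> :: "'k place \<Rightarrow> 'k"
    and S :: "'k place set"
  assumes "number_field TYPE('k)"
    and "uniformizers \<pi>"
    and "abc_conjecture \<pi>"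
    and "Polynomial.degree f \<ge> 3"
    and "only_simple_roots f"
    and "0 \<notin> Per f"
    and "finite S" and "S \<subseteq> places"
  shows "finite (\<V> f S)"
proof -
  interpret abc_height_system "nonarch_places :: 'k place set" val weight complex_embeddings "real (field_degree TYPE('k))"
    by (rule abc_height_system_if_abc_conjecture[OF assms(1-3)])
  have nonper: "(poly f ^^ n) 0 \<noteq> 0" if "n \<ge> 1" for n
  proof
    assume "(poly f ^^ n) 0 = 0"
    then have "(poly (map_poly to_ac f) ^^ n) 0 = 0" using to_ac_iterate[of n f 0] by simp
    then show False using assms(6) that by (auto simp: Per_def)
  qed
  \<comment> \<open>Archimedean places do not affect S-integrality, so only the finite places of
    \<open>S\<close> are passed on.\<close>
  have "finite {\<alpha>. \<exists>(n::nat) (l::int) a. n \<ge> 1 \<and> l \<noteq> 0 \<and> l \<noteq> 1 \<and>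
      (\<forall>v\<in>nonarch_places - (S \<inter> nonarch_places). val v a \<ge> 0) \<and>
      (l < 0 \<longrightarrow> a \<noteq> 0) \<and> (poly f ^^ n) \<alpha> = (a powi l) * \<alpha>}"
    by (rule finite_power_multiples_in_orbits[OF assms(1,4,5) nonper]) (use assms(7) in auto)
  moreover have "\<V> f S \<subseteq> {\<alpha>. \<exists>(n::nat) (l::int) a. n \<ge> 1 \<and> l \<noteq> 0 \<and> l \<noteq> 1 \<and>
      (\<forall>v\<in>nonarch_places - (S \<inter> nonarch_places). val v a \<ge> 0) \<and>
      (l < 0 \<longrightarrow> a \<noteq> 0) \<and> (poly f ^^ n) \<alpha> = (a powi l) * \<alpha>}"
  proof
    fix \<alpha> assume "\<alpha> \<in> \<V> f S"
    then obtain n :: nat and l :: int and a where "n \<ge> 1" "l \<noteq> 0" "l \<noteq> 1" "a \<in> S_integers S" "l < 0 \<longrightarrow> a \<noteq> 0"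
      "(poly f ^^ n) \<alpha> = (a powi l) * \<alpha>" unfolding \<V>_def by blast
    \<comment> \<open>For a = 0 the default \<open>val v 0 = 0\<close> meets the condition as
      well.\<close>
    moreover have "\<forall>v\<in>nonarch_places - (S \<inter> nonarch_places). val v a \<ge> 0"
      using \<open>a \<in> S_integers S\<close> by (auto simp: S_integers_def)
    ultimately show "\<alpha> \<in> {\<alpha>. \<exists>(n::nat) (l::int) a. n \<ge> 1 \<and> l \<noteq> 0 \<and> l \<noteq> 1 \<and>
      (\<forall>v\<in>nonarch_places - (S \<inter> nonarch_places). val v a \<ge> 0) \<and>
      (l < 0 \<longrightarrow> a \<noteq> 0) \<and> (poly f ^^ n) \<alpha> = (a powi l) * \<alpha>}" by blast
  qed
  ultimately show ?thesis by (rule finite_subset[rotated])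
qed

end
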